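(* Let $n\ge 3$ be an integer and let $\epsilon\in I_n$. Let $\kappa(s)$ be the curvature of the strictly convex curve $Q=\{(x,y)\in\mathbb{R}^2 : x^2+y^2+\epsilon y^n=1\}$ in some arc-length parameter $s$. Let $\xi\in\mathbb{R}/\mathbb{Z}$ be the angular variable defined by $$C\frac{d\xi}{ds}=\kappa^{2/3}(s),\qquad C=\int_Q\kappa^{2/3}\,ds.$$ Let $\delta$ be the distance of the set of singularities and zeros of the curvature $\kappa(\xi)$ to the real axis. There exists $\eta_n\in\mathbb{R}$ (depending only on $n$) such that $$2\pi\delta=\frac{|\log\epsilon|}{n}+\eta_n+O(\epsilon^{2/n}\log\epsilon),\qquad\text{as }\epsilon\to 0^+.$$
   Context: When $n$ is odd, the algebraic curve $x^2+y^2+\epsilon y^n=1$ has several real connected components, and $Q$ denotes only the one that tends to the circle $x^2+y^2=1$ as $\epsilon\to 0$. $I_n=(0,\epsilon_n)$, where $\epsilon_n$ is the maximal positive parameter (possibly $+\infty$) such that $Q$ is analytic and strictly convex for all $\epsilon\in(0,\epsilon_n)$. By abuse of notation, $\kappa(\xi)=\kappa(s_0(\xi))$, where $s=s_0(\xi)$ is the inverse of the solution $\xi=\xi_0(s)$ of the differential equation defining $\xi$ with $\xi_0(0)=0$. It is a $1$-periodic real analytic function which does not vanish on the reals, and is extended analytically to complex $\xi$. The number $\delta=\delta(n,\epsilon)>0$ is such that $\kappa(\xi)$ is analytic and does not vanish on the open complex strip $\{\xi\in\mathbb{C}:|\operatorname{Im}\xi|<\delta\}$ and has singularities and/or zeros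 on the boundary of this strip. *)

theory Defs
  imports "HOL-Complex_Analysis.Complex_Analysis" "HOL-Library.Landau_Symbols"
begin

definition algebraic_curve :: "nat \<Rightarrow> real \<Rightarrow> (real \<times> real) set" where
  "algebraic_curve n \<epsilon> = {(x, y). x\<^sup>2 + y\<^sup>2 + \<epsilon> * y ^ n = 1}"

text \<open>For odd \<open>n\<close> only the component tending to the unit circle is kept. All the algebraic
  curves pass through \<open>(1, 0)\<close>, and it is the component of this point that tends to the circle;
  see \<open>Q_tends_to_circle\<close> below.\<close>

definition Q :: "nat \<Rightarrow> real \<Rightarrow> (real \<times> real) set" where
  "Q n \<epsilon> = (if even n then algebraic_curve n \<epsilon>
            else connected_component_set (algebraic_curve n \<epsilon>) (1, 0))"

text \<open>Real analyticity on the whole line, as the existence of a holomorphic extension to a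
  complex neighbourhood of the real axis.\<close>

definition real_analytic :: "(real \<Rightarrow> real) \<Rightarrow> bool" where
  "real_analytic f \<longleftrightarrow> (\<exists>g. g analytic_on \<real> \<and> (\<forall>t. g (complex_of_real t) = complex_of_real (f t)))"

text \<open>\<open>\<gamma>\<close> is an analytic arc-length parametrization of the simple closed curve \<open>S\<close> of length \<open>L\<close>.\<close>

definition arclength_param :: "(real \<times> real) set \<Rightarrow> real \<Rightarrow> (real \<Rightarrow> real \<times> real) \<Rightarrow> bool" where
  "arclength_param S L \<gamma> \<longleftrightarrow>
     0 < L \<and> (\<forall>s. \<gamma> (s + L) = \<gamma> s) \<and> inj_on \<gamma> {0..<L} \<and> range \<gamma> = S \<and>
     real_analytic (\<lambda>s. fst (\<gamma> s)) \<and> real_analytic (\<lambda>s. snd (\<gamma> s)) \<and>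
     (\<forall>s. norm (vector_derivative \<gamma> (at s)) = 1)"

text \<open>\<open>\<gamma>\<close> is assumed to be parametrized by arc length.\<close>

definition curvature :: "(real \<Rightarrow> real \<times> real) \<Rightarrow> real \<Rightarrow> real" where
  "curvature \<gamma> s = norm (vector_derivative (\<lambda>t. vector_derivative \<gamma> (at t)) (at s))"

text \<open>Strict convexity is meant in the differential-geometric sense: the curve bounds a convex
  region and its curvature never vanishes.\<close>

definition analytic_strictly_convex_curve :: "(real \<times> real) set \<Rightarrow> bool" where
  "analytic_strictly_convex_curve S \<longleftrightarrow>
     S = frontier (convex hull S) \<and>
     (\<exists>L \<gamma>. arclength_param S L \<gamma> \<and> (\<forall>s. 0 < curvature \<gamma> s))"

definition eps_max :: "nat \<Rightarrow> ereal" where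
  "eps_max n = Sup {ereal e | e. 0 < e \<and> (\<forall>t\<in>{0<..<e}. analytic_strictly_convex_curve (Q n t))}"

definition param_interval :: "nat \<Rightarrow> real set" where
  "param_interval n = {\<epsilon>. 0 < \<epsilon> \<and> ereal \<epsilon> < eps_max n}"

definition C_const :: "real \<Rightarrow> (real \<Rightarrow> real \<times> real) \<Rightarrow> real" where
  "C_const L \<gamma> = integral {0..L} (\<lambda>s. curvature \<gamma> s powr (2/3))"

definition xi0 :: "real \<Rightarrow> (real \<Rightarrow> real \<times> real) \<Rightarrow> real \<Rightarrow> real" where
  "xi0 L \<gamma> = (THE \<xi>. \<xi> 0 = 0 \<and>
     (\<forall>s. (\<xi> has_real_derivative (curvature \<gamma> s powr (2/3) / C_const L \<gamma>)) (at s)))"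

definition kappa_xi :: "real \<Rightarrow> (real \<Rightarrow> real \<times> real) \<Rightarrow> real \<Rightarrow> real" where
  "kappa_xi L \<gamma> \<xi> = curvature \<gamma> (inv (xi0 L \<gamma>) \<xi>)"

text \<open>\<open>f\<close> extends to a zero-free holomorphic function \<open>F\<close> on the open strip of half-width \<open>d\<close>,
  and some boundary point of the strip is a singularity or a zero of \<open>F\<close>: there \<open>F\<close> has no
  holomorphic continuation with a nonzero value.\<close>

definition strip_halfwidth :: "(real \<Rightarrow> real) \<Rightarrow> real \<Rightarrow> bool" where
  "strip_halfwidth f d \<longleftrightarrow> 0 < d \<and>
     (\<exists>F. F holomorphic_on {z. \<bar>Im z\<bar> < d} \<and>
          (\<forall>x. F (complex_of_real x) = complex_of_real (f x)) \<and>
          (\<forall>z. \<bar>Im z\<bar> < d \<longrightarrow> F z \<noteq> 0) \<and>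
          (\<exists>z0. \<bar>Im z0\<bar> = d \<and>
             \<not> (\<exists>r>0. \<exists>G. G holomorphic_on ball z0 r \<and> G z0 \<noteq> 0 \<and>
                   (\<forall>z\<in>ball z0 r. \<bar>Im z\<bar> < d \<longrightarrow> G z = F z))))"

definition delta :: "real \<Rightarrow> (real \<Rightarrow> real \<times> real) \<Rightarrow> real" where
  "delta L \<gamma> = (THE d. strip_halfwidth (kappa_xi L \<gamma>) d)"

lemma Q_near_circle:
  assumes n: "odd n" and e: "0 < \<epsilon>" "\<epsilon> * 2 ^ n < 3" and p: "p \<in> Q n \<epsilon>"
  shows "\<exists>q\<in>sphere 0 1. dist p q \<le> \<epsilon> * 2 ^ n"
proof -
  let ?A = "algebraic_curve n \<epsilon>"
  obtain T where T: "connected T" "T \<subseteq> ?A" "(1,0) \<in> T" "p \<in> T"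
    using p n by (auto simp: Q_def connected_component_def)
  obtain x y where xy: "p = (x,y)" by (cases p)
  have eq: "x\<^sup>2 + y\<^sup>2 + \<epsilon> * y ^ n = 1" using T xy by (auto simp: algebraic_curve_def)
  have con: "connected (snd ` T)"
    by (intro connected_continuous_image T continuous_intros)
  have lo: "-2 < y"
  proof (rule ccontr)
    assume "\<not> -2 < y"
    moreover have "y \<in> snd ` T" "0 \<in> snd ` T" using T xy by force+
    ultimately have "-2 \<in> snd ` T"
      using con by (auto intro: connectedD_interval[of "snd ` T" y 0])
    then obtain w where "(w,-2) \<in> T" by force
    then have "w\<^sup>2 + 4 + \<epsilon> * (-2) ^ n = 1" using T by (auto simp: algebraic_curve_def)
    then have "w\<^sup>2 = \<epsilon> * 2 ^ n - 3" using n by (simp add: power_minus_odd)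
    then show False using e zero_le_power2[of w] by linarith
  qed
  have hi: "y < 2"
  proof (rule ccontr)
    assume "\<not> y < 2"
    then have "2\<^sup>2 \<le> y\<^sup>2" "0 \<le> \<epsilon> * y ^ n" using e power_mono[of 2 y 2] by auto
    then show False using eq zero_le_power2[of x] by simp
  qed
  have "\<bar>y\<bar> ^ n \<le> 2 ^ n" using lo hi by (intro power_mono) auto
  then have small: "\<bar>\<epsilon> * y ^ n\<bar> \<le> \<epsilon> * 2 ^ n" using e by (simp add: abs_mult power_abs)
  have np: "(norm p)\<^sup>2 = x\<^sup>2 + y\<^sup>2" by (simp add: xy norm_Pair)
  then have "\<bar>(norm p)\<^sup>2 - 1\<bar> \<le> \<epsilon> * 2 ^ n" using eq small by simp
  moreover have "\<bar>norm p - 1\<bar> \<le> \<bar>(norm p)\<^sup>2 - 1\<bar>"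
  proof -
    have "(norm p)\<^sup>2 - 1 = (norm p - 1) * (norm p + 1)"
      by (simp add: power2_eq_square algebra_simps)
    then have "\<bar>(norm p)\<^sup>2 - 1\<bar> = \<bar>norm p - 1\<bar> * (norm p + 1)" by (simp add: abs_mult)
    then show ?thesis by (simp add: mult_le_cancel_left1)
  qed
  moreover have p0: "p \<noteq> 0"
  proof
    assume "p = 0"
    then have "x = 0" "y = 0" using xy by (auto simp: zero_prod_def)
    then show False using eq n by (cases n) auto
  qed
  moreover have "dist p (sgn p) = \<bar>norm p - 1\<bar>"
  proof -
    have "p = norm p *\<^sub>R sgn p" using p0 by (simp add: sgn_div_norm)
    then have "p - sgn p = (norm p - 1) *\<^sub>R sgn p" by (metis scaleR_left_diff_distrib scaleR_one)
    then show ?thesis using p0 by (simp add: dist_norm norm_sgn)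
  qed
  ultimately have "dist p (sgn p) \<le> \<epsilon> * 2 ^ n" "sgn p \<in> sphere 0 1" by (auto simp: norm_sgn)
  then show ?thesis by blast
qed

lemma circle_near_Q:
  assumes n: "odd n" and e: "0 < \<epsilon>" and q: "q \<in> sphere 0 1"
  shows "\<exists>p\<in>Q n \<epsilon>. dist q p \<le> sqrt \<epsilon> + \<epsilon>"
proof -
  define P where "P y = 1 - y\<^sup>2 - \<epsilon> * y ^ n" for y :: real
  have n0: "n > 0" using n by (cases n) auto
  have contP: "continuous_on A P" for A unfolding P_def by (intro continuous_intros)
  have "\<exists>b. 0 \<le> b \<and> b \<le> 1 \<and> P b = 0"
    by (rule IVT2') (use e n0 contP in \<open>auto simp: P_def zero_power\<close>)
  then obtain b where b: "0 \<le> b" "b \<le> 1" "P b = 0" by blast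
  have Ppos: "0 \<le> P y" if "-1 \<le> y" "y \<le> b" for y
  proof (cases "0 \<le> y")
    case True
    then have "y\<^sup>2 \<le> b\<^sup>2" "\<epsilon> * y ^ n \<le> \<epsilon> * b ^ n"
      using that e by (auto intro!: power_mono mult_left_mono)
    then show ?thesis using b(3) by (simp add: P_def)
  next
    case False
    then have "\<epsilon> * y ^ n \<le> 0" using n e
      by (intro mult_nonneg_nonpos) (auto simp: power_le_zero_eq)
    moreover have "y\<^sup>2 \<le> 1" using False that by (simp add: abs_square_le_1)
    ultimately show ?thesis by (simp add: P_def)
  qed
  define S1 where "S1 = (\<lambda>y. (sqrt (P y), y)) ` {-1..b}"
  define S2 where "S2 = (\<lambda>y. (- sqrt (P y), y)) ` {-1..b}"
  have "connected S1" "connected S2" unfolding S1_def S2_def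
    by (intro connected_continuous_image continuous_intros contP connected_Icc)+
  moreover have "(0,b) \<in> S1" "(0,b) \<in> S2" using b by (force simp: S1_def S2_def)+
  ultimately have con: "connected (S1 \<union> S2)" by (blast intro: connected_Un)
  have sub: "S1 \<union> S2 \<subseteq> algebraic_curve n \<epsilon>"
    using Ppos by (auto simp: S1_def S2_def algebraic_curve_def P_def)
  have "(1,0) \<in> S1 \<union> S2" using b n0 by (auto simp: S1_def P_def image_iff intro!: bexI[of _ 0])
  then have inQ: "S1 \<union> S2 \<subseteq> Q n \<epsilon>"
    using connected_component_maximal[OF _ con sub, of "(1, 0)"] n by (simp add: Q_def)
  obtain u v where uv: "q = (u,v)" by (cases q)
  have uv1: "u\<^sup>2 + v\<^sup>2 = 1" using q by (simp add: uv norm_Pair real_sqrt_eq_1_iff)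
  then have v: "-1 \<le> v" "v \<le> 1"
    using abs_square_le_1[of v] zero_le_power2[of u] by auto
  have dsum: "dist (u,v) (x,y) \<le> \<bar>u - x\<bar> + \<bar>v - y\<bar>" for x y
    using sqrt_sum_squares_le_sum_abs[of "u - x" "v - y"] by (simp add: dist_Pair_Pair dist_real_def)
  show ?thesis
  proof (cases "v \<le> b")
    case True
    have "P v = u\<^sup>2 - \<epsilon> * v ^ n" using uv1 by (simp add: P_def)
    moreover have "\<bar>v ^ n\<bar> \<le> 1" using v by (simp add: power_abs power_le_one)
    then have "\<bar>\<epsilon> * v ^ n\<bar> \<le> \<epsilon>" using e by (simp add: abs_mult)
    ultimately have le: "\<bar>u\<^sup>2 - P v\<bar> \<le> \<epsilon>" by simp
    have "\<bar>\<bar>u\<bar> - sqrt (P v)\<bar>\<^sup>2 \<le> \<bar>u\<^sup>2 - P v\<bar>"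
    proof -
      have s: "(sqrt (P v))\<^sup>2 = P v" using Ppos v True by simp
      have "\<bar>\<bar>u\<bar> - sqrt (P v)\<bar> \<le> \<bar>u\<bar> + sqrt (P v)" using real_sqrt_ge_zero[OF Ppos[of v]] v True by linarith
      then have "\<bar>\<bar>u\<bar> - sqrt (P v)\<bar> * \<bar>\<bar>u\<bar> - sqrt (P v)\<bar> \<le> \<bar>\<bar>u\<bar> - sqrt (P v)\<bar> * (\<bar>u\<bar> + sqrt (P v))"
        by (intro mult_left_mono) auto
      also have "\<dots> = \<bar>(\<bar>u\<bar> - sqrt (P v)) * (\<bar>u\<bar> + sqrt (P v))\<bar>"
        using Ppos[of v] v True by (simp add: abs_mult)
      also have "(\<bar>u\<bar> - sqrt (P v)) * (\<bar>u\<bar> + sqrt (P v)) = u\<^sup>2 - P v"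
        using s by (simp add: power2_eq_square algebra_simps)
      finally show ?thesis by (simp add: power2_eq_square)
    qed
    then have "\<bar>\<bar>u\<bar> - sqrt (P v)\<bar> \<le> sqrt \<epsilon>"
      using le by (intro real_le_rsqrt) auto
    then have close: "\<bar>\<bar>u\<bar> - sqrt (P v)\<bar> \<le> sqrt \<epsilon> + \<epsilon>" using e by linarith
    have near: "\<bar>u - sqrt (P v)\<bar> \<le> sqrt \<epsilon> + \<epsilon> \<or> \<bar>u + sqrt (P v)\<bar> \<le> sqrt \<epsilon> + \<epsilon>"
      using close by (cases "0 \<le> u") auto
    have "(sqrt (P v), v) \<in> Q n \<epsilon>" "(- sqrt (P v), v) \<in> Q n \<epsilon>"
      using inQ v True by (auto simp: S1_def S2_def)
    moreover have "dist (u,v) (sqrt (P v), v) \<le> sqrt \<epsilon> + \<epsilon> \<or>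
        dist (u,v) (- sqrt (P v), v) \<le> sqrt \<epsilon> + \<epsilon>"
      using near dsum[of "sqrt (P v)" v] dsum[of "- sqrt (P v)" v] by auto
    ultimately show ?thesis using uv by blast
  next
    case False
    have "b ^ n \<le> 1" using b by (simp add: power_le_one)
    then have "\<epsilon> * b ^ n \<le> \<epsilon>" using e by simp
    then have b2: "1 - b\<^sup>2 \<le> \<epsilon>" using b(3) by (simp add: P_def)
    have "b\<^sup>2 \<le> v\<^sup>2" using False b by (intro power_mono) auto
    then have "\<bar>u\<bar>\<^sup>2 \<le> \<epsilon>" using uv1 b2 by simp
    then have "\<bar>u\<bar> \<le> sqrt \<epsilon>" by (rule real_le_rsqrt)
    moreover have "b\<^sup>2 \<le> b" using b by (simp add: power2_eq_square mult_left_le)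
    then have "\<bar>v - b\<bar> \<le> \<epsilon>" using b2 v False by simp
    ultimately have "dist q (0,b) \<le> sqrt \<epsilon> + \<epsilon>" using dsum[of 0 b] uv by simp
    moreover have "(0,b) \<in> Q n \<epsilon>" using inQ \<open>(0,b) \<in> S1\<close> by blast
    ultimately show ?thesis by blast
  qed
qed

lemma Q_tends_to_circle:
  assumes "odd n" and "0 < r"
  shows "\<forall>\<^sub>F \<epsilon> in at_right 0.
           (\<forall>p\<in>Q n \<epsilon>. \<exists>q\<in>sphere 0 1. dist p q < r) \<and>
           (\<forall>q\<in>sphere 0 1. \<exists>p\<in>Q n \<epsilon>. dist q p < r)"
proof -
  have "((\<lambda>\<epsilon>::real. \<epsilon> * 2 ^ n) \<longlongrightarrow> 0 * 2 ^ n) (at_right 0)"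
    by (intro tendsto_intros)
  then have lim: "((\<lambda>\<epsilon>::real. \<epsilon> * 2 ^ n) \<longlongrightarrow> 0) (at_right 0)" by simp
  have "((\<lambda>\<epsilon>::real. sqrt \<epsilon> + \<epsilon>) \<longlongrightarrow> sqrt 0 + 0) (at_right 0)"
    by (intro tendsto_intros)
  then have "\<forall>\<^sub>F \<epsilon> in at_right (0::real). sqrt \<epsilon> + \<epsilon> < r"
    by (rule order_tendstoD(2)) (use assms in simp)
  moreover have "\<forall>\<^sub>F \<epsilon> in at_right (0::real). \<epsilon> * 2 ^ n < 3" "\<forall>\<^sub>F \<epsilon> in at_right (0::real). \<epsilon> * 2 ^ n < r"
    using assms by (auto intro: order_tendstoD(2)[OF lim])
  moreover have "\<forall>\<^sub>F \<epsilon> in at_right (0::real). 0 < \<epsilon>" by (rule eventually_at_right_less)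
  ultimately show ?thesis
  proof eventually_elim
    case (elim \<epsilon>)
    then show ?case
      using Q_near_circle[OF assms(1), of \<epsilon>] circle_near_Q[OF assms(1), of \<epsilon>]
      by (metis le_less_trans)
  qed
qed

end

theory Submission
  imports Defs
begin

text \<open>Write \<open>n = m + 2\<close> and \<open>\<epsilon> = \<beta> ^ n\<close>. For small \<open>\<epsilon>\<close> the curve is a small perturbation of the unit circle, and
what limits the strip is a zero of the curvature at the complex height where \<open>w = \<epsilon> y ^ n\<close> is of
order one. On the circle that height is reached at imaginary angle about \<open>ln (2 y)\<close> with
\<open>y \<approx> \<epsilon> ^ (- 1 / n)\<close>, which already explains the leading term \<open>\<bar>ln \<epsilon>\<bar> / n\<close>. The constant \<open>\<eta>\<close> and the
error come from an explicit differential equation, which is used from both sides.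

\<^bold>\<open>The differential equation.\<close> On the curve \<open>x\<^sup>2 = Xsq y\<close>, half the gradient is \<open>(x, Ygrad y)\<close>, its length
is \<open>k\<close> with \<open>k\<^sup>2 = Ksq y\<close>, and the curvature is \<open>M y / k\<^sup>3\<close> for a polynomial \<open>M\<close> (\<open>curvature_eq\<close>). In
the variable \<open>C \<xi>\<close> the triple \<open>(x, y, k)\<close> solves
\<open>x' = - Ygrad k M powr (- 2/3)\<close>, \<open>y' = x k M powr (- 2/3)\<close>,
\<open>k' = Ygrad (Ehess - 1) x M powr (- 2/3)\<close>, where \<open>Ehess\<close> is the derivative of \<open>Ygrad\<close>. The right-hand
side is holomorphic as long as \<open>M\<close> stays off the negative axis, so extending the curvature to
complex \<open>\<xi>\<close> amounts to solving this equation in complex time (\<open>strip_continuation\<close>,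
\<open>complex_extension\<close>).

\<^bold>\<open>Speed.\<close> Put \<open>u = y sqrt (1 + \<epsilon> y ^ m)\<close>, so that \<open>u\<^sup>2 + x\<^sup>2 = 1\<close>, and \<open>N = u + \<i> x\<close>. Then
\<open>N' = - \<i> \<omega> N\<close> (\<open>N_derivative\<close>), and \<open>\<bar>ln \<bar>N\<bar>\<bar>\<close> measures how far the imaginary part of the angle has
moved. With \<open>a = (n - 1) (n - 2) / 2\<close> and \<open>c a = n - 1\<close> the expansions \<open>M \<approx> 1 - a w\<close> and
\<open>Ksq \<approx> 1 + c a w\<close> hold up to \<open>O(\<beta>\<^sup>2)\<close>, and \<open>a \<bar>w\<bar>\<close> is at most about
\<open>r = a \<epsilon> 2 ^ (- n) exp (n \<bar>ln \<bar>N\<bar>\<bar>)\<close>. Hence \<open>\<bar>\<omega>\<bar>\<close> is at most \<open>1 / g r\<close> up to a factor \<open>1 + O(\<beta>\<^sup>2)\<close>, where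
\<open>g r = (1 - r) powr (2/3) / sqrt (1 + c r)\<close> is called \<open>gain\<close> (\<open>omega_bound\<close>). Comparison with the
scalar equation with equality (\<open>growth\<close>) shows that \<open>r\<close> cannot reach \<open>1\<close>, and therefore \<open>M\<close> cannot
vanish, before the imaginary time equals the integral of \<open>g\<close>. Writing \<open>g = 1 - (1 - g)\<close> and
integrating gives \<open>ln 2 + (\<bar>ln \<epsilon>\<bar> - ln a - J) / n\<close> with
\<open>J = \<integral>\<^sub>0\<^sup>1 (1 - g t) / t dt\<close>, up to \<open>O(\<beta>\<^sup>2 ln \<epsilon>)\<close>.

\<^bold>\<open>No poles.\<close> The curvature could also become singular where \<open>k\<close> vanishes. The same comparison bounds
the variation of \<open>k\<close> along a vertical line by \<open>sqrt (1 + c) - 1 + o(1)\<close>, and \<open>c \<le> 2\<close> makes this smaller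
than \<open>1\<close> (\<open>k_variation\<close>). Together these steps give the lower bound for the width (\<open>lower_bound\<close>).

\<^bold>\<open>Upper bound.\<close> Start at the top point \<open>x = 0\<close> and follow \<open>y\<close> upwards along the real axis: \<open>x\<close> is then
purely imaginary, the time is purely imaginary, and all the inequalities above become equalities up to
\<open>O(\<beta>\<^sup>2)\<close>. At the first real zero of \<open>M\<close> the curvature vanishes, so a zero-free extension cannot reach
that far (\<open>y_inverse_path\<close>, \<open>upper_bound\<close>), and the travel time has the same asymptotics.

\<^bold>\<open>Normalization.\<close> On the real axis \<open>\<omega> = 1 + O(\<beta>\<^sup>2)\<close> and \<open>N\<close> turns exactly once around the circle per
period, so \<open>C = 2 \<pi> (1 + O(\<beta>\<^sup>2))\<close> (\<open>period_bounds\<close>). Dividing by \<open>C\<close> yields the theorem with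
\<open>\<eta> = ln 2 - (ln a + J) / n\<close>, and \<open>\<beta>\<^sup>2 = \<epsilon> powr (2 / n)\<close>. The number \<open>\<delta>\<close> itself is well defined because
local zero-free continuations across a boundary of a periodic strip can be glued
(\<open>strip_halfwidth_exists\<close>).\<close>

section \<open>Zero-free extensions to horizontal strips\<close>

definition strip :: "real \<Rightarrow> complex set" where
  "strip d = {z. \<bar>Im z\<bar> < d}"

lemma open_strip [simp]: "open (strip d)"
  unfolding strip_def by (intro open_Collect_less continuous_intros)

lemma convex_strip [simp]: "convex (strip d)"
proof -
  have "strip d = {z. Im z < d} \<inter> {z. Im z > - d}" by (auto simp: strip_def abs_less_iff)
  then show ?thesis by (simp add: convex_Int convex_halfspace_Im_lt convex_halfspace_Im_gt)
qed

lemma of_real_in_strip [simp]: "0 < d \<Longrightarrow> complex_of_real x \<in> strip d"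
  by (simp add: strip_def)

text \<open>For two balls of equal radius, the midpoint of the centres is a canonical point of their
intersection. It keeps the same imaginary part, or stays in a convex set, whenever both centres do,
which is how local continuations around different centres are compared.\<close>

lemma midpoint_in_balls:
  fixes c c' z :: complex
  assumes "z \<in> ball c r" "z \<in> ball c' r"
  shows "(c + c') / 2 \<in> ball c r \<inter> ball c' r"
proof -
  have "dist c c' < 2 * r" using assms dist_triangle3[of c c' z] by (simp add: dist_commute)
  moreover have "c - (c + c') / 2 = (c - c') / 2" "c' - (c + c') / 2 = (c' - c) / 2" by (simp_all add: field_simps)
  then have "dist c ((c + c') / 2) = dist c c' / 2" "dist c' ((c + c') / 2) = dist c c' / 2"
    by (simp_all only: dist_norm norm_divide) (simp_all add: norm_minus_commute)
  ultimately show ?thesis by simp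
qed

lemma holomorphic_glue:
  assumes "\<And>i. i \<in> I \<Longrightarrow> open (U i)" and "\<And>i. i \<in> I \<Longrightarrow> f i holomorphic_on U i"
    and agree: "\<And>i j z. i \<in> I \<Longrightarrow> j \<in> I \<Longrightarrow> z \<in> U i \<Longrightarrow> z \<in> U j \<Longrightarrow> f i z = f j z"
  obtains F where "F holomorphic_on (\<Union>i\<in>I. U i)" "\<And>i z. i \<in> I \<Longrightarrow> z \<in> U i \<Longrightarrow> F z = f i z"
proof
  define F where "F z = f (SOME i. i \<in> I \<and> z \<in> U i) z" for z
  show eq: "F z = f i z" if "i \<in> I" "z \<in> U i" for i z
    unfolding F_def using that by (intro agree) (auto intro: someI2)
  have "F holomorphic_on U i" if "i \<in> I" for i
    using holomorphic_cong[of "U i" "U i" F "f i"] eq assms(2) that by simp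
  then show "F holomorphic_on (\<Union>i\<in>I. U i)"
    using assms(1) by (intro holomorphic_on_UN_open) auto
qed

lemma holomorphic_eq_from_reals:
  assumes "F holomorphic_on S" "G holomorphic_on S" "open S" "connected S"
    and "complex_of_real x0 \<in> S" "\<And>x. complex_of_real x \<in> S \<Longrightarrow> F (of_real x) = G (of_real x)"
    and "z \<in> S"
  shows "F z = G z"
proof -
  have *: "complex_of_real x0 islimpt (of_real ` {x. complex_of_real x \<in> S})"
  proof (rule islimptI)
    fix T assume T: "complex_of_real x0 \<in> T" "open T"
    then have "open (T \<inter> S)" "of_real x0 \<in> T \<inter> S" using assms by auto
    then obtain e where e: "e > 0" "ball (of_real x0) e \<subseteq> T \<inter> S" by (meson openE)
    have "dist (complex_of_real x0) (of_real (x0 + e/2)) < e"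
      using e(1) by (simp add: dist_norm flip: of_real_diff)
    then have "of_real (x0 + e/2) \<in> T \<inter> S" using e(2) by (meson mem_ball subsetD)
    then show "\<exists>y\<in>of_real ` {x. complex_of_real x \<in> S}. y \<in> T \<and> y \<noteq> of_real x0"
      using e(1) by (intro bexI[of _ "complex_of_real (x0+e/2)"] conjI imageI) (auto simp del: of_real_add)
  qed
  have "F z - G z = 0"
    by (rule analytic_continuation[OF holomorphic_on_diff[OF assms(1,2)] assms(3,4) _ assms(5) * _ assms(7)])
      (use assms(6) in auto)
  then show ?thesis by simp
qed

definition zero_free_ext :: "(real \<Rightarrow> real) \<Rightarrow> real \<Rightarrow> (complex \<Rightarrow> complex) \<Rightarrow> bool" where
  "zero_free_ext f d F \<longleftrightarrow> F holomorphic_on strip d \<and>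
     (\<forall>x. F (complex_of_real x) = complex_of_real (f x)) \<and> (\<forall>z\<in>strip d. F z \<noteq> 0)"

text \<open>Two extensions agree on the real axis, hence on the smaller strip.\<close>

lemma zero_free_ext_unique:
  assumes "zero_free_ext f d F" "zero_free_ext f d' G" "0 < d" "d \<le> d'" "z \<in> strip d"
  shows "F z = G z"
proof (rule holomorphic_eq_from_reals[of F "strip d" G 0])
  show "G holomorphic_on strip d"
    using assms by (auto simp: zero_free_ext_def strip_def intro: holomorphic_on_subset)
  show "complex_of_real 0 \<in> strip d" using assms(3) by (rule of_real_in_strip)
qed (use assms in \<open>auto simp: zero_free_ext_def convex_connected\<close>)

definition singular_boundary_point :: "(complex \<Rightarrow> complex) \<Rightarrow> real \<Rightarrow> complex \<Rightarrow> bool" where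
  "singular_boundary_point F d z0 \<longleftrightarrow> \<bar>Im z0\<bar> = d \<and>
     \<not> (\<exists>r>0. \<exists>G. G holomorphic_on ball z0 r \<and> G z0 \<noteq> 0 \<and> (\<forall>z\<in>ball z0 r. \<bar>Im z\<bar> < d \<longrightarrow> G z = F z))"

lemma strip_halfwidth_iff:
  "strip_halfwidth f d \<longleftrightarrow> 0 < d \<and> (\<exists>F. zero_free_ext f d F \<and> (\<exists>z0. singular_boundary_point F d z0))"
  unfolding strip_halfwidth_def zero_free_ext_def singular_boundary_point_def strip_def
    Ball_def mem_Collect_eq conj_assoc by (rule refl)

text \<open>A zero-free extension to a wider strip would restrict to a regular, nonzero continuation at the
singular boundary point. So the half-width is not merely some boundary height but the largest one.\<close>

lemma strip_halfwidth_greatest: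
  assumes "strip_halfwidth f d" "zero_free_ext f d' G"
  shows "d' \<le> d"
proof (rule ccontr)
  assume "\<not> d' \<le> d"
  then have dd: "d < d'" by simp
  obtain F z0 where F: "0 < d" "zero_free_ext f d F" and z0: "singular_boundary_point F d z0"
    using assms(1) strip_halfwidth_iff by auto
  have zd: "\<bar>Im z0\<bar> = d" using z0 by (simp add: singular_boundary_point_def)
  then have "z0 \<in> strip d'" using dd by (simp add: strip_def)
  then obtain r where r: "r > 0" "ball z0 r \<subseteq> strip d'" using open_strip by (meson openE)
  moreover have "G holomorphic_on ball z0 r"
    using assms(2) r by (auto simp: zero_free_ext_def intro: holomorphic_on_subset)
  moreover have "G z0 \<noteq> 0" using assms(2) \<open>z0 \<in> strip d'\<close> by (auto simp: zero_free_ext_def)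
  moreover have "\<forall>z\<in>ball z0 r. \<bar>Im z\<bar> < d \<longrightarrow> G z = F z"
    using zero_free_ext_unique[OF F(2) assms(2) F(1)] dd by (auto simp: strip_def)
  ultimately show False using z0 unfolding singular_boundary_point_def by blast
qed

lemma strip_halfwidth_unique:
  assumes "strip_halfwidth f d" "strip_halfwidth f d'"
  shows "d = d'"
  using assms strip_halfwidth_greatest strip_halfwidth_iff by (metis order_antisym)

text \<open>The translate by a period extends the same real function, so uniqueness applies.\<close>

lemma zero_free_ext_shift:
  assumes F: "zero_free_ext f d F" and d: "0 < d" and per: "\<And>x. f (x + P) = f x" and z: "z \<in> strip d"
  shows "F (z + of_real (of_int k * P)) = F z"
proof -
  have pn: "f (x + of_nat j * P) = f x" for x j
  proof (induction j)
    case (Suc j)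
    have "f (x + of_nat (Suc j) * P) = f ((x + of_nat j * P) + P)" by (simp add: algebra_simps)
    then show ?case using per Suc by metis
  qed simp
  have pk: "f (x + of_int k * P) = f x" for x
  proof (cases "k \<ge> 0")
    case True then show ?thesis using pn[of x "nat k"] by simp
  next
    case False
    then have "f ((x + of_int k * P) + of_nat (nat (-k)) * P) = f (x + of_int k * P)" by (rule_tac pn)
    then show ?thesis using False by (simp add: algebra_simps)
  qed
  have "zero_free_ext f d (\<lambda>z. F (z + of_real (of_int k * P)))"
    unfolding zero_free_ext_def
  proof (intro conjI allI ballI)
    show "(\<lambda>z. F (z + of_real (of_int k * P))) holomorphic_on strip d"
      by (rule holomorphic_on_compose_gen[unfolded o_def, where g = F and t = "strip d"])
         (use F in \<open>auto simp: zero_free_ext_def strip_def intro!: holomorphic_intros\<close>)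
    show "F (of_real x + of_real (of_int k * P)) = of_real (f x)" for x
      using F pk[of x] by (metis zero_free_ext_def of_real_add)
    show "F (z + of_real (of_int k * P)) \<noteq> 0" if "z \<in> strip d" for z
      using F that by (auto simp: zero_free_ext_def strip_def)
  qed
  from zero_free_ext_unique[OF this F d order_refl z] show ?thesis .
qed

text \<open>If every boundary point is regular, each has a ball with a nonvanishing continuation. By periodicity
only a compact piece of the boundary matters, and the Lebesgue number of its cover by these balls is
a radius that works along the whole boundary. Two of the uniform balls that meet have
centres on the same boundary line, so their intersection contains points of the open strip, where
both continuations equal the original function; hence everything glues.\<close>

lemma zero_free_ext_enlarge:
  assumes F: "zero_free_ext f d F" and d: "0 < d" and P: "0 < P" "\<And>x. f (x + P) = f x"
    and reg: "\<And>z0. \<not> singular_boundary_point F d z0"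
  shows "\<exists>d'>d. \<exists>G. zero_free_ext f d' G"
proof -
  define good where "good z r G \<longleftrightarrow> G holomorphic_on ball z r \<and> (\<forall>w\<in>ball z r. G w \<noteq> 0) \<and>
      (\<forall>w\<in>ball z r. \<bar>Im w\<bar> < d \<longrightarrow> G w = F w)" for z r and G :: "complex \<Rightarrow> complex"
  define Bd where "Bd = (\<lambda>x. Complex x d) ` {0..P} \<union> (\<lambda>x. Complex x (-d)) ` {0..P}"
  have cont: "continuous_on {0..P} (\<lambda>x. Complex x c)" for c
    unfolding Complex_eq by (intro continuous_intros)
  have "compact Bd" unfolding Bd_def by (intro compact_Un compact_continuous_image cont compact_Icc)
  have ex: "\<exists>r G. r > 0 \<and> good z r G" if zd: "\<bar>Im z\<bar> = d" for z
  proof -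
    obtain r G where r: "r > 0" "G holomorphic_on ball z r" "G z \<noteq> 0"
        "\<forall>w\<in>ball z r. \<bar>Im w\<bar> < d \<longrightarrow> G w = F w"
      using reg[of z] zd unfolding singular_boundary_point_def by auto
    have "continuous_on (ball z r) G" using r by (intro holomorphic_on_imp_continuous_on)
    then have "isCont G z" using r by (simp add: continuous_on_eq_continuous_at)
    then obtain s where s: "s > 0" "\<And>w. dist z w < s \<Longrightarrow> G w \<noteq> 0"
      using r continuous_at_avoid[of z G 0] by blast
    have "good z (min r s) G"
      unfolding good_def using r s(2) by (auto intro: holomorphic_on_subset)
    then show ?thesis using r s by (intro exI[of _ "min r s"] exI[of _ G]) auto
  qed
  then obtain R where R: "\<And>z. \<bar>Im z\<bar> = d \<Longrightarrow> R z > 0 \<and> (\<exists>G. good z (R z) G)" by metis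
  have BdIm: "\<bar>Im z\<bar> = d" if "z \<in> Bd" for z using that d by (auto simp: Bd_def)
  have "Bd \<subseteq> \<Union>((\<lambda>z. ball z (R z)) ` Bd)" using R BdIm by (auto intro!: bexI)
  then obtain e where e: "e > 0" "\<And>x. x \<in> Bd \<Longrightarrow> \<exists>V\<in>(\<lambda>z. ball z (R z)) ` Bd. ball x e \<subseteq> V"
    by (rule Heine_Borel_lemma[OF \<open>compact Bd\<close>, of "(\<lambda>z. ball z (R z)) ` Bd"]) auto
  define \<rho> where "\<rho> = min e d"
  have rho: "0 < \<rho>" "\<rho> \<le> d" "\<rho> \<le> e" using e d by (auto simp: \<rho>_def)
  have loc: "\<exists>G. good z \<rho> G" if z: "\<bar>Im z\<bar> = d" for z
  proof -
    \<comment> \<open>translate into the fundamental period\<close>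
    define k where "k = \<lfloor>Re z / P\<rfloor>"
    define z' where "z' = z - of_real (of_int k * P)"
    have "of_int k \<le> Re z / P" "Re z / P < of_int k + 1" unfolding k_def by linarith+
    then have "of_int k * P \<le> Re z" "Re z < (of_int k + 1) * P" using P by (auto simp: field_simps)
    then have "Re z' \<in> {0..P}" "Im z' = Im z" by (auto simp: z'_def algebra_simps)
    then have "z' \<in> Bd" using z
      by (cases "Im z \<ge> 0") (auto simp: Bd_def image_iff complex_eq_iff)
    then obtain z1 where z1: "z1 \<in> Bd" "ball z' e \<subseteq> ball z1 (R z1)" using e by blast
    then obtain G where G: "good z1 (R z1) G" using R BdIm by blast
    have sub: "w - of_real (of_int k * P) \<in> ball z1 (R z1)" if "w \<in> ball z \<rho>" for w
    proof -
      have "dist z' (w - of_real (of_int k * P)) = dist z w" by (simp add: z'_def dist_norm)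
      then have "w - of_real (of_int k * P) \<in> ball z' e" using that rho by auto
      then show ?thesis using z1 by blast
    qed
    have "good z \<rho> (\<lambda>w. G (w - of_real (of_int k * P)))"
      unfolding good_def
    proof (intro conjI ballI impI)
      show "(\<lambda>w. G (w - of_real (of_int k * P))) holomorphic_on ball z \<rho>"
        by (rule holomorphic_on_compose_gen[unfolded o_def, where g = G and t = "ball z1 (R z1)"])
          (use G sub in \<open>auto simp: good_def intro!: holomorphic_intros\<close>)
      show "G (w - of_real (of_int k * P)) \<noteq> 0" if "w \<in> ball z \<rho>" for w
        using G sub[OF that] by (auto simp: good_def)
      show "G (w - of_real (of_int k * P)) = F w" if "w \<in> ball z \<rho>" "\<bar>Im w\<bar> < d" for w
      proof -
        have "w - of_real (of_int k * P) \<in> strip d" using that by (simp add: strip_def)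
        then have "F (w - of_real (of_int k * P) + of_real (of_int k * P)) = F (w - of_real (of_int k * P))"
          by (rule zero_free_ext_shift[OF F d P(2)])
        moreover have "G (w - of_real (of_int k * P)) = F (w - of_real (of_int k * P))"
          using G sub[OF that(1)] that(2) by (auto simp: good_def)
        ultimately show ?thesis by simp
      qed
    qed
    then show ?thesis by blast
  qed
  then obtain H where H: "\<And>z. \<bar>Im z\<bar> = d \<Longrightarrow> good z \<rho> (H z)" by metis
  define U where "U i = (case i of None \<Rightarrow> strip d | Some c \<Rightarrow> ball c \<rho>)" for i
  define f' where "f' i = (case i of None \<Rightarrow> F | Some c \<Rightarrow> H c)" for i
  define I where "I = insert None (Some ` {c. \<bar>Im c\<bar> = d})"
  have cc: "H c z = H c' z" if c: "\<bar>Im c\<bar> = d" "\<bar>Im c'\<bar> = d" and z: "z \<in> ball c \<rho>" "z \<in> ball c' \<rho>" for c c' z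
  proof -
    have a: "\<bar>Im (z - c)\<bar> < \<rho>" "\<bar>Im (z - c')\<bar> < \<rho>"
      using abs_Im_le_cmod[of "z - c"] abs_Im_le_cmod[of "z - c'"] z by (auto simp: dist_norm norm_minus_commute)
    have im: "Im c = Im c'" using a c rho by auto
    define mid where "mid = (c + c') / 2"
    have mb: "mid \<in> ball c \<rho> \<inter> ball c' \<rho>" unfolding mid_def by (rule midpoint_in_balls[OF z])
    have "open (ball c \<rho> \<inter> ball c' \<rho>)" by auto
    then obtain s where s: "s > 0" "ball mid s \<subseteq> ball c \<rho> \<inter> ball c' \<rho>" using mb by (meson openE)
    define t where "t = min (s/2) (d/2)"
    have t: "0 < t" "t < s" "t < d" using s d by (auto simp: t_def)
    \<comment> \<open>moving from the midpoint towards the real axis enters the open strip\<close>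
    define p where "p = mid - \<i> * of_real (sgn (Im c) * t)"
    have imm: "Im mid = Im c" using im by (simp add: mid_def)
    have sg: "\<bar>sgn (Im c)\<bar> = 1" using c d by (auto simp: sgn_if)
    have "dist mid p = t" using t sg by (simp add: p_def dist_norm norm_mult abs_mult)
    then have p1: "p \<in> ball c \<rho> \<inter> ball c' \<rho>" using s t by auto
    have "\<bar>Im p\<bar> < d" using imm c t d by (auto simp: p_def sgn_if abs_if split: if_splits)
    then have p2: "p \<in> strip d" by (simp add: strip_def)
    show ?thesis
    proof (rule analytic_continuation_open[of "ball c \<rho> \<inter> ball c' \<rho> \<inter> strip d" "ball c \<rho> \<inter> ball c' \<rho>" "H c" "H c'"])
      show "ball c \<rho> \<inter> ball c' \<rho> \<inter> strip d \<noteq> {}" using p1 p2 by blast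
      show "z \<in> ball c \<rho> \<inter> ball c' \<rho>" using z by simp
      show "connected (ball c \<rho> \<inter> ball c' \<rho>)" by (intro convex_connected convex_Int convex_ball)
      show "H c holomorphic_on ball c \<rho> \<inter> ball c' \<rho>" "H c' holomorphic_on ball c \<rho> \<inter> ball c' \<rho>"
        using H c by (auto simp: good_def intro: holomorphic_on_subset)
      show "H c w = H c' w" if "w \<in> ball c \<rho> \<inter> ball c' \<rho> \<inter> strip d" for w
        using H[OF c(1)] H[OF c(2)] that by (auto simp: good_def strip_def)
    qed (auto intro!: open_Int)
  qed
  obtain G where G: "G holomorphic_on (\<Union>i\<in>I. U i)" "\<And>i z. i \<in> I \<Longrightarrow> z \<in> U i \<Longrightarrow> G z = f' i z"
  proof (rule holomorphic_glue[of I U f'])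
    show "open (U i)" if "i \<in> I" for i by (auto simp: U_def split: option.split)
    show "f' i holomorphic_on U i" if "i \<in> I" for i
      using that F H by (auto simp: U_def f'_def I_def good_def zero_free_ext_def)
    show "f' i z = f' j z" if "i \<in> I" "j \<in> I" "z \<in> U i" "z \<in> U j" for i j z
    proof -
      have HF: "H c z = F z" if "\<bar>Im c\<bar> = d" "z \<in> ball c \<rho>" "\<bar>Im z\<bar> < d" for c
        using H[OF that(1)] that(2,3) unfolding good_def by blast
      show ?thesis
      proof (cases i)
        case None
        then show ?thesis using that HF by (cases j) (simp_all add: U_def f'_def I_def strip_def image_iff)
      next
        case (Some c)
        then have c: "\<bar>Im c\<bar> = d" "z \<in> ball c \<rho>" using that by (auto simp: I_def U_def)
        show ?thesis
        proof (cases j)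
          case None
          then show ?thesis using that(4) Some HF[OF c] by (simp add: U_def f'_def strip_def)
        next
          case (Some c')
          then have c': "\<bar>Im c'\<bar> = d" "z \<in> ball c' \<rho>" using that by (auto simp: I_def U_def)
          show ?thesis using cc[OF c(1) c'(1) c(2) c'(2)] Some \<open>i = Some c\<close> by (simp add: f'_def)
        qed
      qed
    qed
  qed blast
  have cover: "\<exists>i\<in>I. z \<in> U i" if z: "z \<in> strip (d + \<rho>)" for z
  proof (cases "\<bar>Im z\<bar> < d")
    case True then show ?thesis by (auto simp: I_def U_def strip_def)
  next
    case False
    define c where "c = Complex (Re z) (sgn (Im z) * d)"
    have "\<bar>Im c\<bar> = d" using False d by (auto simp: c_def sgn_if)
    moreover have "c - z = Complex 0 (sgn (Im z) * d - Im z)" by (auto simp: c_def complex_eq_iff)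
    then have "cmod (c - z) = \<bar>sgn (Im z) * d - Im z\<bar>" by (simp add: cmod_def)
    then have "z \<in> ball c \<rho>"
      using z False d by (auto simp: dist_norm strip_def sgn_if abs_if split: if_splits)
    ultimately show ?thesis by (auto simp: I_def U_def)
  qed
  have "zero_free_ext f (d + \<rho>) G"
    unfolding zero_free_ext_def
  proof (intro conjI allI ballI)
    show "G holomorphic_on strip (d + \<rho>)"
      by (rule holomorphic_on_subset[OF G(1)]) (use cover in auto)
    show "G (of_real x) = of_real (f x)" for x
      using G(2)[of None "of_real x"] F d by (auto simp: I_def U_def f'_def zero_free_ext_def)
    show "G z \<noteq> 0" if zz: "z \<in> strip (d + \<rho>)" for z
    proof -
      obtain i where i: "i \<in> I" "z \<in> U i" using cover[OF zz] by blast
      then show ?thesis using G(2)[OF i] F H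
        by (auto simp: I_def U_def f'_def zero_free_ext_def good_def)
    qed
  qed
  then show ?thesis using rho by (intro exI[of _ "d + \<rho>"]) auto
qed

text \<open>Take the supremum of the half-widths of zero-free extensions, which are nested and hence glue to an
extension at the supremum. If its boundary were regular everywhere it could be enlarged.\<close>

lemma strip_halfwidth_exists:
  assumes F0: "zero_free_ext f d0 F0" and d0: "0 < d0" and P: "0 < P" "\<And>x. f (x + P) = f x"
    and bd: "\<And>d F. zero_free_ext f d F \<Longrightarrow> d \<le> h"
  shows "\<exists>d. strip_halfwidth f d \<and> d \<le> h"
proof -
  define S where "S = {d. 0 < d \<and> (\<exists>F. zero_free_ext f d F)}"
  have S: "d0 \<in> S" "bdd_above S" using F0 d0 bd by (auto simp: S_def bdd_above_def)
  define D where "D = Sup S"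
  have D: "0 < D" "D \<le> h" "\<And>d. d \<in> S \<Longrightarrow> d \<le> D"
  proof -
    show up: "d \<le> D" if "d \<in> S" for d using cSup_upper[OF that S(2)] by (simp add: D_def)
    show "0 < D" using up[OF S(1)] d0 by simp
    show "D \<le> h" unfolding D_def using S(1) bd by (intro cSup_least) (auto simp: S_def)
  qed
  have "\<forall>d\<in>S. \<exists>F. zero_free_ext f d F" by (simp add: S_def)
  then obtain Fs where Fs: "\<And>d. d \<in> S \<Longrightarrow> zero_free_ext f d (Fs d)" by metis
  have ag: "Fs i z = Fs j z" if "i \<in> S" "j \<in> S" "z \<in> strip i" "z \<in> strip j" for i j z
  proof (cases "i \<le> j")
    case True
    then show ?thesis using zero_free_ext_unique[OF Fs[OF that(1)] Fs[OF that(2)]] that by (simp add: S_def)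
  next
    case False
    then show ?thesis using zero_free_ext_unique[OF Fs[OF that(2)] Fs[OF that(1)], of z] that by (simp add: S_def)
  qed
  obtain F where F: "F holomorphic_on (\<Union>d\<in>S. strip d)" "\<And>d z. d \<in> S \<Longrightarrow> z \<in> strip d \<Longrightarrow> F z = Fs d z"
  proof (rule holomorphic_glue[of S strip Fs])
    show "Fs i holomorphic_on strip i" if "i \<in> S" for i using Fs[OF that] by (simp add: zero_free_ext_def)
    show "Fs i z = Fs j z" if "i \<in> S" "j \<in> S" "z \<in> strip i" "z \<in> strip j" for i j z
      using that by (rule ag)
  qed auto
  have cover: "\<exists>d\<in>S. z \<in> strip d" if "z \<in> strip D" for z
    using that less_cSup_iff[of S "\<bar>Im z\<bar>"] S by (auto simp: strip_def D_def)
  have ext: "zero_free_ext f D F"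
    unfolding zero_free_ext_def
  proof (intro conjI allI ballI)
    show "F holomorphic_on strip D" by (rule holomorphic_on_subset[OF F(1)]) (use cover in auto)
    show "F (of_real x) = of_real (f x)" for x
      using F(2)[OF S(1), of "of_real x"] Fs[OF S(1)] d0 by (auto simp: zero_free_ext_def)
    show "F z \<noteq> 0" if "z \<in> strip D" for z
      using cover[OF that] F(2) Fs by (auto simp: zero_free_ext_def)
  qed
  have "\<exists>z0. singular_boundary_point F D z0"
  proof (rule ccontr)
    assume "\<not> ?thesis"
    then obtain d' G where *: "D < d'" "zero_free_ext f d' G"
      using zero_free_ext_enlarge[OF ext D(1) P] by blast
    then have "d' \<in> S" using D(1) * by (auto simp: S_def)
    then show False using D(3)[of d'] *(1) by simp
  qed
  then show ?thesis using ext D strip_halfwidth_iff by blast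
qed

lemma THE_strip_halfwidth:
  assumes "zero_free_ext f d0 F0" "0 < d0" "0 < P" "\<And>x. f (x + P) = f x"
    and "\<And>d F. zero_free_ext f d F \<Longrightarrow> d \<le> h"
  shows "d0 \<le> (THE d. strip_halfwidth f d)" "(THE d. strip_halfwidth f d) \<le> h"
proof -
  obtain d where d: "strip_halfwidth f d" "d \<le> h"
    using strip_halfwidth_exists[OF assms(1-4), of h] assms(5) by blast
  then have "(THE d. strip_halfwidth f d) = d"
    using strip_halfwidth_unique by (intro the_equality) auto
  then show "d0 \<le> (THE d. strip_halfwidth f d)" "(THE d. strip_halfwidth f d) \<le> h"
    using d strip_halfwidth_greatest[OF d(1) assms(1)] by auto
qed

section \<open>Holomorphic differential equations on strips\<close>

text \<open>The index type is arbitrary and closeness is expressed coordinatewise with a common bound, so that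
the phase space needs no norm.\<close>

definition polydisc :: "('i \<Rightarrow> complex) \<Rightarrow> real \<Rightarrow> ('i \<Rightarrow> complex) set" where
  "polydisc w0 \<rho> = {w. \<forall>j. cmod (w j - w0 j) \<le> \<rho>}"

text \<open>An autonomous vector field with bounds that are uniform over all polydiscs of radius \<open>\<rho>\<close> centred in \<open>K\<close>.
The radius \<open>r\<close> in time is chosen such that a solution cannot leave its polydisc and Picard iteration
contracts by the factor one half. It depends on \<open>K\<close> only, so a solution which is known to stay in \<open>K\<close>
can be prolonged in steps of fixed size. Holomorphy of the field is expressed by composition with
holomorphic curves, which avoids differentiability in several variables.\<close>

locale holomorphic_ode =
  fixes \<Phi> :: "'i \<Rightarrow> ('i \<Rightarrow> complex) \<Rightarrow> complex" and K :: "('i \<Rightarrow> complex) set"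
    and \<rho> B \<Lambda> r :: real
  assumes pos: "0 < \<rho>" "0 \<le> B" "0 \<le> \<Lambda>" "0 < r" and radius: "B * r \<le> \<rho>" "\<Lambda> * r \<le> 1/2"
    and bounded: "\<And>w0 w i. w0 \<in> K \<Longrightarrow> w \<in> polydisc w0 \<rho> \<Longrightarrow> cmod (\<Phi> i w) \<le> B"
    and lipschitz: "\<And>w0 w w' b i. w0 \<in> K \<Longrightarrow> w \<in> polydisc w0 \<rho> \<Longrightarrow> w' \<in> polydisc w0 \<rho> \<Longrightarrow>
       (\<And>j. cmod (w j - w' j) \<le> b) \<Longrightarrow> cmod (\<Phi> i w - \<Phi> i w') \<le> \<Lambda> * b"
    and holomorphic: "\<And>w0 W S i. w0 \<in> K \<Longrightarrow> open S \<Longrightarrow> (\<And>j. W j holomorphic_on S) \<Longrightarrow>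
       (\<And>z. z \<in> S \<Longrightarrow> (\<lambda>j. W j z) \<in> polydisc w0 \<rho>) \<Longrightarrow> (\<lambda>z. \<Phi> i (\<lambda>j. W j z)) holomorphic_on S"
begin

definition admissible :: "complex \<Rightarrow> ('i \<Rightarrow> complex) \<Rightarrow> ('i \<Rightarrow> complex \<Rightarrow> complex) \<Rightarrow> bool" where
  "admissible c w0 V \<longleftrightarrow> (\<forall>j. V j holomorphic_on ball c r) \<and> (\<forall>z\<in>ball c r. (\<lambda>j. V j z) \<in> polydisc w0 \<rho>)"

text \<open>\<open>V'\<close> is the Picard iterate of \<open>V\<close>, as a relation: it is the primitive of the field along \<open>V\<close> with the
prescribed value at the centre.\<close>

definition picard_image :: "complex \<Rightarrow> ('i \<Rightarrow> complex) \<Rightarrow> ('i \<Rightarrow> complex \<Rightarrow> complex) \<Rightarrow> ('i \<Rightarrow> complex \<Rightarrow> complex) \<Rightarrow> bool" where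
  "picard_image c w0 V V' \<longleftrightarrow> (\<forall>j. V' j c = w0 j) \<and>
     (\<forall>z\<in>ball c r. \<forall>j. (V' j has_field_derivative \<Phi> j (\<lambda>i. V i z)) (at z))"

lemma picard_image_DERIV:
  "picard_image c w0 V V' \<Longrightarrow> z \<in> ball c r \<Longrightarrow> (V' j has_field_derivative \<Phi> j (\<lambda>i. V i z)) (at z)"
  by (simp add: picard_image_def)

lemma picard_image_exists:
  assumes "w0 \<in> K" and V: "admissible c w0 V"
  shows "\<exists>V'. picard_image c w0 V V'"
proof -
  have "\<exists>g. \<forall>z\<in>ball c r. (g has_field_derivative \<Phi> j (\<lambda>i. V i z)) (at z)" for j
  proof -
    have "(\<lambda>z. \<Phi> j (\<lambda>i. V i z)) holomorphic_on ball c r"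
      using V by (intro holomorphic[OF assms(1)]) (auto simp: admissible_def)
    then obtain g where "\<And>x. x \<in> ball c r \<Longrightarrow> (g has_field_derivative \<Phi> j (\<lambda>i. V i x)) (at x within ball c r)"
      using holomorphic_convex_primitive'[OF convex_ball open_ball] by blast
    then show ?thesis by (metis at_within_open open_ball)
  qed
  then obtain g where g: "\<And>j z. z \<in> ball c r \<Longrightarrow> (g j has_field_derivative \<Phi> j (\<lambda>i. V i z)) (at z)" by metis
  have "picard_image c w0 V (\<lambda>j z. g j z - g j c + w0 j)"
    unfolding picard_image_def by (auto intro!: derivative_eq_intros g)
  then show ?thesis by blast
qed

lemma picard_image_admissible:
  assumes "w0 \<in> K" and V: "admissible c w0 V" "picard_image c w0 V V'"
  shows "admissible c w0 V'"
  unfolding admissible_def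
proof (intro conjI allI ballI)
  show "V' j holomorphic_on ball c r" for j
    using V(2) by (auto simp: picard_image_def holomorphic_on_open)
  show "(\<lambda>j. V' j z) \<in> polydisc w0 \<rho>" if z: "z \<in> ball c r" for z
    unfolding polydisc_def mem_Collect_eq
  proof
    fix j
    have "cmod (V' j z - V' j c) \<le> B * cmod (z - c)"
    proof (rule field_differentiable_bound[of "ball c r" "V' j" "\<lambda>z. \<Phi> j (\<lambda>i. V i z)"])
      show "(V' j has_field_derivative \<Phi> j (\<lambda>i. V i x)) (at x within ball c r)" if "x \<in> ball c r" for x
        using V(2) that by (auto simp: picard_image_def intro: has_field_derivative_at_within)
      show "cmod (\<Phi> j (\<lambda>i. V i x)) \<le> B" if "x \<in> ball c r" for x
        using V(1) that assms(1) by (intro bounded) (auto simp: admissible_def)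
    qed (use z pos in auto)
    also have "\<dots> \<le> B * r" using z pos by (intro mult_left_mono) (auto simp: dist_norm norm_minus_commute)
    finally show "cmod (V' j z - w0 j) \<le> \<rho>" using radius V(2) by (simp add: picard_image_def)
  qed
qed

text \<open>The difference of two images vanishes at the centre and has derivative at most \<open>\<Lambda> b\<close>; the constraint
\<open>\<Lambda> r \<le> 1/2\<close> then halves the distance.\<close>

lemma picard_image_contracts:
  assumes "w0 \<in> K" and V: "admissible c w0 V" "picard_image c w0 V V'"
    and U: "admissible c w0 U" "picard_image c w0 U U'"
    and b: "\<And>z j. z \<in> ball c r \<Longrightarrow> cmod (V j z - U j z) \<le> b" and z: "z \<in> ball c r"
  shows "cmod (V' j z - U' j z) \<le> b / 2"
proof -
  have b0: "0 \<le> b" using b[OF z, of j] norm_ge_zero order_trans by blast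
  have "cmod ((V' j z - U' j z) - (V' j c - U' j c)) \<le> (\<Lambda> * b) * cmod (z - c)"
  proof (rule field_differentiable_bound[of "ball c r" "\<lambda>z. V' j z - U' j z" "\<lambda>z. \<Phi> j (\<lambda>i. V i z) - \<Phi> j (\<lambda>i. U i z)"])
    show "((\<lambda>z. V' j z - U' j z) has_field_derivative \<Phi> j (\<lambda>i. V i x) - \<Phi> j (\<lambda>i. U i x)) (at x within ball c r)"
      if "x \<in> ball c r" for x
      by (rule has_field_derivative_at_within, rule DERIV_diff)
        (rule picard_image_DERIV[OF V(2) that] picard_image_DERIV[OF U(2) that])+
    show "cmod (\<Phi> j (\<lambda>i. V i x) - \<Phi> j (\<lambda>i. U i x)) \<le> \<Lambda> * b" if x: "x \<in> ball c r" for x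
    proof (rule lipschitz[OF assms(1)])
      show "(\<lambda>i. V i x) \<in> polydisc w0 \<rho>" "(\<lambda>i. U i x) \<in> polydisc w0 \<rho>"
        using V(1) U(1) x unfolding admissible_def by blast+
    qed (use b[OF x] in simp)
  qed (use z pos in auto)
  also have "\<dots> \<le> (\<Lambda> * b) * r" using z pos b0 by (intro mult_left_mono) (auto simp: dist_norm norm_minus_commute)
  also have "\<dots> = (\<Lambda> * r) * b" by simp
  also have "\<dots> \<le> 1/2 * b" using radius b0 by (intro mult_right_mono)
  finally show ?thesis using V(2) U(2) by (simp add: picard_image_def)
qed

text \<open>Picard iteration from the constant function converges uniformly on the ball, and locally uniform
limits of holomorphic functions are holomorphic.\<close>

lemma local_solution:
  assumes w0: "w0 \<in> K"
  obtains W where "admissible c w0 W" "picard_image c w0 W W"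
proof -
  obtain T where T: "\<And>V. admissible c w0 V \<Longrightarrow> picard_image c w0 V (T V)"
    using picard_image_exists[OF w0] by metis
  define V where "V k = (T ^^ k) (\<lambda>j z. w0 j)" for k
  have V0: "V 0 = (\<lambda>j z. w0 j)" and VS: "V (Suc k) = T (V k)" for k by (simp_all add: V_def)
  have adm: "admissible c w0 (V k)" for k
  proof (induction k)
    case 0 show ?case using pos by (auto simp: V0 admissible_def polydisc_def)
  next
    case (Suc k) then show ?case using picard_image_admissible[OF w0] T VS by metis
  qed
  have conv: "cmod (V (l + k) j z - V k j z) \<le> \<rho> / 2 ^ k" if "z \<in> ball c r" for l k j z
    using that
  proof (induction k arbitrary: j z)
    case 0 then show ?case using adm[of l] by (auto simp: V0 admissible_def polydisc_def)
  next
    case (Suc k)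
    have "cmod (V (Suc (l + k)) j z - V (Suc k) j z) \<le> (\<rho> / 2 ^ k) / 2"
      unfolding VS
      by (rule picard_image_contracts[OF w0 adm T[OF adm] adm T[OF adm]]) (use Suc in auto)
    then show ?case by simp
  qed
  have small: "\<exists>N. \<forall>n\<ge>N. \<rho> / 2 ^ n < e" if e: "e > 0" for e
  proof -
    have "(\<lambda>n. \<rho> * (1/2) ^ n) \<longlonglongrightarrow> \<rho> * 0" by (intro tendsto_intros LIMSEQ_power_zero) auto
    then have "eventually (\<lambda>n. \<rho> * (1/2) ^ n < e) sequentially" using e by (auto dest: order_tendstoD(2))
    then show ?thesis by (simp add: eventually_sequentially power_divide)
  qed
  have "uniformly_Cauchy_on (ball c r) (\<lambda>k. V k j)" for j
    unfolding uniformly_Cauchy_on_def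
  proof (intro allI impI)
    fix e :: real assume "e > 0"
    then obtain N where N: "\<And>n. n \<ge> N \<Longrightarrow> \<rho> / 2 ^ n < e/2" using small[of "e/2"] by auto
    have "dist (V m j x) (V n j x) < e" if "x \<in> ball c r" "m \<ge> N" "n \<ge> N" for x m n
    proof -
      have "cmod (V m j x - V N j x) \<le> \<rho> / 2 ^ N" "cmod (V n j x - V N j x) \<le> \<rho> / 2 ^ N"
        using conv[OF that(1), of "m - N" N j] conv[OF that(1), of "n - N" N j] that(2,3) by simp_all
      then have "cmod (V m j x - V N j x) < e/2" "cmod (V n j x - V N j x) < e/2"
        using N[of N] by linarith+
      then show ?thesis using dist_triangle_half_r[of "V N j x" "V m j x" e "V n j x"] by (simp add: dist_norm norm_minus_commute)
    qed
    then show "\<exists>M. \<forall>x\<in>ball c r. \<forall>m\<ge>M. \<forall>n\<ge>M. dist (V m j x) (V n j x) < e" by blast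
  qed
  then have "\<forall>j. \<exists>l. uniform_limit (ball c r) (\<lambda>k. V k j) l sequentially"
    using Cauchy_uniformly_convergent by (auto simp: uniformly_convergent_on_def)
  then obtain W where W: "\<And>j. uniform_limit (ball c r) (\<lambda>k. V k j) (W j) sequentially" by metis
  have pw: "(\<lambda>k. V k j z) \<longlonglongrightarrow> W j z" if "z \<in> ball c r" for j z
    using tendsto_uniform_limitI[OF W that] .
  have WV: "cmod (W j z - V k j z) \<le> \<rho> / 2 ^ k" if "z \<in> ball c r" for j z k
  proof (rule LIMSEQ_le_const2)
    show "(\<lambda>l. cmod (V (l + k) j z - V k j z)) \<longlonglongrightarrow> cmod (W j z - V k j z)"
      by (intro tendsto_intros LIMSEQ_ignore_initial_segment pw that)
    show "\<exists>N. \<forall>n\<ge>N. cmod (V (n + k) j z - V k j z) \<le> \<rho> / 2 ^ k" using conv[OF that] by blast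
  qed
  have admW: "admissible c w0 W"
    unfolding admissible_def
  proof (intro conjI allI ballI)
    show "W j holomorphic_on ball c r" for j
    proof (rule holomorphic_uniform_sequence[where f = "\<lambda>k. V k j"])
      fix x assume "x \<in> ball c r"
      then obtain d where "d > 0" "cball x d \<subseteq> ball c r" using open_contains_cball[of "ball c r"] open_ball by blast
      then show "\<exists>d>0. cball x d \<subseteq> ball c r \<and> uniform_limit (cball x d) (\<lambda>k. V k j) (W j) sequentially"
        using uniform_limit_on_subset[OF W] by blast
    qed (use adm in \<open>auto simp: admissible_def\<close>)
    show "(\<lambda>j. W j z) \<in> polydisc w0 \<rho>" if "z \<in> ball c r" for z
      using WV[OF that, of _ 0] by (simp add: polydisc_def V0)
  qed
  have "T W j z = W j z" if z: "z \<in> ball c r" for j z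
  proof -
    have "cmod (T W j z - V (Suc k) j z) \<le> (\<rho> / 2 ^ k) / 2" for k
      unfolding VS by (rule picard_image_contracts[OF w0 admW T[OF admW] adm T[OF adm]]) (use WV z in auto)
    moreover have "cmod (T W j z - W j z) \<le> cmod (T W j z - V (Suc k) j z) + cmod (W j z - V (Suc k) j z)" for k
      using norm_triangle_ineq4[of "T W j z - V (Suc k) j z" "W j z - V (Suc k) j z"] by simp
    moreover have "cmod (W j z - V (Suc k) j z) \<le> (\<rho> / 2 ^ k) / 2" for k
      using WV[OF z, of j "Suc k"] by simp
    ultimately have "cmod (T W j z - W j z) \<le> (\<rho> / 2 ^ k) / 2 + (\<rho> / 2 ^ k) / 2" for k
      using add_mono order_trans by meson
    then have "cmod (T W j z - W j z) \<le> \<rho> / 2 ^ k" for k by simp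
    then have "\<not> cmod (T W j z - W j z) > 0" using small by (metis linorder_not_le order_refl)
    then show ?thesis by simp
  qed
  then have "picard_image c w0 W W"
  proof -
    assume eq: "\<And>z j. z \<in> ball c r \<Longrightarrow> T W j z = W j z"
    have "(W j has_field_derivative \<Phi> j (\<lambda>i. W i z)) (at z)" if z: "z \<in> ball c r" for j z
      by (rule has_field_derivative_transform_within_open[of "T W j" _ _ "ball c r"])
        (use z eq T[OF admW] in \<open>auto simp: picard_image_def\<close>)
    moreover have "W j c = w0 j" for j using eq[of c j] T[OF admW] pos by (simp add: picard_image_def)
    ultimately show ?thesis by (auto simp: picard_image_def)
  qed
  with admW show thesis by (rule that)
qed

text \<open>The argument only looks at real segments, because one of the two solutions that are compared may be
given on a convex set without interior, such as the real axis. Each application of the integral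
equation halves the bound for the difference.\<close>

lemma segment_unique:
  assumes w0: "w0 \<in> K" and b: "0 < b" "cmod c * \<Lambda> * b \<le> 1/2"
    and f: "\<And>j t. t \<in> {0..b} \<Longrightarrow> (f j has_vector_derivative c * \<Phi> j (\<lambda>i. f i t)) (at t within {0..b})"
    and g: "\<And>j t. t \<in> {0..b} \<Longrightarrow> (g j has_vector_derivative c * \<Phi> j (\<lambda>i. g i t)) (at t within {0..b})"
    and fP: "\<And>t. t \<in> {0..b} \<Longrightarrow> (\<lambda>j. f j t) \<in> polydisc w0 \<rho>"
    and gP: "\<And>t. t \<in> {0..b} \<Longrightarrow> (\<lambda>j. g j t) \<in> polydisc w0 \<rho>"
    and init: "\<And>j. f j 0 = g j 0" and t: "t \<in> {0..b}"
  shows "f j t = g j t"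
proof -
  have bound: "cmod (f j t - g j t) \<le> 2 * \<rho> / 2 ^ k" if "t \<in> {0..b}" for k j t
    using that
  proof (induction k arbitrary: j t)
    case 0
    have "cmod (f j t - w0 j) \<le> \<rho>" "cmod (g j t - w0 j) \<le> \<rho>" using fP[OF 0] gP[OF 0] by (auto simp: polydisc_def)
    then show ?case using norm_triangle_ineq4[of "f j t - w0 j" "g j t - w0 j"] by simp
  next
    case (Suc k)
    define M where "M = 2 * \<rho> / 2 ^ k"
    have M0: "0 \<le> M" using pos by (simp add: M_def)
    have "norm ((f j t - g j t) - (f j 0 - g j 0)) \<le> (cmod c * \<Lambda> * M) * norm (t - 0)"
    proof (rule differentiable_bound[of "{0..b}" "\<lambda>t. f j t - g j t"
          "\<lambda>s h. h *\<^sub>R (c * \<Phi> j (\<lambda>i. f i s) - c * \<Phi> j (\<lambda>i. g i s))"])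
      show "((\<lambda>t. f j t - g j t) has_derivative (\<lambda>h. h *\<^sub>R (c * \<Phi> j (\<lambda>i. f i s) - c * \<Phi> j (\<lambda>i. g i s)))) (at s within {0..b})"
        if "s \<in> {0..b}" for s
        using has_vector_derivative_diff[OF f[OF that] g[OF that]] by (simp add: has_vector_derivative_def)
      show "onorm (\<lambda>h. h *\<^sub>R (c * \<Phi> j (\<lambda>i. f i s) - c * \<Phi> j (\<lambda>i. g i s))) \<le> cmod c * \<Lambda> * M" if s: "s \<in> {0..b}" for s
      proof (rule onorm_bound)
        have "cmod (\<Phi> j (\<lambda>i. f i s) - \<Phi> j (\<lambda>i. g i s)) \<le> \<Lambda> * M"
          by (rule lipschitz[OF w0 fP[OF s] gP[OF s]]) (use Suc.IH[OF s] in \<open>auto simp: M_def\<close>)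
        then have "cmod c * cmod (\<Phi> j (\<lambda>i. f i s) - \<Phi> j (\<lambda>i. g i s)) \<le> cmod c * (\<Lambda> * M)" by (intro mult_left_mono) auto
        then have "cmod (c * \<Phi> j (\<lambda>i. f i s) - c * \<Phi> j (\<lambda>i. g i s)) \<le> cmod c * \<Lambda> * M"
          by (simp add: norm_mult mult.assoc flip: right_diff_distrib)
        then show "norm (h *\<^sub>R (c * \<Phi> j (\<lambda>i. f i s) - c * \<Phi> j (\<lambda>i. g i s))) \<le> cmod c * \<Lambda> * M * norm h" for h
          unfolding norm_scaleR real_norm_def by (subst mult.commute) (rule mult_right_mono, auto)
      qed (use pos M0 in auto)
    qed (use Suc.prems b in auto)
    also have "\<dots> \<le> (cmod c * \<Lambda> * M) * b" using Suc.prems pos M0 by (intro mult_left_mono) auto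
    also have "\<dots> = (cmod c * \<Lambda> * b) * M" by simp
    also have "\<dots> \<le> 1/2 * M" using b M0 by (intro mult_right_mono)
    finally show ?case using init by (simp add: M_def)
  qed
  have "(\<lambda>k. 2 * \<rho> * (1/2) ^ k) \<longlonglongrightarrow> 2 * \<rho> * 0" by (intro tendsto_intros LIMSEQ_power_zero) auto
  then have "cmod (f j t - g j t) \<le> 2 * \<rho> * 0"
    by (rule LIMSEQ_le_const) (use bound[OF t, of j] in \<open>auto simp: power_divide\<close>)
  then show ?thesis by simp
qed

text \<open>The second clause records that the values stay in the region where the field is controlled.\<close>

definition ode_solution :: "complex set \<Rightarrow> ('i \<Rightarrow> complex \<Rightarrow> complex) \<Rightarrow> bool" where
  "ode_solution S W \<longleftrightarrow> (\<forall>z\<in>S. \<forall>j. (W j has_field_derivative \<Phi> j (\<lambda>i. W i z)) (at z)) \<and>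
     (\<forall>z\<in>S. \<exists>w0\<in>K. (\<lambda>j. W j z) \<in> polydisc w0 \<rho>)"

lemma ode_solution_subset: "ode_solution S W \<Longrightarrow> S' \<subseteq> S \<Longrightarrow> ode_solution S' W"
  unfolding ode_solution_def by blast

lemma derivative_on_segment:
  assumes "(F has_field_derivative D) (at (c + of_real t * d))"
  shows "((\<lambda>t. F (c + of_real t * d)) has_vector_derivative d * D) (at t within S)"
proof -
  have "((\<lambda>t. c + of_real t * d) has_vector_derivative d) (at t)"
    by (auto intro!: derivative_eq_intros)
  from field_vector_diff_chain_at[OF this assms] show ?thesis
    by (simp add: o_def has_vector_derivative_at_within)
qed

text \<open>Two solutions with bounded speed and equal values at the centre both stay in the polydisc around that
value, where uniqueness along radii applies.\<close>

lemma solution_unique_near: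
  assumes C: "v \<in> K" and s: "0 < s" "s \<le> r"
    and F: "\<And>j z. z \<in> ball m s \<Longrightarrow> (F j has_field_derivative \<Phi> j (\<lambda>i. F i z)) (at z)"
    and Fb: "\<And>j z. z \<in> ball m s \<Longrightarrow> cmod (\<Phi> j (\<lambda>i. F i z)) \<le> B"
    and G: "\<And>j z. z \<in> ball m s \<Longrightarrow> (G j has_field_derivative \<Phi> j (\<lambda>i. G i z)) (at z)"
    and Gb: "\<And>j z. z \<in> ball m s \<Longrightarrow> cmod (\<Phi> j (\<lambda>i. G i z)) \<le> B"
    and init: "\<And>j. F j m = v j" "\<And>j. G j m = v j" and z: "z \<in> ball m s"
  shows "F j z = G j z"
proof -
  have near: "(\<lambda>j. F j y) \<in> polydisc v \<rho>"
    if "\<And>j z. z \<in> ball m s \<Longrightarrow> (F j has_field_derivative \<Phi> j (\<lambda>i. F i z)) (at z)"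
      "\<And>j z. z \<in> ball m s \<Longrightarrow> cmod (\<Phi> j (\<lambda>i. F i z)) \<le> B" "\<And>j. F j m = v j" and y: "y \<in> ball m s" for F y
    unfolding polydisc_def mem_Collect_eq
  proof
    fix j
    have "cmod (F j y - F j m) \<le> B * cmod (y - m)"
      by (rule field_differentiable_bound[of "ball m s" "F j" "\<lambda>z. \<Phi> j (\<lambda>i. F i z)"])
        (use that s in \<open>auto intro: has_field_derivative_at_within\<close>)
    also have "\<dots> \<le> B * r" using y s pos by (intro mult_left_mono) (auto simp: dist_norm norm_minus_commute)
    finally show "cmod (F j y - v j) \<le> \<rho>" using that(3) radius by simp
  qed
  have seg: "m + of_real t * (z - m) \<in> ball m s" if "t \<in> {0..1}" for t
  proof -
    have "t * cmod (z - m) \<le> 1 * cmod (z - m)" using that by (intro mult_right_mono) auto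
    then show ?thesis using z that by (auto simp: dist_norm norm_mult norm_minus_commute)
  qed
  have "cmod (z - m) * \<Lambda> * 1 \<le> r * \<Lambda>" using z s pos by (simp add: mult_right_mono dist_norm norm_minus_commute)
  then have lam: "cmod (z - m) * \<Lambda> * 1 \<le> 1 / 2" using radius(2) by (simp add: mult.commute)
  have "F j (m + of_real 1 * (z - m)) = G j (m + of_real 1 * (z - m))"
  proof (rule segment_unique[OF C zero_less_one lam, where f = "\<lambda>j t. F j (m + of_real t * (z - m))"
        and g = "\<lambda>j t. G j (m + of_real t * (z - m))"])
    fix j and t :: real assume t: "t \<in> {0..1}"
    show "((\<lambda>t. F j (m + of_real t * (z - m))) has_vector_derivative (z - m) * \<Phi> j (\<lambda>i. F i (m + of_real t * (z - m)))) (at t within {0..1})"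
      by (rule derivative_on_segment[OF F[OF seg[OF t]]])
    show "((\<lambda>t. G j (m + of_real t * (z - m))) has_vector_derivative (z - m) * \<Phi> j (\<lambda>i. G i (m + of_real t * (z - m)))) (at t within {0..1})"
      by (rule derivative_on_segment[OF G[OF seg[OF t]]])
  next
    fix t :: real assume t: "t \<in> {0..1}"
    show "(\<lambda>j. F j (m + of_real t * (z - m))) \<in> polydisc v \<rho>" by (rule near[OF F Fb init(1) seg[OF t]])
    show "(\<lambda>j. G j (m + of_real t * (z - m))) \<in> polydisc v \<rho>" by (rule near[OF G Gb init(2) seg[OF t]])
  qed (use init in auto)
  then show ?thesis by simp
qed

text \<open>A solution on a convex set with values in \<open>K\<close> extends to the \<open>r\<close>-neighbourhood: solve locally around
every point, and glue. Two of the local solutions agree near the midpoint of their centres, which lies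
in the convex set, and therefore on the convex intersection of their discs. The hypothesis on \<open>V\<close>
speaks of derivatives along segments so that it covers both the real axis and open strips.\<close>

lemma extend_from_convex:
  assumes conv: "convex C" and VK: "\<And>c. c \<in> C \<Longrightarrow> (\<lambda>j. V j c) \<in> K"
    and V: "\<And>c z t j. c \<in> C \<Longrightarrow> z \<in> C \<Longrightarrow> t \<in> {0..1} \<Longrightarrow>
       ((\<lambda>t. V j (c + of_real t * (z - c))) has_vector_derivative (z - c) * \<Phi> j (\<lambda>i. V i (c + of_real t * (z - c)))) (at t within {0..1})"
  shows "\<exists>W. ode_solution (\<Union>c\<in>C. ball c r) W \<and> (\<forall>c\<in>C. \<forall>j. W j c = V j c)"
proof -
  have "\<forall>c\<in>C. \<exists>f. admissible c (\<lambda>j. V j c) f \<and> picard_image c (\<lambda>j. V j c) f f"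
    using local_solution VK by metis
  then obtain f where f: "\<And>c. c \<in> C \<Longrightarrow> admissible c (\<lambda>j. V j c) (f c)"
      "\<And>c. c \<in> C \<Longrightarrow> picard_image c (\<lambda>j. V j c) (f c) (f c)" by metis
  have fP: "(\<lambda>j. f c j z) \<in> polydisc (\<lambda>j. V j c) \<rho>" if "c \<in> C" "z \<in> ball c r" for c z
    using f(1)[OF that(1)] that(2) by (simp add: admissible_def)
  note fD = picard_image_DERIV[OF f(2)]
  have fB: "cmod (\<Phi> j (\<lambda>i. f c i z)) \<le> B" if "c \<in> C" "z \<in> ball c r" for c z j
    by (rule bounded[OF VK[OF that(1)] fP[OF that]])
  have segC: "c + of_real t * (z - c) \<in> C" if "c \<in> C" "z \<in> C" "t \<in> {0..1}" for c z and t :: real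
  proof -
    have "(1 - t) *\<^sub>R c + t *\<^sub>R z \<in> C" using conv that by (auto simp: convex_alt)
    then show ?thesis by (simp add: scaleR_conv_of_real algebra_simps)
  qed
  have fV: "f c j z = V j z" if c: "c \<in> C" and z: "z \<in> C" "z \<in> ball c r" for c j z
  proof -
    have seg: "c + of_real t * (z - c) \<in> ball c r" if "t \<in> {0..1}" for t
    proof -
      have "t * cmod (z - c) \<le> 1 * cmod (z - c)" using that by (intro mult_right_mono) auto
      then show ?thesis using z that by (auto simp: dist_norm norm_mult norm_minus_commute)
    qed
    have zc: "cmod (z - c) \<le> r" using z by (simp add: dist_norm norm_minus_commute)
    have "cmod (z - c) * \<Lambda> * 1 \<le> r * \<Lambda>" using zc pos by (simp add: mult_right_mono)
    then have lam: "cmod (z - c) * \<Lambda> * 1 \<le> 1 / 2" using radius(2) by (simp add: mult.commute)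
    have "f c j (c + of_real 1 * (z - c)) = V j (c + of_real 1 * (z - c))"
    proof (rule segment_unique[OF VK[OF c] zero_less_one lam, where f = "\<lambda>j t. f c j (c + of_real t * (z - c))"
          and g = "\<lambda>j t. V j (c + of_real t * (z - c))"])
      fix j and t :: real assume t: "t \<in> {0..1}"
      show "((\<lambda>t. f c j (c + of_real t * (z - c))) has_vector_derivative (z - c) * \<Phi> j (\<lambda>i. f c i (c + of_real t * (z - c)))) (at t within {0..1})"
        by (rule derivative_on_segment[OF fD[OF c seg[OF t]]])
      show "((\<lambda>t. V j (c + of_real t * (z - c))) has_vector_derivative (z - c) * \<Phi> j (\<lambda>i. V i (c + of_real t * (z - c)))) (at t within {0..1})"
        by (rule V[OF c z(1) t])
    next
      fix t :: real assume t: "t \<in> {0..1}"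
      show "(\<lambda>j. f c j (c + of_real t * (z - c))) \<in> polydisc (\<lambda>j. V j c) \<rho>" by (rule fP[OF c seg[OF t]])
      show "(\<lambda>j. V j (c + of_real t * (z - c))) \<in> polydisc (\<lambda>j. V j c) \<rho>"
        unfolding polydisc_def mem_Collect_eq
      proof
        fix j
        have "norm (V j (c + of_real t * (z - c)) - V j (c + of_real 0 * (z - c))) \<le> (cmod (z - c) * B) * norm (t - 0)"
        proof (rule differentiable_bound[of "{0..1}" "\<lambda>t. V j (c + of_real t * (z - c))"
              "\<lambda>s h. h *\<^sub>R ((z - c) * \<Phi> j (\<lambda>i. V i (c + of_real s * (z - c))))"])
          show "((\<lambda>t. V j (c + of_real t * (z - c))) has_derivative (\<lambda>h. h *\<^sub>R ((z - c) * \<Phi> j (\<lambda>i. V i (c + of_real s * (z - c)))))) (at s within {0..1})"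
            if "s \<in> {0..1}" for s using V[OF c z(1) that] by (simp add: has_vector_derivative_def)
          show "onorm (\<lambda>h. h *\<^sub>R ((z - c) * \<Phi> j (\<lambda>i. V i (c + of_real s * (z - c))))) \<le> cmod (z - c) * B" if s: "s \<in> {0..1}" for s
          proof (rule onorm_bound)
            have "(\<lambda>i. V i (c + of_real s * (z - c))) \<in> polydisc (\<lambda>i. V i (c + of_real s * (z - c))) \<rho>"
              using pos by (simp add: polydisc_def)
            then have "cmod (\<Phi> j (\<lambda>i. V i (c + of_real s * (z - c)))) \<le> B"
              by (rule bounded[OF VK[OF segC[OF c z(1) s]]])
            then show "norm (h *\<^sub>R ((z - c) * \<Phi> j (\<lambda>i. V i (c + of_real s * (z - c))))) \<le> cmod (z - c) * B * norm h" for h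
              unfolding norm_scaleR real_norm_def norm_mult
              by (subst mult.commute) (intro mult_right_mono mult_left_mono, auto)
          qed (use pos in auto)
        qed (use t in auto)
        also have "\<dots> \<le> (cmod (z - c) * B) * 1" using t pos by (intro mult_left_mono) auto
        also have "\<dots> \<le> r * B" using zc pos by (simp add: mult_right_mono)
        finally show "cmod (V j (c + of_real t * (z - c)) - V j c) \<le> \<rho>" using radius by (simp add: mult.commute)
      qed
    qed (use f(2)[OF c] in \<open>auto simp: picard_image_def\<close>)
    then show ?thesis by simp
  qed
  have ff: "f c j z = f c' j z" if c: "c \<in> C" "c' \<in> C" and z: "z \<in> ball c r" "z \<in> ball c' r" for c c' j z
  proof -
    define m where "m = (c + c') / 2"
    have mb: "m \<in> ball c r \<inter> ball c' r" unfolding m_def by (rule midpoint_in_balls[OF z])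
    have "m = c + of_real (1/2) * (c' - c)" by (simp add: m_def field_simps)
    then have mC: "m \<in> C" using segC[OF c, of "1/2"] by simp
    have "open (ball c r \<inter> ball c' r)" by auto
    then obtain s0 where s0: "s0 > 0" "ball m s0 \<subseteq> ball c r \<inter> ball c' r" using mb by (meson openE)
    define s where "s = min s0 r"
    have s: "0 < s" "s \<le> r" "ball m s \<subseteq> ball c r" "ball m s \<subseteq> ball c' r" using s0 pos by (auto simp: s_def)
    have near: "f c j y = f c' j y" if "y \<in> ball m s" for y
      by (rule solution_unique_near[OF VK[OF mC] s(1,2) _ _ _ _ _ _ that])
        (use s(3,4) fD[OF c(1)] fD[OF c(2)] fB[OF c(1)] fB[OF c(2)] fV[OF c(1) mC] fV[OF c(2) mC] mb in \<open>simp_all add: subset_eq\<close>)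
    show ?thesis
    proof (rule analytic_continuation_open[of "ball m s" "ball c r \<inter> ball c' r" "f c j" "f c' j"])
      show "ball m s \<noteq> {}" using s by simp
      show "ball m s \<subseteq> ball c r \<inter> ball c' r" using s by simp
      show "connected (ball c r \<inter> ball c' r)" by (intro convex_connected convex_Int convex_ball)
      show "f c j holomorphic_on ball c r \<inter> ball c' r" "f c' j holomorphic_on ball c r \<inter> ball c' r"
        using f(1) c unfolding admissible_def by (metis holomorphic_on_subset Int_lower1 Int_lower2)+
      show "z \<in> ball c r \<inter> ball c' r" using z by simp
    qed (use near in auto)
  qed
  have "\<exists>W. \<forall>c\<in>C. \<forall>z\<in>ball c r. W z = f c j z" for j
  proof -
    obtain W where "W holomorphic_on (\<Union>c\<in>C. ball c r)" "\<And>c z. c \<in> C \<Longrightarrow> z \<in> ball c r \<Longrightarrow> W z = f c j z"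
    proof (rule holomorphic_glue[of C "\<lambda>c. ball c r" "\<lambda>c. f c j"])
      show "f c j holomorphic_on ball c r" if "c \<in> C" for c using f(1)[OF that] by (simp add: admissible_def)
      show "f i j z = f i' j z" if "i \<in> C" "i' \<in> C" "z \<in> ball i r" "z \<in> ball i' r" for i i' z
        using that by (rule ff)
    qed (assumption | simp)+
    then show ?thesis by blast
  qed
  then obtain W where W: "\<And>j c z. c \<in> C \<Longrightarrow> z \<in> ball c r \<Longrightarrow> W j z = f c j z" by metis
  have "ode_solution (\<Union>c\<in>C. ball c r) W"
    unfolding ode_solution_def
  proof (intro conjI ballI allI)
    fix z assume "z \<in> (\<Union>c\<in>C. ball c r)"
    then obtain c where c: "c \<in> C" "z \<in> ball c r" by blast
    show "(W j has_field_derivative \<Phi> j (\<lambda>i. W i z)) (at z)" for j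
    proof (rule has_field_derivative_transform_within_open[of "f c j" _ _ "ball c r"])
      show "(f c j has_field_derivative \<Phi> j (\<lambda>i. W i z)) (at z)" using fD[OF c] W[OF c] by simp
      show "f c j x = W j x" if "x \<in> ball c r" for x using W[OF c(1) that] by simp
    qed (use c in simp_all)
    show "\<exists>w0\<in>K. (\<lambda>j. W j z) \<in> polydisc w0 \<rho>" using fP[OF c] VK[OF c(1)] by (simp add: W[OF c]) blast
  qed
  moreover have "W j c = V j c" if "c \<in> C" for c j using W[OF that, of c j] fV[OF that that] pos by simp
  ultimately show ?thesis by blast
qed

text \<open>The a priori bound keeps the solution on each intermediate strip inside \<open>K\<close>, so the strip can be
widened by \<open>r\<close> again and again; finitely many steps reach \<open>T\<close>.\<close>

lemma strip_continuation:
  assumes VK: "\<And>x. (\<lambda>j. V j x) \<in> K" and V: "\<And>x j. (V j has_vector_derivative \<Phi> j (\<lambda>i. V i x)) (at x)"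
    and T: "0 < T"
    and apriori: "\<And>d W z. 0 < d \<Longrightarrow> d \<le> T \<Longrightarrow> ode_solution (strip d) W \<Longrightarrow>
       (\<And>x j. W j (complex_of_real x) = V j x) \<Longrightarrow> z \<in> strip d \<Longrightarrow> (\<lambda>j. W j z) \<in> K"
  obtains W where "ode_solution (strip T) W" "\<And>x j. W j (complex_of_real x) = V j x"
proof -
  have step: "\<exists>W. ode_solution (strip (min (of_nat (Suc k) * r) T)) W \<and> (\<forall>x j. W j (complex_of_real x) = V j x)" for k
  proof (induction k)
    case 0
    have "\<exists>W. ode_solution (\<Union>c\<in>\<real>. ball c r) W \<and> (\<forall>c\<in>\<real>. \<forall>j. W j c = V j (Re c))"
    proof (rule extend_from_convex)
      show "convex (\<real> :: complex set)"
        unfolding convex_def by (auto simp: scaleR_conv_of_real intro!: Reals_add Reals_mult)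
      show "(\<lambda>j. V j (Re c)) \<in> K" for c by (rule VK)
      fix c z :: complex and t :: real and j assume cz: "c \<in> \<real>" "z \<in> \<real>"
      have "((\<lambda>t. Re c + t * (Re z - Re c)) has_vector_derivative (Re z - Re c)) (at t)"
        by (auto intro!: derivative_eq_intros)
      from vector_diff_chain_at[OF this V[of j "Re c + t * (Re z - Re c)"]]
      have "((\<lambda>t. V j (Re c + t * (Re z - Re c))) has_vector_derivative
           (Re z - Re c) *\<^sub>R \<Phi> j (\<lambda>i. V i (Re c + t * (Re z - Re c)))) (at t)" by (simp add: o_def)
      moreover have "complex_of_real (Re z - Re c) = z - c" using cz by (auto simp: complex_eq_iff complex_is_Real_iff)
      ultimately show "((\<lambda>t. V j (Re (c + of_real t * (z - c)))) has_vector_derivative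
          (z - c) * \<Phi> j (\<lambda>i. V i (Re (c + of_real t * (z - c))))) (at t within {0..1})"
        by (simp add: scaleR_conv_of_real has_vector_derivative_at_within)
    qed
    then obtain W where W: "ode_solution (\<Union>c\<in>\<real>. ball c r) W" "\<And>c j. c \<in> \<real> \<Longrightarrow> W j c = V j (Re c)" by blast
    have "strip (min r T) \<subseteq> (\<Union>c\<in>\<real>. ball c r)"
    proof
      fix z assume "z \<in> strip (min r T)"
      moreover have "of_real (Re z) - z = - (\<i> * of_real (Im z))" by (simp add: complex_eq_iff)
      then have "dist (of_real (Re z)) z = \<bar>Im z\<bar>" by (simp add: dist_norm norm_mult)
      ultimately have "z \<in> ball (of_real (Re z)) r" by (simp add: strip_def)
      then show "z \<in> (\<Union>c\<in>\<real>. ball c r)" by (rule UN_I[OF Reals_of_real])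
    qed
    then show ?case using W ode_solution_subset by (intro exI[of _ W]) auto
  next
    case (Suc k)
    define d where "d = min (of_nat (Suc k) * r) T"
    have d: "0 < d" "d \<le> T" using pos T by (auto simp: d_def)
    obtain W where W: "ode_solution (strip d) W" "\<And>x j. W j (complex_of_real x) = V j x" using Suc by (auto simp: d_def)
    have "\<exists>W'. ode_solution (\<Union>c\<in>strip d. ball c r) W' \<and> (\<forall>c\<in>strip d. \<forall>j. W' j c = W j c)"
    proof (rule extend_from_convex)
      show "(\<lambda>j. W j c) \<in> K" if "c \<in> strip d" for c by (rule apriori[OF d W that])
      fix c z :: complex and t :: real and j assume cz: "c \<in> strip d" "z \<in> strip d" "t \<in> {0..1}"
      have "(1 - t) *\<^sub>R c + t *\<^sub>R z \<in> strip d" using convex_strip cz unfolding convex_alt by auto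
      then have "c + of_real t * (z - c) \<in> strip d" by (simp add: scaleR_conv_of_real algebra_simps)
      then show "((\<lambda>t. W j (c + of_real t * (z - c))) has_vector_derivative
          (z - c) * \<Phi> j (\<lambda>i. W i (c + of_real t * (z - c)))) (at t within {0..1})"
        using W(1) by (intro derivative_on_segment) (simp add: ode_solution_def)
    qed simp
    then obtain W' where W': "ode_solution (\<Union>c\<in>strip d. ball c r) W'" "\<And>c j. c \<in> strip d \<Longrightarrow> W' j c = W j c" by blast
    have "strip (min (of_nat (Suc (Suc k)) * r) T) \<subseteq> (\<Union>c\<in>strip d. ball c r)"
    proof
      fix z assume z: "z \<in> strip (min (of_nat (Suc (Suc k)) * r) T)"
      then have z': "\<bar>Im z\<bar> < d + r" "\<bar>Im z\<bar> < T" using pos by (auto simp: strip_def d_def algebra_simps)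
      \<comment> \<open>a height inside the old strip at distance less than \<open>r\<close> from \<open>z\<close>\<close>
      define h where "h = min \<bar>Im z\<bar> (max 0 ((\<bar>Im z\<bar> - r + d) / 2))"
      have h: "0 \<le> h" "h < d" "\<bar>Im z\<bar> - h < r" "h \<le> \<bar>Im z\<bar>"
        using z' d pos by (auto simp: h_def min_def max_def field_simps)
      define c where "c = Complex (Re z) (sgn (Im z) * h)"
      have "c \<in> strip d" using h by (auto simp: c_def strip_def abs_mult sgn_if)
      moreover have "c - z = Complex 0 (sgn (Im z) * h - Im z)" by (simp add: c_def complex_eq_iff)
      then have "dist c z = \<bar>sgn (Im z) * h - Im z\<bar>" by (simp add: dist_norm cmod_def)
      then have "z \<in> ball c r" using h by (auto simp: sgn_if abs_if split: if_splits)
      ultimately show "z \<in> (\<Union>c\<in>strip d. ball c r)" by (rule UN_I)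
    qed
    moreover have "W' j (complex_of_real x) = V j x" for x j using W' W(2) d by simp
    ultimately show ?case using W'(1) ode_solution_subset by blast
  qed
  obtain k where "T / r \<le> of_nat k" using real_arch_simple by blast
  then have "T \<le> of_nat k * r" using pos by (simp add: field_simps)
  also have "\<dots> \<le> of_nat (Suc k) * r" using pos by simp
  finally have "min (of_nat (Suc k) * r) T = T" by simp
  then show thesis using step[of k] that by metis
qed

end

section \<open>The comparison function\<close>

text \<open>The reciprocal of the limiting angular speed at level \<open>r\<close>. Beyond \<open>r = 1\<close> it is continued by zero, so that
inequalities of the form speed times gain at most one hold trivially there, and the comparison
argument does not have to discuss when the level \<open>1\<close> is passed.\<close>

definition gain :: "real \<Rightarrow> real \<Rightarrow> real" where
  "gain c r = (max 0 (1 - r)) powr (2/3) / sqrt (1 + c * r)"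

text \<open>The value at \<open>0\<close> is the limit of the quotient, minus the derivative of \<open>gain\<close> at \<open>0\<close>.\<close>

definition defect :: "real \<Rightarrow> real \<Rightarrow> real" where
  "defect c t = (if t = 0 then 2/3 + c/2 else (1 - gain c t) / t)"

text \<open>This integral describes the integral of \<open>gain\<close> along an exponentially growing level: the
substitution \<open>r = r\<^sub>0 exp (n s)\<close> turns \<open>\<integral> gain ds\<close> into \<open>s - (J r - J r\<^sub>0) / n\<close>, where \<open>J\<close> is this
function. Its value at \<open>1\<close> enters the constant of the asymptotic formula.\<close>

definition defect_integral :: "real \<Rightarrow> real \<Rightarrow> real" where
  "defect_integral c r = integral {0..r} (defect c)"

context
  fixes c :: real
  assumes c: "0 < c"
begin

lemma gain_0 [simp]: "gain c 0 = 1"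
  by (simp add: gain_def)

lemma gain_nonneg: "0 \<le> r \<Longrightarrow> 0 \<le> gain c r"
  using c by (simp add: gain_def)

lemma gain_pos:
  assumes "0 < r" "r < 1" shows "0 < gain c r"
  using mult_pos_pos[OF c assms(1)] assms(2) by (simp add: gain_def)

lemma gain_antimono:
  assumes "0 \<le> r" "r \<le> r'" shows "gain c r' \<le> gain c r"
  unfolding gain_def
proof (rule frac_le)
  show "max 0 (1 - r') powr (2/3) \<le> max 0 (1 - r) powr (2/3)" using assms by (intro powr_mono2) auto
  show "sqrt (1 + c * r) \<le> sqrt (1 + c * r')" using assms c by (simp add: mult_left_mono)
  have "0 \<le> c * r" using assms c by simp
  then show "0 < sqrt (1 + c * r)" by simp
qed auto

lemma gain_le_1: "0 \<le> r \<Longrightarrow> gain c r \<le> 1"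
  using gain_antimono[of 0 r] by simp

lemma continuous_on_gain: "continuous_on {0..} (gain c)"
proof -
  have "1 + c * r \<noteq> 0" if "0 \<le> r" for r using c that by (smt (verit) mult_nonneg_nonneg)
  then show ?thesis unfolding gain_def[abs_def]
    by (intro continuous_intros continuous_on_powr') auto
qed

lemma defect_nonneg: "0 \<le> t \<Longrightarrow> 0 \<le> defect c t"
  using c gain_le_1[of t] by (auto simp: defect_def)

lemma continuous_on_defect: "continuous_on {0..} (defect c)"
proof -
  have "continuous (at t within {0..}) (defect c)" if t: "0 \<le> t" for t
  proof (cases "t = 0")
    case False
    have ev: "eventually (\<lambda>s. s > 0) (at t within {0..})"
      using False t by (intro eventually_at_topological[THEN iffD2] exI[of _ "{0<..}"]) auto
    have "((\<lambda>s. (1 - gain c s) / s) \<longlongrightarrow> (1 - gain c t) / t) (at t within {0..})"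
      using continuous_on_gain t False by (intro tendsto_intros) (auto simp: continuous_on_def)
    moreover have "eventually (\<lambda>s. (1 - gain c s) / s = defect c s) (at t within {0..})"
      using ev by eventually_elim (simp add: defect_def)
    ultimately have "(defect c \<longlongrightarrow> (1 - gain c t) / t) (at t within {0..})"
      by (rule Lim_transform_eventually)
    then show ?thesis using False by (simp add: continuous_within defect_def)
  next
    case True
    have "((\<lambda>t. (1 - t) powr (2/3) / sqrt (1 + c * t)) has_real_derivative - (2/3 + c/2)) (at 0)"
      by (auto intro!: derivative_eq_intros simp: field_simps)
    then have "((\<lambda>t. ((1 - t) powr (2/3) / sqrt (1 + c * t) - 1) / t) \<longlongrightarrow> - (2/3 + c/2)) (at 0)"
      by (simp add: has_field_derivative_iff)
    then have "((\<lambda>t. - (((1 - t) powr (2/3) / sqrt (1 + c * t) - 1) / t)) \<longlongrightarrow> - (- (2/3 + c/2))) (at 0)"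
      by (rule tendsto_minus)
    then have "((\<lambda>t. - (((1 - t) powr (2/3) / sqrt (1 + c * t) - 1) / t)) \<longlongrightarrow> - (- (2/3 + c/2))) (at 0 within {0..})"
      by (rule tendsto_within_subset) simp
    then have "((\<lambda>t. - (((1 - t) powr (2/3) / sqrt (1 + c * t) - 1) / t)) \<longlongrightarrow> 2/3 + c/2) (at 0 within {0..})"
      by (simp only: minus_minus)
    moreover have "eventually (\<lambda>s. s \<noteq> 0 \<and> s < 1) (at (0::real) within {0..})"
      by (intro eventually_at_topological[THEN iffD2] exI[of _ "{..<1}"]) auto
    then have "eventually (\<lambda>t. - (((1 - t) powr (2/3) / sqrt (1 + c * t) - 1) / t) = defect c t) (at 0 within {0..})"
      by eventually_elim (simp add: defect_def gain_def max_def minus_divide_left)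
    ultimately have "(defect c \<longlongrightarrow> 2/3 + c/2) (at 0 within {0..})" by (rule Lim_transform_eventually)
    then show ?thesis using True by (simp add: continuous_within defect_def)
  qed
  then show ?thesis by (simp add: continuous_on_eq_continuous_within)
qed

lemma defect_integral_0 [simp]: "defect_integral c 0 = 0"
  by (simp add: defect_integral_def)

lemma defect_integral_within:
  assumes "0 \<le> r" "r \<le> b"
  shows "(defect_integral c has_real_derivative defect c r) (at r within {0..b})"
  unfolding defect_integral_def[abs_def]
  using integral_has_real_derivative[of 0 b "defect c" r] continuous_on_subset[OF continuous_on_defect] assms by auto

lemma defect_integral_DERIV:
  assumes "0 < r" shows "(defect_integral c has_real_derivative defect c r) (at r)"
proof -
  have "at r within {0..r + 1} = at r" using assms by (intro at_within_interior) auto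
  then show ?thesis using defect_integral_within[of r "r + 1"] assms by simp
qed

lemma defect_integral_nonneg: "0 \<le> r \<Longrightarrow> 0 \<le> defect_integral c r"
  unfolding defect_integral_def by (intro integral_nonneg integrable_continuous_real
      continuous_on_subset[OF continuous_on_defect]) (auto intro: defect_nonneg)

lemma defect_integral_lipschitz:
  obtains D where "0 \<le> D" "\<And>r s. r \<in> {0..1} \<Longrightarrow> s \<in> {0..1} \<Longrightarrow> \<bar>defect_integral c r - defect_integral c s\<bar> \<le> D * \<bar>r - s\<bar>"
proof -
  have "compact (defect c ` {0..1})"
    by (intro compact_continuous_image continuous_on_subset[OF continuous_on_defect]) auto
  then obtain D where D: "\<And>x. x \<in> {0..1} \<Longrightarrow> \<bar>defect c x\<bar> \<le> D" by (metis bounded_iff compact_imp_bounded imageI real_norm_def)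
  have "\<bar>defect_integral c r - defect_integral c s\<bar> \<le> D * \<bar>r - s\<bar>" if "r \<in> {0..1}" "s \<in> {0..1}" for r s
    using field_differentiable_bound[of "{0..1}" "defect_integral c" "defect c" D r s] D that defect_integral_within by auto
  moreover have "0 \<le> D" using D[of 0] by auto
  ultimately show thesis using that by blast
qed

lemma defect_integral_exp_DERIV:
  assumes "0 < r0"
  shows "((\<lambda>s. defect_integral c (r0 * exp (n * s))) has_real_derivative n * (1 - gain c (r0 * exp (n * s)))) (at s)"
proof -
  have p: "0 < r0 * exp (n * s)" using assms by simp
  have "((\<lambda>s. r0 * exp (n * s)) has_real_derivative r0 * (exp (n * s) * n)) (at s)"
    by (auto intro!: derivative_eq_intros)
  from DERIV_chain2[OF defect_integral_DERIV[OF p] this] show ?thesis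
    using p assms by (simp add: defect_def mult.commute[of n])
qed

end

text \<open>With \<open>F = \<bar>f\<bar>\<close> the hypothesis reads \<open>(A \<circ> F)' \<le> 1\<close>. Since \<open>\<bar>f\<bar>\<close> is not differentiable at zeros of \<open>f\<close>, and
\<open>A\<close> need not be differentiable at \<open>0\<close>, the proof uses \<open>F = sqrt (f\<^sup>2 + \<delta>\<^sup>2)\<close>, whose derivative is smaller
in absolute value, and lets \<open>\<delta>\<close> tend to \<open>0\<close>. Monotonicity of \<open>A'\<close> absorbs the difference between \<open>\<bar>f\<bar>\<close>
and \<open>F\<close>.\<close>

lemma comparison_majorant:
  fixes A A' f f' :: "real \<Rightarrow> real"
  assumes t: "0 \<le> t" and A: "\<And>s. 0 < s \<Longrightarrow> (A has_real_derivative A' s) (at s)"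
    and contA: "continuous_on {0..} A" and A'0: "\<And>s. 0 \<le> s \<Longrightarrow> 0 \<le> A' s"
    and A'mono: "\<And>s s'. 0 \<le> s \<Longrightarrow> s \<le> s' \<Longrightarrow> A' s' \<le> A' s"
    and f: "\<And>\<tau>. 0 \<le> \<tau> \<Longrightarrow> \<tau> \<le> t \<Longrightarrow> (f has_real_derivative f' \<tau>) (at \<tau> within {0..t})"
    and f0: "f 0 = 0" and bd: "\<And>\<tau>. 0 \<le> \<tau> \<Longrightarrow> \<tau> \<le> t \<Longrightarrow> \<bar>f' \<tau>\<bar> * A' \<bar>f \<tau>\<bar> \<le> 1"
  shows "A \<bar>f t\<bar> \<le> A 0 + t"
proof -
  have main: "A (sqrt ((f t)\<^sup>2 + \<delta>\<^sup>2)) \<le> A \<delta> + t" if \<delta>: "\<delta> > 0" for \<delta>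
  proof -
    define F where "F \<tau> = sqrt ((f \<tau>)\<^sup>2 + \<delta>\<^sup>2)" for \<tau>
    have Fpos: "0 < F \<tau>" "\<bar>f \<tau>\<bar> \<le> F \<tau>" for \<tau>
    proof -
      have "0 < (f \<tau>)\<^sup>2 + \<delta>\<^sup>2" using \<delta> by (simp add: add_nonneg_pos)
      then show "0 < F \<tau>" by (simp add: F_def)
      show "\<bar>f \<tau>\<bar> \<le> F \<tau>" unfolding F_def by (rule real_le_rsqrt) simp
    qed
    have dF: "(F has_real_derivative f \<tau> * f' \<tau> / F \<tau>) (at \<tau> within {0..t})" if "0 \<le> \<tau>" "\<tau> \<le> t" for \<tau>
    proof -
      have "0 < (f \<tau>)\<^sup>2 + \<delta>\<^sup>2" using \<delta> by (simp add: add_nonneg_pos)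
      then show ?thesis unfolding F_def
        by (auto intro!: derivative_eq_intros f[OF that] simp: field_simps)
    qed
    have dAF: "((\<lambda>\<tau>. A (F \<tau>)) has_real_derivative A' (F \<tau>) * (f \<tau> * f' \<tau> / F \<tau>)) (at \<tau> within {0..t})"
      if "0 \<le> \<tau>" "\<tau> \<le> t" for \<tau>
      by (rule DERIV_chain2[OF A[OF Fpos(1)] dF[OF that]])
    have b: "norm (A' (F \<tau>) * (f \<tau> * f' \<tau> / F \<tau>)) \<le> 1" if "0 \<le> \<tau>" "\<tau> \<le> t" for \<tau>
    proof -
      have "norm (A' (F \<tau>) * (f \<tau> * f' \<tau> / F \<tau>)) = A' (F \<tau>) * \<bar>f' \<tau>\<bar> * (\<bar>f \<tau>\<bar> / F \<tau>)"
        using Fpos[of \<tau>] A'0[of "F \<tau>"] by (simp add: abs_mult)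
      also have "\<dots> \<le> A' \<bar>f \<tau>\<bar> * \<bar>f' \<tau>\<bar> * 1"
        using Fpos[of \<tau>] A'0[of "F \<tau>"] A'0[of "\<bar>f \<tau>\<bar>"] A'mono[of "\<bar>f \<tau>\<bar>" "F \<tau>"]
        by (intro mult_mono) auto
      also have "\<dots> \<le> 1" using bd[OF that] by (simp add: mult.commute)
      finally show ?thesis .
    qed
    have "norm (A (F t) - A (F 0)) \<le> 1 * norm (t - 0)"
      by (rule field_differentiable_bound[of "{0..t}" "\<lambda>\<tau>. A (F \<tau>)"]) (use dAF b t in auto)
    then show ?thesis using t f0 \<delta> by (simp add: F_def)
  qed
  have cA: "(A \<longlongrightarrow> A s) (at s within {0..})" if "0 \<le> s" for s
    using contA that by (auto simp: continuous_on_def)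
  have l1: "((\<lambda>\<delta>. A (sqrt ((f t)\<^sup>2 + \<delta>\<^sup>2))) \<longlongrightarrow> A \<bar>f t\<bar>) (at_right 0)"
  proof -
    have "((\<lambda>\<delta>. sqrt ((f t)\<^sup>2 + \<delta>\<^sup>2)) \<longlongrightarrow> sqrt ((f t)\<^sup>2 + 0\<^sup>2)) (at_right 0)" by (intro tendsto_intros)
    then show ?thesis using continuous_on_tendsto_compose[OF contA, of "\<lambda>\<delta>. sqrt ((f t)\<^sup>2 + \<delta>\<^sup>2)" "\<bar>f t\<bar>" "at_right 0"] by simp
  qed
  have l2: "((\<lambda>\<delta>. A \<delta> + t) \<longlongrightarrow> A 0 + t) (at_right 0)"
    by (rule tendsto_add[OF _ tendsto_const], rule tendsto_within_subset[OF cA]) auto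
  have "eventually (\<lambda>\<delta>. A (sqrt ((f t)\<^sup>2 + \<delta>\<^sup>2)) \<le> A \<delta> + t) (at_right 0)"
    using eventually_at_right_less[of 0] by eventually_elim (rule main)
  from tendsto_le[OF trivial_limit_at_right_real l2 l1 this] show ?thesis .
qed

section \<open>The curve and its perturbation estimates\<close>

text \<open>The mean value theorem for powers, in the form used to compare \<open>cosh\<close> with half an exponential.\<close>

lemma power_add_le:
  fixes s d :: real
  assumes "0 \<le> s" "0 \<le> d"
  shows "(s + d) ^ Suc k \<le> s ^ Suc k + of_nat (Suc k) * d * (s + d) ^ k"
proof (induction k)
  case (Suc k)
  have "(s + d) ^ Suc (Suc k) = s * (s + d) ^ Suc k + d * (s + d) ^ Suc k" by (simp add: algebra_simps)
  also have "s * (s + d) ^ Suc k \<le> s * (s ^ Suc k + of_nat (Suc k) * d * (s + d) ^ k)"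
    using Suc assms by (intro mult_left_mono) auto
  also have "\<dots> = s ^ Suc (Suc k) + of_nat (Suc k) * d * (s * (s + d) ^ k)" by (simp add: algebra_simps)
  also have "s * (s + d) ^ k \<le> (s + d) ^ Suc k" using assms by (simp add: mult_right_mono)
  then have "of_nat (Suc k) * d * (s * (s + d) ^ k) \<le> of_nat (Suc k) * d * (s + d) ^ Suc k"
    using assms by (intro mult_left_mono) auto
  finally show ?case by (simp add: algebra_simps)
qed simp

lemma power_one_plus_le:
  fixes b :: real
  assumes "0 \<le> b" "of_nat n * b \<le> 1"
  shows "(1 + b) ^ n \<le> 1 + 2 * of_nat n * b"
proof -
  have "(1 + b) ^ n \<le> (exp b) ^ n" using assms by (intro power_mono) auto
  also have "\<dots> = exp (of_nat n * b)" by (simp add: exp_of_nat_mult)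
  also have "\<dots> \<le> 1 + of_nat n * b + (of_nat n * b)\<^sup>2" using assms by (intro exp_bound) auto
  also have "(of_nat n * b)\<^sup>2 \<le> of_nat n * b" using assms by (simp add: power2_eq_square mult_left_le)
  finally show ?thesis by (simp add: mult_ac)
qed

lemma DERIV_monomial:
  "((\<lambda>y::'a::real_normed_field. b * y ^ Suc k) has_field_derivative b * (of_nat (Suc k) * y ^ k)) (at y)"
proof -
  have "((\<lambda>y::'a. y ^ Suc k) has_field_derivative (1 + of_nat k) * (1 * y ^ k)) (at y)"
    by (rule DERIV_power_Suc[OF DERIV_ident])
  from DERIV_cmult[OF this, of b] show ?thesis by (simp del: power_Suc)
qed

text \<open>The parametrization by \<open>m = n - 2\<close> and \<open>\<beta> = \<epsilon> ^ (1/n)\<close> avoids subtraction and roots: the natural size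
of \<open>y\<close> at the singularity is \<open>1 / \<beta>\<close>, and all relative errors are multiples of \<open>\<beta>\<^sup>2\<close>.\<close>

locale curve =
  fixes m :: nat and \<beta> :: real
  assumes m: "1 \<le> m" and beta: "0 < \<beta>"
begin

text \<open>The exponent \<open>n\<close> is taken as a real number since it enters the estimates as a coefficient. The
coefficients of \<open>S\<close> in \<open>1 - M\<close> and in \<open>Ksq - 1\<close> are \<open>a\<close> and \<open>c a\<close>. The quantity \<open>err\<close> is one generous
multiple of \<open>\<beta>\<^sup>2\<close> that dominates every relative error below, including the powers of \<open>2\<close> lost when
\<open>(\<beta> y) ^ n\<close> is estimated with \<open>\<beta> y\<close> up to \<open>2\<close>.\<close>

definition "\<epsilon> = \<beta> ^ (m + 2)"
definition "n = real m + 2"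
definition "a = (real m + 1) * real m / 2"
definition "c = 2 / real m"
definition "err = n ^ 3 * 4 ^ (m + 4) * \<beta>\<^sup>2"

text \<open>The polynomials are defined over any real normed field, because both the real curve and its complex
continuation are needed. With \<open>f = x\<^sup>2 + y\<^sup>2 + \<epsilon> y ^ n\<close>, half the gradient of \<open>f\<close> on the curve is
\<open>(x, Ygrad y)\<close> with \<open>x\<^sup>2 = Xsq y\<close>, \<open>Ksq\<close> is its squared length, half the Hessian of \<open>f\<close> is diagonal with
entries \<open>1\<close> and \<open>Ehess y\<close>, and \<open>M\<close> is the numerator of the curvature of a level curve.\<close>

definition P :: "'a::real_normed_field \<Rightarrow> 'a" where "P y = of_real \<epsilon> * y ^ m"
definition S :: "'a::real_normed_field \<Rightarrow> 'a" where "S y = of_real \<epsilon> * y ^ (m + 2)"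
definition Xsq :: "'a::real_normed_field \<Rightarrow> 'a" where "Xsq y = 1 - y\<^sup>2 - S y"
definition Ygrad :: "'a::real_normed_field \<Rightarrow> 'a" where "Ygrad y = y * (1 + of_real (n / 2) * P y)"
definition Ehess :: "'a::real_normed_field \<Rightarrow> 'a" where "Ehess y = 1 + of_real (n * (n - 1) / 2) * P y"
definition Ksq :: "'a::real_normed_field \<Rightarrow> 'a" where "Ksq y = Xsq y + (Ygrad y)\<^sup>2"
definition M :: "'a::real_normed_field \<Rightarrow> 'a" where "M y = Ehess y * Xsq y + (Ygrad y)\<^sup>2"

lemma n_pos: "3 \<le> n" and a_ge_1: "1 \<le> a" and c_pos: "0 < c" and c_le_2: "c \<le> 2" and ca: "c * a = n - 1"
  and a_le: "a \<le> n\<^sup>2 / 2"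
proof -
  have 1: "1 \<le> real m" using m by simp
  show "3 \<le> n" "0 < c" "c \<le> 2" "c * a = n - 1" using 1 by (auto simp: n_def c_def a_def field_simps)
  have "1 * 1 \<le> real m * real m" using 1 by (intro mult_mono) auto
  then show "1 \<le> a" "a \<le> n\<^sup>2 / 2" using 1 by (auto simp: a_def n_def power2_eq_square algebra_simps)
qed

lemma n_nat: "n = real (m + 2)" by (simp add: n_def)

lemma eps_pos: "0 < \<epsilon>" using beta by (simp add: \<epsilon>_def)

lemma S_P: "S y = P y * y\<^sup>2" by (simp add: S_def P_def power_add power2_eq_square)

text \<open>Written in \<open>P\<close> and \<open>S\<close>, all terms without a factor \<open>P\<close> belong to the limit at the scale \<open>y \<approx> 1 / \<beta>\<close>, since
\<open>P\<close> is of order \<open>\<beta>\<^sup>2\<close> there.\<close>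

lemma M_expand: "M y = 1 + of_real (n * (n - 1) / 2) * P y - of_real a * S y - of_real (n * (n - 2) / 4) * P y * S y"
proof -
  have a: "of_real (n * (n - 1) / 2) = (of_real n * (of_real n - 1) / 2 :: 'a)"
    "of_real (n * (n - 2) / 4) = (of_real n * (of_real n - 2) / 4 :: 'a)"
    "of_real (n / 2) = (of_real n / 2 :: 'a)"
    "of_real a = ((of_real n - 1) * (of_real n - 2) / 2 :: 'a)" by (simp_all add: a_def n_def)
  show ?thesis unfolding M_def Ehess_def Xsq_def Ygrad_def S_P a
    by (simp add: field_simps power2_eq_square)
qed

lemma Ksq_expand: "Ksq y = 1 + of_real (n - 1) * S y + of_real (n\<^sup>2 / 4) * P y * S y"
proof -
  have a: "of_real (n - 1) = (of_real n - 1 :: 'a)" "of_real (n\<^sup>2 / 4) = ((of_real n)\<^sup>2 / 4 :: 'a)"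
    "of_real (n / 2) = (of_real n / 2 :: 'a)" by simp_all
  show ?thesis unfolding Ksq_def Xsq_def Ygrad_def S_P a
    by (simp add: field_simps power2_eq_square)
qed

lemma norm_S: "norm (S y) = (\<beta> * norm y) ^ (m + 2)"
  using beta by (simp add: S_def \<epsilon>_def norm_mult norm_power power_mult_distrib)

lemma norm_P: "norm (P y) = \<beta>\<^sup>2 * (\<beta> * norm y) ^ m"
  using beta by (simp add: P_def \<epsilon>_def norm_mult norm_power power_mult_distrib power_add power2_eq_square)

lemma P_of_real: "P (complex_of_real y) = of_real (P y)" and S_of_real: "S (complex_of_real y) = of_real (S y)"
  and Xsq_of_real: "Xsq (complex_of_real y) = of_real (Xsq y)" and Ygrad_of_real: "Ygrad (complex_of_real y) = of_real (Ygrad y)"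
  and Ehess_of_real: "Ehess (complex_of_real y) = of_real (Ehess y)" and Ksq_of_real: "Ksq (complex_of_real y) = of_real (Ksq y)"
  and M_of_real: "M (complex_of_real y) = of_real (M y)"
  by (simp_all add: P_def S_def Xsq_def Ygrad_def Ehess_def Ksq_def M_def)

lemma continuous_on_polys [continuous_intros]:
  assumes "continuous_on A f"
  shows "continuous_on A (\<lambda>x. P (f x))" "continuous_on A (\<lambda>x. S (f x))" "continuous_on A (\<lambda>x. Xsq (f x))"
    "continuous_on A (\<lambda>x. Ygrad (f x))" "continuous_on A (\<lambda>x. Ehess (f x))" "continuous_on A (\<lambda>x. Ksq (f x))"
    "continuous_on A (\<lambda>x. M (f x))"
  using assms unfolding P_def S_def Xsq_def Ygrad_def Ehess_def Ksq_def M_def by (auto intro!: continuous_intros)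

lemma holomorphic_on_polys [holomorphic_intros]:
  assumes "f holomorphic_on A"
  shows "(\<lambda>x. P (f x)) holomorphic_on A" "(\<lambda>x. Xsq (f x)) holomorphic_on A"
    "(\<lambda>x. Ygrad (f x)) holomorphic_on A" "(\<lambda>x. Ehess (f x)) holomorphic_on A" "(\<lambda>x. Ksq (f x)) holomorphic_on A"
    "(\<lambda>x. M (f x)) holomorphic_on A"
  using assms unfolding P_def S_def Xsq_def Ygrad_def Ehess_def Ksq_def M_def by (auto intro!: holomorphic_intros)

lemma DERIV_Xsq: "(Xsq has_field_derivative - 2 * Ygrad y) (at y)"
proof -
  have "((\<lambda>y::'a. 1 - y\<^sup>2 - of_real \<epsilon> * y ^ (m + 2)) has_field_derivative
     - (2 * y) - of_real \<epsilon> * (of_nat (m + 2) * y ^ (m + 1))) (at y)"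
    using DERIV_diff[OF DERIV_diff[OF DERIV_const[of 1] DERIV_monomial[of 1 1]] DERIV_monomial[of "of_real \<epsilon>" "m + 1"], of y]
    by (simp add: power2_eq_square)
  moreover have "- (2 * y) - of_real \<epsilon> * (of_nat (m + 2) * y ^ (m + 1)) = - 2 * Ygrad y"
    by (simp add: Ygrad_def P_def n_def field_simps)
  moreover have "Xsq = (\<lambda>y::'a. 1 - y\<^sup>2 - of_real \<epsilon> * y ^ (m + 2))" by (simp add: fun_eq_iff Xsq_def S_def)
  ultimately show ?thesis by simp
qed

lemma DERIV_Ygrad: "(Ygrad has_field_derivative Ehess y) (at y)"
proof -
  have y: "y ^ m * y = y ^ (m + 1)" by simp
  have eq: "Ygrad = (\<lambda>y::'a. y + of_real (n/2 * \<epsilon>) * y ^ (m + 1))"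
    by (auto simp: Ygrad_def P_def algebra_simps)
  have "((\<lambda>y::'a. y + of_real (n/2 * \<epsilon>) * y ^ (m + 1)) has_field_derivative
     1 + of_real (n/2 * \<epsilon>) * (of_nat (m + 1) * y ^ m)) (at y)"
    using DERIV_add[OF DERIV_ident DERIV_monomial[of "of_real (n/2 * \<epsilon>)" m]] by simp
  moreover have "1 + of_real (n/2 * \<epsilon>) * (of_nat (m + 1) * y ^ m) = Ehess y"
    by (simp add: Ehess_def P_def n_def field_simps)
  ultimately show ?thesis unfolding eq by simp
qed

lemma DERIV_Ksq: "(Ksq has_field_derivative 2 * Ygrad y * (Ehess y - 1)) (at y)"
  unfolding Ksq_def[abs_def]
  by (auto intro!: derivative_eq_intros DERIV_Xsq DERIV_Ygrad simp: algebra_simps)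

lemma beta_le_err: "n\<^sup>2 * (n * 2 ^ (m + 4) + 2) * \<beta>\<^sup>2 \<le> err"
proof -
  have n0: "1 \<le> n" using n_pos by simp
  have "(1::real) \<le> 2 ^ (m + 4)" by (rule one_le_power) simp
  then have "(2::real) ^ (m + 4) + 1 \<le> 2 * 2 ^ (m + 4)" by linarith
  also have "(2::real) * 2 ^ (m + 4) \<le> 2 ^ (m + 4) * 2 ^ (m + 4)"
  proof (rule mult_right_mono)
    have "(1::real) \<le> 2 ^ m" by (rule one_le_power) simp
    moreover have "(2::real) ^ (m + 4) = 16 * 2 ^ m" by (simp add: power_add)
    ultimately show "(2::real) \<le> 2 ^ (m + 4)" by linarith
  qed simp
  also have "\<dots> = 4 ^ (m + 4)" by (simp flip: power_mult_distrib)
  finally have 4: "(2::real) ^ (m + 4) + 1 \<le> 4 ^ (m + 4)" .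
  have "n * 2 ^ (m + 4) + 2 \<le> n * 2 ^ (m + 4) + n" using n_pos by simp
  also have "\<dots> = n * (2 ^ (m + 4) + 1)" by (simp add: algebra_simps)
  also have "\<dots> \<le> n * 4 ^ (m + 4)" using 4 n0 by (intro mult_left_mono) auto
  finally have "n\<^sup>2 * (n * 2 ^ (m + 4) + 2) * \<beta>\<^sup>2 \<le> n\<^sup>2 * (n * 4 ^ (m + 4)) * \<beta>\<^sup>2"
    by (intro mult_right_mono mult_left_mono) auto
  then show ?thesis by (simp add: err_def power3_eq_cube power2_eq_square)
qed

lemma err_pos: "0 < err" using beta n_pos by (simp add: err_def)

lemma beta_bounds:
  shows "2 * n\<^sup>2 * \<beta>\<^sup>2 \<le> err" "n * \<beta>\<^sup>2 \<le> err" "\<beta>\<^sup>2 \<le> err"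
proof -
  have n1: "1 \<le> n" using n_pos by simp
  have "2 * n\<^sup>2 * \<beta>\<^sup>2 \<le> n\<^sup>2 * (n * 2 ^ (m + 4) + 2) * \<beta>\<^sup>2"
    using n1 by (intro mult_right_mono) (auto simp: algebra_simps)
  then show 1: "2 * n\<^sup>2 * \<beta>\<^sup>2 \<le> err" using beta_le_err by simp
  have "n \<le> n\<^sup>2" "1 \<le> n\<^sup>2" using n1 by (auto simp: power2_eq_square intro: mult_le_cancel_left1[THEN iffD2] order_trans[OF n1])
  then have "n * \<beta>\<^sup>2 \<le> 2 * n\<^sup>2 * \<beta>\<^sup>2" "1 * \<beta>\<^sup>2 \<le> 2 * n\<^sup>2 * \<beta>\<^sup>2"
    by (simp_all only: mult_1_left) (auto intro!: mult_right_mono mult_right_mono[of 1 "2 * n\<^sup>2" "\<beta>\<^sup>2", simplified])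
  then show "n * \<beta>\<^sup>2 \<le> err" "\<beta>\<^sup>2 \<le> err" using 1 by auto
qed

lemma perturbation_bounds:
  assumes y: "\<beta> * norm y \<le> 1"
  defines "s \<equiv> (\<beta> * norm y) ^ (m + 2)"
  shows "norm (P y) \<le> \<beta>\<^sup>2" "norm (M y - 1) \<le> a * s + n\<^sup>2 * \<beta>\<^sup>2" "norm (Ksq y - 1) \<le> (n - 1) * s + n\<^sup>2 * \<beta>\<^sup>2"
proof -
  have w0: "0 \<le> \<beta> * norm y" using beta by simp
  have "(\<beta> * norm y) ^ m \<le> 1" using power_le_one[OF w0 y] .
  then show P: "norm (P y) \<le> \<beta>\<^sup>2" by (simp add: norm_P mult_left_le)
  have s: "norm (S y) = s" "s \<le> 1" "0 \<le> s"
    unfolding s_def norm_S using power_le_one[OF w0 y, of "m + 2"] zero_le_power[OF w0, of "m + 2"] by blast+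
  have PS: "norm (P y * S y) \<le> \<beta>\<^sup>2 * 1" unfolding norm_mult using P s by (intro mult_mono) auto
  have n3: "3 \<le> n" by (rule n_pos)
  have "norm (M y - 1) = norm (of_real (n * (n - 1) / 2) * P y - of_real a * S y - of_real (n * (n - 2) / 4) * (P y * S y))"
    by (subst M_expand) (simp only: mult.assoc, simp add: algebra_simps)
  also have "\<dots> \<le> norm (of_real (n * (n - 1) / 2) * P y) + norm (of_real a * S y) + norm (of_real (n * (n - 2) / 4) * (P y * S y))"
    by (meson add_mono norm_triangle_ineq4 order_refl order_trans)
  also have "\<dots> = n * (n - 1) / 2 * norm (P y) + a * s + n * (n - 2) / 4 * norm (P y * S y)"
    using n3 a_ge_1 s(1) by (simp only: norm_mult norm_of_real) (simp add: abs_mult)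
  also have "\<dots> \<le> n * (n - 1) / 2 * \<beta>\<^sup>2 + a * s + n * (n - 2) / 4 * (\<beta>\<^sup>2 * 1)"
    using n3 P PS a_ge_1 by (intro add_mono mult_left_mono) auto
  also have "\<dots> = a * s + (n * (n - 1) / 2 + n * (n - 2) / 4) * \<beta>\<^sup>2" by (simp add: algebra_simps)
  also have "\<dots> \<le> a * s + n\<^sup>2 * \<beta>\<^sup>2"
    using n3 by (intro add_left_mono mult_right_mono) (auto simp: power2_eq_square field_simps)
  finally show "norm (M y - 1) \<le> a * s + n\<^sup>2 * \<beta>\<^sup>2" .
  have "norm (Ksq y - 1) = norm (of_real (n - 1) * S y + of_real (n\<^sup>2 / 4) * (P y * S y))"
    by (simp add: Ksq_expand mult.assoc)
  also have "\<dots> \<le> norm (of_real (n - 1) * S y) + norm (of_real (n\<^sup>2 / 4) * (P y * S y))"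
    by (rule norm_triangle_ineq)
  also have "\<dots> = (n - 1) * s + n\<^sup>2 / 4 * norm (P y * S y)"
    using n3 s(1) by (simp only: norm_mult norm_of_real) (simp add: abs_mult)
  also have "\<dots> \<le> (n - 1) * s + n\<^sup>2 / 4 * (\<beta>\<^sup>2 * 1)" using PS n3 by (intro add_mono mult_left_mono) auto
  also have "\<dots> \<le> (n - 1) * s + n\<^sup>2 * \<beta>\<^sup>2" by simp
  finally show "norm (Ksq y - 1) \<le> (n - 1) * s + n\<^sup>2 * \<beta>\<^sup>2" .
qed

text \<open>At imaginary angle \<open>\<eta>\<close> the largest possible \<open>\<bar>y\<bar>\<close> is about \<open>exp \<eta> / 2\<close>, and the level is \<open>a \<epsilon> \<bar>y\<bar> ^ n\<close> at that
point, so that \<open>M\<close> can vanish only when the level reaches \<open>1\<close>. The factor \<open>1 / (1 - err)\<close> turns the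
additive error in \<open>\<bar>M - 1\<bar> \<le> (1 - err) level + err\<close> into the multiplicative one of
\<open>\<bar>M\<bar> \<ge> (1 - err) (1 - level)\<close>, which remains useful up to level \<open>1\<close>.\<close>

definition "r0 = a * \<epsilon> / 2 ^ (m + 2) / (1 - err)"
definition level :: "real \<Rightarrow> real" where "level \<eta> = r0 * exp (n * \<eta>)"

end

locale small_curve = curve +
  assumes err: "err \<le> 1/100"
begin

lemma beta_small: "\<beta> \<le> 1" "\<beta>\<^sup>2 \<le> 1/100"
  using beta_bounds(3) err beta abs_square_le_1[of \<beta>] by auto

lemma beta_tenth: "\<beta> \<le> 1/10"
  using beta_small(2) beta power2_le_imp_le[of \<beta> "1/10"] by (simp add: power2_eq_square)

lemma r0_pos: "0 < r0" using a_ge_1 eps_pos err by (simp add: r0_def)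

lemma level_pos: "0 < level \<eta>" using r0_pos by (simp add: level_def)

lemma level_mono: "\<eta> \<le> \<eta>' \<Longrightarrow> level \<eta> \<le> level \<eta>'" using r0_pos n_pos by (simp add: level_def)

lemma level_eq: "(1 - err) * level \<eta> = a * (\<beta> * exp \<eta> / 2) ^ (m + 2)"
proof -
  have "exp (n * \<eta>) = exp \<eta> ^ (m + 2)" unfolding n_nat by (rule exp_of_nat_mult)
  then show ?thesis using err
    unfolding level_def r0_def \<epsilon>_def power_mult_distrib power_divide by (simp add: field_simps)
qed


text \<open>The bound on \<open>y\<^sup>2 (1 + P y)\<close> gives \<open>\<beta> \<bar>y\<bar> \<le> \<beta> cosh \<eta> (1 + \<beta>\<^sup>2)\<close>. Here \<open>\<beta> cosh \<eta> = t + d\<close> with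
\<open>t = \<beta> exp \<eta> / 2 \<le> 1\<close> and \<open>t d = \<beta>\<^sup>2 / 4\<close>, so replacing \<open>cosh\<close> by half the exponential costs only
\<open>O(\<beta>\<^sup>2)\<close> in the \<open>n\<close>-th power.\<close>

lemma level_bounds_aux:
  assumes eta: "0 \<le> \<eta>" "level \<eta> < 1" and y: "\<beta> * norm y \<le> 1"
    and u: "norm (y\<^sup>2 * (1 + P y)) \<le> (cosh \<eta>)\<^sup>2"
  defines "s \<equiv> (\<beta> * exp \<eta> / 2) ^ (m + 2)"
  shows "(\<beta> * norm y) ^ (m + 2) \<le> s + n * 2 ^ (m + 4) * \<beta>\<^sup>2"
    and "(\<beta> * norm y) ^ m * (\<beta> * cosh \<eta>)\<^sup>2 \<le> s + n * 2 ^ (m + 4) * \<beta>\<^sup>2"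
proof -
  define t where "t = \<beta> * exp \<eta> / 2"
  define X where "X = \<beta> * cosh \<eta>"
  define d where "d = \<beta> * exp (- \<eta>) / 2"
  have st: "s = t ^ (m + 2)" by (simp add: s_def t_def)
  have n3: "3 \<le> n" by (rule n_pos)
  have t0: "0 < t" using beta by (simp add: t_def)
  have "(1 - err) * level \<eta> \<le> 1 * level \<eta>" using err_pos level_pos[of \<eta>] by (intro mult_right_mono) auto
  then have as: "a * s < 1" using level_eq[of \<eta>] eta(2) by (simp add: s_def)
  have "1 * s \<le> a * s" using a_ge_1 t0 by (intro mult_right_mono) (auto simp: st)
  then have "s < 1" using as by simp
  then have t1: "t \<le> 1" using t0 by (metis st linorder_not_le one_le_power order_less_imp_le)
  have Xtd: "X = t + d" by (simp add: X_def t_def d_def cosh_def field_simps)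
  have d: "0 < d" "d \<le> t" using beta eta by (auto simp: d_def t_def)
  have td: "d * t = \<beta>\<^sup>2 / 4" by (simp add: d_def t_def power2_eq_square exp_minus)
  have Xn: "X ^ (m + 2) \<le> s + n * 2 ^ (m + 2) * \<beta>\<^sup>2"
  proof -
    have "X ^ Suc (m + 1) \<le> t ^ Suc (m + 1) + of_nat (Suc (m + 1)) * d * (t + d) ^ (m + 1)"
      unfolding Xtd using t0 d by (intro power_add_le) auto
    also have "(t + d) ^ (m + 1) \<le> (2 * t) ^ (m + 1)" using t0 d by (intro power_mono) auto
    then have "of_nat (Suc (m + 1)) * d * (t + d) ^ (m + 1) \<le> of_nat (Suc (m + 1)) * d * (2 * t) ^ (m + 1)"
      using d by (intro mult_left_mono) auto
    also have "of_nat (Suc (m + 1)) * d * (2 * t) ^ (m + 1) = n * 2 ^ (m + 1) * (d * t) * t ^ m"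
      by (simp add: n_def power_mult_distrib)
    also have "\<dots> \<le> n * 2 ^ (m + 1) * (d * t) * 1"
      using t0 t1 d n3 by (intro mult_left_mono power_le_one) auto
    also have "\<dots> \<le> n * 2 ^ (m + 2) * \<beta>\<^sup>2" unfolding td using n3 by simp
    finally show ?thesis by (simp add: st)
  qed
  define v where "v = \<beta> * norm y"
  have v0: "0 \<le> v" using beta by (simp add: v_def)
  have X0: "0 \<le> X" using beta by (simp add: X_def)
  have b: "\<beta>\<^sup>2 \<le> 1/100" by (rule beta_small)
  have vX: "v \<le> X * (1 + \<beta>\<^sup>2)"
  proof -
    have "norm (P y) \<le> \<beta>\<^sup>2" by (rule perturbation_bounds[OF y])
    then have "1 - \<beta>\<^sup>2 \<le> norm (1 + P y)" using norm_triangle_ineq4[of "1 + P y" "P y"] by simp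
    then have "(norm y)\<^sup>2 * (1 - \<beta>\<^sup>2) \<le> (norm y)\<^sup>2 * norm (1 + P y)" by (intro mult_left_mono) auto
    also have "\<dots> \<le> (cosh \<eta>)\<^sup>2" using u by (simp add: norm_mult norm_power)
    finally have "\<beta>\<^sup>2 * ((norm y)\<^sup>2 * (1 - \<beta>\<^sup>2)) \<le> \<beta>\<^sup>2 * (cosh \<eta>)\<^sup>2" by (intro mult_left_mono) auto
    then have 1: "v\<^sup>2 * (1 - \<beta>\<^sup>2) \<le> X\<^sup>2" by (simp add: v_def X_def power_mult_distrib algebra_simps)
    have "(1 + \<beta>\<^sup>2)\<^sup>2 * (1 - \<beta>\<^sup>2) = 1 + \<beta>\<^sup>2 * (1 - \<beta>\<^sup>2 - \<beta>\<^sup>2 * \<beta>\<^sup>2)" by (simp add: power2_eq_square algebra_simps)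
    moreover have "\<beta>\<^sup>2 * \<beta>\<^sup>2 \<le> 1/100 * (1/100)" using b by (intro mult_mono) auto
    then have "0 \<le> \<beta>\<^sup>2 * (1 - \<beta>\<^sup>2 - \<beta>\<^sup>2 * \<beta>\<^sup>2)" using b by (intro mult_nonneg_nonneg) auto
    ultimately have 2: "1 \<le> (1 + \<beta>\<^sup>2)\<^sup>2 * (1 - \<beta>\<^sup>2)" by simp
    have "v\<^sup>2 * 1 \<le> v\<^sup>2 * ((1 + \<beta>\<^sup>2)\<^sup>2 * (1 - \<beta>\<^sup>2))" using 2 by (intro mult_left_mono) auto
    also have "\<dots> = (v\<^sup>2 * (1 - \<beta>\<^sup>2)) * (1 + \<beta>\<^sup>2)\<^sup>2" by (simp only: mult_ac)
    also have "\<dots> \<le> X\<^sup>2 * (1 + \<beta>\<^sup>2)\<^sup>2" using 1 by (intro mult_right_mono) auto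
    finally have "v\<^sup>2 \<le> (X * (1 + \<beta>\<^sup>2))\<^sup>2" by (simp add: power_mult_distrib)
    then show ?thesis using X0 by (intro power2_le_imp_le[of v]) auto
  qed
  have nb: "n * \<beta>\<^sup>2 \<le> 1/100" using beta_bounds(2) err by simp
  have pj: "v ^ j * X ^ (m + 2 - j) \<le> s + n * 2 ^ (m + 4) * \<beta>\<^sup>2" if "j \<le> m + 2" for j
  proof -
    have "v ^ j \<le> (X * (1 + \<beta>\<^sup>2)) ^ j" using vX v0 by (intro power_mono)
    also have "\<dots> = X ^ j * (1 + \<beta>\<^sup>2) ^ j" by (simp add: power_mult_distrib)
    also have "\<dots> \<le> X ^ j * (1 + \<beta>\<^sup>2) ^ (m + 2)"
      using X0 that by (intro mult_left_mono power_increasing) auto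
    finally have "v ^ j * X ^ (m + 2 - j) \<le> (X ^ j * (1 + \<beta>\<^sup>2) ^ (m + 2)) * X ^ (m + 2 - j)"
      using X0 by (intro mult_right_mono) auto
    also have "\<dots> = X ^ (m + 2) * (1 + \<beta>\<^sup>2) ^ (m + 2)"
      using that by (simp add: mult.commute mult.left_commute flip: power_add del: power_Suc)
    also have "\<dots> \<le> (s + n * 2 ^ (m + 2) * \<beta>\<^sup>2) * (1 + 2 * n * \<beta>\<^sup>2)"
    proof (rule mult_mono[OF Xn])
      show "(1 + \<beta>\<^sup>2) ^ (m + 2) \<le> 1 + 2 * n * \<beta>\<^sup>2"
        using power_one_plus_le[of "\<beta>\<^sup>2" "m + 2"] nb unfolding n_nat by simp
      show "0 \<le> s + n * 2 ^ (m + 2) * \<beta>\<^sup>2" using n3 t0 by (simp add: st)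
    qed simp
    also have "\<dots> = s + s * (2 * n * \<beta>\<^sup>2) + n * 2 ^ (m + 2) * \<beta>\<^sup>2 * (1 + 2 * (n * \<beta>\<^sup>2))" by (simp add: algebra_simps)
    also have "\<dots> \<le> s + 1 * (2 * n * \<beta>\<^sup>2) + n * 2 ^ (m + 2) * \<beta>\<^sup>2 * 2"
      using \<open>s < 1\<close> nb n3 by (intro add_mono mult_right_mono mult_left_mono) auto
    also have "\<dots> = s + n * \<beta>\<^sup>2 * (2 + 2 * 2 ^ (m + 2))" by (simp add: algebra_simps)
    also have "\<dots> \<le> s + n * \<beta>\<^sup>2 * 2 ^ (m + 4)"
    proof (intro add_left_mono mult_left_mono)
      have "(1::real) \<le> 2 ^ m" by (rule one_le_power) simp
      moreover have "(2::real) ^ (m + 2) = 4 * 2 ^ m" "(2::real) ^ (m + 4) = 16 * 2 ^ m" by (simp_all add: power_add)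
      ultimately show "(2 + 2 * 2 ^ (m + 2) :: real) \<le> 2 ^ (m + 4)" by linarith
    qed (use n3 in auto)
    finally show ?thesis by (simp add: mult_ac)
  qed
  show "(\<beta> * norm y) ^ (m + 2) \<le> s + n * 2 ^ (m + 4) * \<beta>\<^sup>2" using pj[of "m + 2"] by (simp add: v_def)
  show "(\<beta> * norm y) ^ m * (\<beta> * cosh \<eta>)\<^sup>2 \<le> s + n * 2 ^ (m + 4) * \<beta>\<^sup>2" using pj[of m] by (simp add: v_def X_def)
qed

text \<open>All bounds hold with the level attained at an upper bound \<open>\<eta>\<close> for the imaginary angle. The first one
keeps \<open>M\<close> in the disc of radius \<open>1\<close> around \<open>1\<close>, the next two bound the speed, and the last one bounds
the variation of \<open>k\<close>.\<close>

lemma level_bounds: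
  assumes eta: "0 \<le> \<eta>" "level \<eta> < 1" and y: "\<beta> * norm y \<le> 1"
    and u: "norm (y\<^sup>2 * (1 + P y)) \<le> (cosh \<eta>)\<^sup>2"
  shows "a * (\<beta> * norm y) ^ (m + 2) + n\<^sup>2 * \<beta>\<^sup>2 \<le> (1 - err) * level \<eta> + err"
    and "norm (Ksq y) \<le> (1 + err) * (1 + c * level \<eta>)"
    and "(1 - err) * (1 - level \<eta>) \<le> norm (M y)"
    and "n * (n - 1) / 2 * (norm (P y) * (cosh \<eta>)\<^sup>2) \<le> n / 2 * (c * level \<eta> + err)"
proof -
  note aux = level_bounds_aux[OF eta y u]
  define s where "s = (\<beta> * exp \<eta> / 2) ^ (m + 2)"
  define D where "D = n * 2 ^ (m + 4)"
  have n3: "3 \<le> n" by (rule n_pos)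
  have D0: "0 \<le> D" using n3 by (simp add: D_def)
  have as: "a * s = (1 - err) * level \<eta>" by (simp add: level_eq s_def)
  have be: "n\<^sup>2 * (D + 2) * \<beta>\<^sup>2 \<le> err" using beta_le_err by (simp add: D_def)
  have w: "(\<beta> * norm y) ^ (m + 2) \<le> s + D * \<beta>\<^sup>2" using aux(1) by (simp add: s_def D_def)
  have "a * (\<beta> * norm y) ^ (m + 2) \<le> a * s + a * D * \<beta>\<^sup>2"
    using mult_left_mono[OF w, of a] a_ge_1 by (simp add: algebra_simps)
  moreover have "a * D * \<beta>\<^sup>2 \<le> n\<^sup>2 * D * \<beta>\<^sup>2" using a_le D0 by (intro mult_right_mono order_trans[OF a_le]) auto
  moreover have "n\<^sup>2 * (D + 2) * \<beta>\<^sup>2 = n\<^sup>2 * D * \<beta>\<^sup>2 + 2 * (n\<^sup>2 * \<beta>\<^sup>2)" by (simp add: algebra_simps)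
  moreover have "0 \<le> n\<^sup>2 * \<beta>\<^sup>2" by simp
  ultimately show 1: "a * (\<beta> * norm y) ^ (m + 2) + n\<^sup>2 * \<beta>\<^sup>2 \<le> (1 - err) * level \<eta> + err"
    using be as by linarith
  have "norm (M y - 1) \<le> (1 - err) * level \<eta> + err" using perturbation_bounds(2)[OF y] 1 by simp
  moreover have "1 - norm (M y - 1) \<le> norm (M y)" using norm_triangle_ineq4[of "M y" "M y - 1"] by simp
  ultimately show "(1 - err) * (1 - level \<eta>) \<le> norm (M y)" by (simp add: algebra_simps)
  have cs: "(n - 1) * s \<le> c * level \<eta>"
  proof -
    have "(n - 1) * s = c * (a * s)" using ca by (simp flip: mult.assoc)
    also have "\<dots> \<le> c * (1 * level \<eta>)" unfolding as using c_pos level_pos[of \<eta>] err_pos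
      by (intro mult_left_mono mult_right_mono) auto
    finally show ?thesis by simp
  qed
  have n1D: "(n - 1) * D * \<beta>\<^sup>2 \<le> n\<^sup>2 * D * \<beta>\<^sup>2"
    using n3 D0 by (intro mult_right_mono) (auto simp: power2_eq_square intro: order_trans[of _ "n * 1"])
  have "norm (Ksq y) \<le> 1 + norm (Ksq y - 1)" using norm_triangle_ineq[of 1 "Ksq y - 1"] by simp
  also have "\<dots> \<le> 1 + ((n - 1) * (s + D * \<beta>\<^sup>2) + n\<^sup>2 * \<beta>\<^sup>2)"
    using perturbation_bounds(3)[OF y] mult_left_mono[OF w, of "n - 1"] n3 by linarith
  also have "\<dots> = 1 + (n - 1) * s + ((n - 1) * D * \<beta>\<^sup>2 + n\<^sup>2 * \<beta>\<^sup>2)" by (simp add: algebra_simps)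
  also have "\<dots> \<le> 1 + c * level \<eta> + err"
  proof -
    have "(n - 1) * D * \<beta>\<^sup>2 + n\<^sup>2 * \<beta>\<^sup>2 \<le> err" using n1D be by (simp add: algebra_simps) (smt (verit) zero_le_mult_iff zero_le_power2)
    then show ?thesis using cs by linarith
  qed
  also have "\<dots> \<le> (1 + err) * (1 + c * level \<eta>)"
    using err_pos c_pos level_pos[of \<eta>] by (simp add: algebra_simps)
  finally show "norm (Ksq y) \<le> (1 + err) * (1 + c * level \<eta>)" .
  have "norm (P y) * (cosh \<eta>)\<^sup>2 = (\<beta> * norm y) ^ m * (\<beta> * cosh \<eta>)\<^sup>2"
    by (simp add: norm_P power_mult_distrib mult_ac)
  also have "\<dots> \<le> s + D * \<beta>\<^sup>2" using aux(2) by (simp add: s_def D_def)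
  finally have "n / 2 * (n - 1) * (norm (P y) * (cosh \<eta>)\<^sup>2) \<le> n / 2 * (n - 1) * (s + D * \<beta>\<^sup>2)"
    using n3 by (intro mult_left_mono) auto
  also have "\<dots> = n / 2 * ((n - 1) * s + (n - 1) * D * \<beta>\<^sup>2)" by (simp only: distrib_left mult.assoc)
  also have "\<dots> \<le> n / 2 * (c * level \<eta> + err)"
  proof (intro mult_left_mono add_mono cs)
    show "(n - 1) * D * \<beta>\<^sup>2 \<le> err" using n1D be by (simp add: algebra_simps) (smt (verit) zero_le_mult_iff zero_le_power2)
  qed (use n3 in auto)
  finally show "n * (n - 1) / 2 * (norm (P y) * (cosh \<eta>)\<^sup>2) \<le> n / 2 * (c * level \<eta> + err)" by (simp add: mult_ac)
qed

lemma M_power_bound: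
  assumes "r < 1" "(1 - err) * (1 - r) \<le> M'"
  shows "M' powr (-2/3) \<le> (1 - r) powr (-2/3) / (1 - err)"
proof -
  have e: "0 < err" "err \<le> 1/100" using err_pos err by auto
  have "M' powr (-2/3) \<le> ((1 - err) * (1 - r)) powr (-2/3)" using assms e by (intro powr_mono2') auto
  also have "\<dots> = (1 - err) powr (-2/3) * (1 - r) powr (-2/3)" using e assms by (simp add: powr_mult)
  also have "\<dots> \<le> (1 - err) powr (-1) * (1 - r) powr (-2/3)"
    using e powr_mono'[of "-1" "-2/3" "1 - err"] by (intro mult_right_mono) auto
  also have "\<dots> = (1 - r) powr (-2/3) / (1 - err)" using e powr_neg_one[of "1 - err"] by simp
  finally show ?thesis .
qed

text \<open>The factors of the angular speed are bounded by those of \<open>1 / gain\<close> up to \<open>1 + err\<close> or \<open>1 / (1 - err)\<close>.\<close>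

lemma speed_bound:
  fixes K M' qt :: real
  assumes r: "0 \<le> r" and K: "0 \<le> K" "K \<le> (1 + err) * (1 + c * r)" and qt: "0 \<le> qt" "qt \<le> 1 + err"
    and M: "(1 - err) * (1 - r) \<le> M'" "0 < M'"
  shows "qt * sqrt K * M' powr (-2/3) * gain c r \<le> 1 + 5 * err"
proof (cases "r < 1")
  case False
  then show ?thesis using err_pos by (simp add: gain_def)
next
  case True
  have e: "0 < err" "err \<le> 1/100" using err_pos err by auto
  have cr: "0 < 1 + c * r" using c_pos r by (smt (verit) mult_nonneg_nonneg)
  have "sqrt K \<le> sqrt ((1 + err) * (1 + c * r))" using K by simp
  also have "\<dots> = sqrt (1 + err) * sqrt (1 + c * r)" by (rule real_sqrt_mult)
  also have "\<dots> \<le> (1 + err) * sqrt (1 + c * r)"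
    using e cr by (intro mult_right_mono) (auto intro!: real_le_lsqrt simp: power2_eq_square algebra_simps)
  finally have k: "sqrt K \<le> (1 + err) * sqrt (1 + c * r)" .
  have p: "M' powr (-2/3) \<le> (1 - r) powr (-2/3) / (1 - err)" by (rule M_power_bound[OF True M(1)])
  have "qt * sqrt K * M' powr (-2/3) \<le> (1 + err) * ((1 + err) * sqrt (1 + c * r)) * ((1 - r) powr (-2/3) / (1 - err))"
    using qt k p K e cr by (intro mult_mono) (auto intro!: mult_nonneg_nonneg)
  then have "qt * sqrt K * M' powr (-2/3) * gain c r \<le>
      (1 + err) * ((1 + err) * sqrt (1 + c * r)) * ((1 - r) powr (-2/3) / (1 - err)) * gain c r"
    using gain_nonneg[OF c_pos r] by (intro mult_right_mono)
  also have "\<dots> = (1 + err)\<^sup>2 / (1 - err) * ((1 - r) powr (-2/3) * (1 - r) powr (2/3)) * (sqrt (1 + c * r) / sqrt (1 + c * r))"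
    using True by (simp add: gain_def max_def power2_eq_square)
  also have "\<dots> = (1 + err)\<^sup>2 / (1 - err)" using True cr by (simp flip: powr_add)
  also have "\<dots> \<le> 1 + 5 * err"
  proof -
    have "6 * err\<^sup>2 \<le> 2 * err" using e by (simp add: power2_eq_square)
    then have "(1 + err)\<^sup>2 \<le> (1 + 5 * err) * (1 - err)" by (simp add: power2_eq_square algebra_simps)
    then show ?thesis using e by (simp add: divide_le_eq)
  qed
  finally show ?thesis .
qed

end

section \<open>The differential equation of the curve in complex time\<close>

text \<open>Sums over coordinates never occur, so one constant for the bound and the Lipschitz estimate in the
coordinatewise sense suffices. The class is closed under products, which reduces the estimates for
the vector field to those for its factors.\<close>

definition bounded_lipschitz :: "('i \<Rightarrow> complex) set \<Rightarrow> (('i \<Rightarrow> complex) \<Rightarrow> complex) \<Rightarrow> bool" where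
  "bounded_lipschitz D f \<longleftrightarrow> (\<exists>C\<ge>0. (\<forall>w\<in>D. cmod (f w) \<le> C) \<and>
     (\<forall>w\<in>D. \<forall>w'\<in>D. \<forall>b. (\<forall>j. cmod (w j - w' j) \<le> b) \<longrightarrow> cmod (f w - f w') \<le> C * b))"

lemma bounded_lipschitz_mult:
  assumes "bounded_lipschitz D f" "bounded_lipschitz D g"
  shows "bounded_lipschitz D (\<lambda>w. f w * g w)"
proof -
  obtain C where C: "0 \<le> C" "\<And>w. w \<in> D \<Longrightarrow> cmod (f w) \<le> C"
      "\<And>w w' b. w \<in> D \<Longrightarrow> w' \<in> D \<Longrightarrow> (\<And>j. cmod (w j - w' j) \<le> b) \<Longrightarrow> cmod (f w - f w') \<le> C * b"
    using assms(1) unfolding bounded_lipschitz_def by blast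
  obtain C' where C': "0 \<le> C'" "\<And>w. w \<in> D \<Longrightarrow> cmod (g w) \<le> C'"
      "\<And>w w' b. w \<in> D \<Longrightarrow> w' \<in> D \<Longrightarrow> (\<And>j. cmod (w j - w' j) \<le> b) \<Longrightarrow> cmod (g w - g w') \<le> C' * b"
    using assms(2) unfolding bounded_lipschitz_def by blast
  have "cmod (f w * g w) \<le> 2 * C * C'" if "w \<in> D" for w
  proof -
    have "cmod (f w * g w) \<le> C * C'" unfolding norm_mult using C C' that by (intro mult_mono) auto
    moreover have "0 \<le> C * C'" using C C' by simp
    ultimately show ?thesis by simp
  qed
  moreover have "cmod (f w * g w - f w' * g w') \<le> 2 * C * C' * b"
    if "w \<in> D" "w' \<in> D" "\<And>j. cmod (w j - w' j) \<le> b" for w w' b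
  proof -
    have b: "0 \<le> b" using that(3) norm_ge_zero order_trans by blast
    have "f w * g w - f w' * g w' = f w * (g w - g w') + (f w - f w') * g w'" by (simp add: algebra_simps)
    then have "cmod (f w * g w - f w' * g w') \<le> cmod (f w) * cmod (g w - g w') + cmod (f w - f w') * cmod (g w')"
      by (metis norm_mult norm_triangle_ineq)
    also have "\<dots> \<le> C * (C' * b) + (C * b) * C'"
      using C(1) C(2)[OF that(1)] C'(1) C'(2)[OF that(2)] C(3)[OF that] C'(3)[OF that] b
      by (intro add_mono mult_mono) auto
    finally show ?thesis by (simp add: algebra_simps)
  qed
  ultimately show ?thesis unfolding bounded_lipschitz_def using C(1) C'(1)
    by (intro exI[of _ "2 * C * C'"]) auto
qed

lemma bounded_lipschitz_minus: "bounded_lipschitz D f \<Longrightarrow> bounded_lipschitz D (\<lambda>w. - f w)"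
  unfolding bounded_lipschitz_def by (simp add: norm_minus_commute)

lemma bounded_lipschitz_coordinate:
  assumes "\<And>w. w \<in> D \<Longrightarrow> cmod (w i) \<le> C"
  shows "bounded_lipschitz D (\<lambda>w. w i)"
  unfolding bounded_lipschitz_def
proof (intro exI[of _ "max 1 C"] conjI ballI allI impI)
  fix w w' :: "'a \<Rightarrow> complex" and b assume b: "\<forall>j. cmod (w j - w' j) \<le> b"
  then have "0 \<le> b" using norm_ge_zero order_trans by blast
  then have "1 * b \<le> max 1 C * b" by (intro mult_right_mono) auto
  then show "cmod (w i - w' i) \<le> max 1 C * b" using b by (metis mult_1 order_trans)
qed (use assms in \<open>auto simp: le_max_iff_disj\<close>)

lemma bounded_lipschitz_holomorphic:
  assumes h: "h holomorphic_on U" "open U" "cball 0 t \<subseteq> U" and D: "\<And>w. w \<in> D \<Longrightarrow> cmod (w i) \<le> t"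
  shows "bounded_lipschitz D (\<lambda>w. h (w i))"
proof -
  have "continuous_on (cball 0 t) h" "continuous_on (cball 0 t) (deriv h)"
    using h holomorphic_on_subset holomorphic_deriv by (blast intro: holomorphic_on_imp_continuous_on)+
  then have "bounded (h ` cball 0 t)" "bounded (deriv h ` cball 0 t)"
    by (simp_all add: compact_continuous_image compact_imp_bounded)
  then obtain B C where B: "\<And>z. z \<in> cball 0 t \<Longrightarrow> cmod (h z) \<le> B" and C: "\<And>z. z \<in> cball 0 t \<Longrightarrow> cmod (deriv h z) \<le> C"
    unfolding bounded_iff by (metis imageI)
  define E where "E = max 0 (max B C)"
  have lip: "cmod (h y - h z) \<le> E * cmod (y - z)" if "y \<in> cball 0 t" "z \<in> cball 0 t" for y z
  proof (rule field_differentiable_bound[of "cball 0 t" h "deriv h"])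
    show "(h has_field_derivative deriv h x) (at x within cball 0 t)" if "x \<in> cball 0 t" for x
    proof (rule has_field_derivative_at_within)
      show "(h has_field_derivative deriv h x) (at x)" using holomorphic_derivI[OF h(1,2)] h(3) that by blast
    qed
    show "cmod (deriv h x) \<le> E" if "x \<in> cball 0 t" for x using C[OF that] by (simp add: E_def)
  qed (use that in auto)
  show ?thesis unfolding bounded_lipschitz_def
  proof (intro exI[of _ E] conjI ballI allI impI)
    show "cmod (h (w i)) \<le> E" if "w \<in> D" for w using B[of "w i"] D[OF that] by (simp add: E_def)
    fix w w' b assume w: "w \<in> D" "w' \<in> D" and b: "\<forall>j. cmod (w j - w' j) \<le> b"
    have "cmod (h (w i) - h (w' i)) \<le> E * cmod (w i - w' i)" using lip D w by simp
    also have "\<dots> \<le> E * b" using b by (intro mult_left_mono) (auto simp: E_def)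
    finally show "cmod (h (w i) - h (w' i)) \<le> E * b" .
  qed (simp add: E_def)
qed

lemma half_ln_square_derivative:
  fixes R I :: "real \<Rightarrow> real"
  assumes "(R has_real_derivative R') (at t within A)" "(I has_real_derivative I') (at t within A)"
    and "0 < (R t)\<^sup>2 + (I t)\<^sup>2"
  shows "((\<lambda>t. ln ((R t)\<^sup>2 + (I t)\<^sup>2) / 2) has_real_derivative
     (R t * R' + I t * I') / ((R t)\<^sup>2 + (I t)\<^sup>2)) (at t within A)"
proof -
  have "((\<lambda>t. (R t)\<^sup>2 + (I t)\<^sup>2) has_real_derivative 2 * (R t * R' + I t * I')) (at t within A)"
    by (auto intro!: derivative_eq_intros assms(1,2) simp: algebra_simps)
  from DERIV_cdivide[OF DERIV_chain2[OF DERIV_ln_divide[OF assms(3)] this], of 2]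
  have "((\<lambda>t. ln ((R t)\<^sup>2 + (I t)\<^sup>2) / 2) has_real_derivative
     1 / ((R t)\<^sup>2 + (I t)\<^sup>2) * (2 * (R t * R' + I t * I')) / 2) (at t within A)" .
  moreover have "1 / S * (2 * X) / 2 = X / S" for S X :: real by simp
  ultimately show ?thesis by metis
qed

text \<open>The logarithm of the modulus has the real part of the logarithmic derivative as its derivative; going
through \<open>ln (Re\<^sup>2 + Im\<^sup>2) / 2\<close> avoids a branch of the complex logarithm.\<close>

lemma ln_norm_derivative:
  fixes g :: "real \<Rightarrow> complex"
  assumes "(g has_vector_derivative \<omega> * g t) (at t within A)" "g t \<noteq> 0"
  shows "((\<lambda>t. ln (cmod (g t))) has_real_derivative Re \<omega>) (at t within A)"
proof -
  have R: "((\<lambda>t. Re (g t)) has_real_derivative Re (\<omega> * g t)) (at t within A)"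
    and I: "((\<lambda>t. Im (g t)) has_real_derivative Im (\<omega> * g t)) (at t within A)"
    using bounded_linear.has_vector_derivative[OF bounded_linear_Re assms(1)]
      bounded_linear.has_vector_derivative[OF bounded_linear_Im assms(1)]
    by (simp_all add: has_real_derivative_iff_has_vector_derivative)
  define s where "s = (Re (g t))\<^sup>2 + (Im (g t))\<^sup>2"
  have s: "0 < s" using assms(2) unfolding s_def by (metis complex_neq_0)
  have "((\<lambda>t. ln ((Re (g t))\<^sup>2 + (Im (g t))\<^sup>2) / 2) has_real_derivative
     (Re (g t) * Re (\<omega> * g t) + Im (g t) * Im (\<omega> * g t)) / s) (at t within A)"
    using half_ln_square_derivative[OF R I] s by (simp add: s_def)
  moreover have "Re (g t) * Re (\<omega> * g t) + Im (g t) * Im (\<omega> * g t) = Re \<omega> * s"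
    by (simp add: s_def algebra_simps power2_eq_square)
  moreover have "ln (cmod w) = ln ((Re w)\<^sup>2 + (Im w)\<^sup>2) / 2" for w
    by (cases "w = 0") (simp_all add: cmod_def ln_sqrt complex_neq_0)
  then have "(\<lambda>t. ln (cmod (g t))) = (\<lambda>t. ln ((Re (g t))\<^sup>2 + (Im (g t))\<^sup>2) / 2)" by auto
  ultimately show ?thesis using s by simp
qed

datatype coord = CX | CY | CK

context curve
begin

text \<open>By \<open>perturbation_bounds\<close> this keeps \<open>M\<close> within distance less than \<open>1\<close> of \<open>1\<close>, hence off the branch cut.\<close>

definition safe :: "real \<Rightarrow> bool" where
  "safe t \<longleftrightarrow> a * t ^ (m + 2) + n\<^sup>2 * \<beta>\<^sup>2 < 1"

text \<open>The principal branch of \<open>M powr (- 2/3)\<close>.\<close>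

definition pw :: "complex \<Rightarrow> complex" where
  "pw y = exp (of_real (-2/3) * Ln (M y))"

text \<open>The length \<open>k\<close> of the half gradient is a third unknown, although \<open>k\<^sup>2 = Ksq y\<close> along orbits: a square root
of \<open>Ksq y\<close> would have to be continued past possible zeros of \<open>Ksq\<close>, whereas the field in three unknowns
is holomorphic wherever \<open>M\<close> avoids the cut.\<close>

definition vf :: "coord \<Rightarrow> (coord \<Rightarrow> complex) \<Rightarrow> complex" where
  "vf j w = (case j of CX \<Rightarrow> - (Ygrad (w CY) * w CK * pw (w CY))
     | CY \<Rightarrow> w CX * w CK * pw (w CY)
     | CK \<Rightarrow> Ygrad (w CY) * (Ehess (w CY) - 1) * w CX * pw (w CY))"

lemma vf_simps:
  "vf CX w = - (Ygrad (w CY) * w CK * pw (w CY))" "vf CY w = w CX * w CK * pw (w CY)"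
  "vf CK w = Ygrad (w CY) * (Ehess (w CY) - 1) * w CX * pw (w CY)"
  by (simp_all add: vf_def)

lemma safe_le_1:
  assumes "safe t" "0 \<le> t" shows "t < 1"
proof (rule ccontr)
  assume "\<not> t < 1"
  then have "1 \<le> t ^ (m + 2)" by (intro one_le_power) auto
  then have "1 * 1 \<le> a * t ^ (m + 2)" using a_ge_1 by (intro mult_mono) auto
  moreover have "0 \<le> n\<^sup>2 * \<beta>\<^sup>2" by simp
  ultimately show False using assms(1) unfolding safe_def by linarith
qed

lemma safe_mono: "safe t \<Longrightarrow> 0 \<le> s \<Longrightarrow> s \<le> t \<Longrightarrow> safe s"
  unfolding safe_def using a_ge_1
  by (smt (verit) mult_left_mono power_mono)

lemma safe_M:
  assumes "safe (\<beta> * norm y)" shows "norm (M y - 1) < 1"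
  using perturbation_bounds(2)[of y] safe_le_1[OF assms] assms beta by (simp add: safe_def)

lemma safe_M_cut:
  assumes "safe (\<beta> * cmod y)" shows "M y \<notin> \<real>\<^sub>\<le>\<^sub>0" "M y \<noteq> 0"
proof -
  have "\<bar>Re (M y) - 1\<bar> < 1" using safe_M[OF assms] abs_Re_le_cmod[of "M y - 1"] by simp
  then show "M y \<notin> \<real>\<^sub>\<le>\<^sub>0" by (auto simp: complex_nonpos_Reals_iff)
  then show "M y \<noteq> 0" by auto
qed

lemma norm_pw: "M y \<noteq> 0 \<Longrightarrow> cmod (pw y) = cmod (M y) powr (-2/3)"
  by (simp add: pw_def powr_def Re_Ln)

lemma pw_of_real: "0 < M y \<Longrightarrow> pw (of_real y) = of_real (M y powr (-2/3))"
  by (simp add: pw_def M_of_real Ln_of_real powr_def flip: exp_of_real)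

lemma holomorphic_pw:
  assumes "f holomorphic_on A" "\<And>z. z \<in> A \<Longrightarrow> M (f z) \<notin> \<real>\<^sub>\<le>\<^sub>0"
  shows "(\<lambda>z. pw (f z)) holomorphic_on A"
  unfolding pw_def using assms by (intro holomorphic_intros) auto

definition phase_box :: "real \<Rightarrow> real \<Rightarrow> (coord \<Rightarrow> complex) set" where
  "phase_box t R = {w. \<beta> * cmod (w CY) \<le> t \<and> cmod (w CX) \<le> R \<and> cmod (w CK) \<le> R}"

lemma vf_bounded_lipschitz:
  assumes t: "0 \<le> t" "safe t"
  obtains C where "0 \<le> C" "\<And>j w. w \<in> phase_box t R \<Longrightarrow> cmod (vf j w) \<le> C"
    "\<And>j w w' b. w \<in> phase_box t R \<Longrightarrow> w' \<in> phase_box t R \<Longrightarrow> (\<And>j. cmod (w j - w' j) \<le> b) \<Longrightarrow> cmod (vf j w - vf j w') \<le> C * b"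
proof -
  let ?D = "phase_box t R"
  have x: "bounded_lipschitz ?D (\<lambda>w. w CX)" and k: "bounded_lipschitz ?D (\<lambda>w. w CK)"
    by (rule bounded_lipschitz_coordinate[where C = R]; simp add: phase_box_def)+
  have y: "cmod (w CY) \<le> t / \<beta>" if "w \<in> ?D" for w
    using that beta by (simp add: phase_box_def field_simps)
  have "open {y. 0 < Re (M y)}" by (intro open_Collect_less continuous_intros)
  moreover have "cball 0 (t / \<beta>) \<subseteq> {y. 0 < Re (M y)}"
  proof
    fix y :: complex assume "y \<in> cball 0 (t / \<beta>)"
    then have "\<beta> * cmod y \<le> t" using beta by (simp add: field_simps)
    then have "safe (\<beta> * cmod y)" using safe_mono[OF t(2)] beta by simp
    from safe_M[OF this] have "\<bar>Re (M y) - 1\<bar> < 1" using abs_Re_le_cmod[of "M y - 1"] by simp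
    then show "y \<in> {y. 0 < Re (M y)}" by simp
  qed
  moreover have "pw holomorphic_on {y. 0 < Re (M y)}"
    by (rule holomorphic_pw) (auto simp: complex_nonpos_Reals_iff intro: holomorphic_intros)
  ultimately have p: "bounded_lipschitz ?D (\<lambda>w. pw (w CY))"
    using y by (intro bounded_lipschitz_holomorphic[where h = pw and U = "{y. 0 < Re (M y)}"]) auto
  have g: "bounded_lipschitz ?D (\<lambda>w. Ygrad (w CY))"
    by (rule bounded_lipschitz_holomorphic[where h = Ygrad and U = UNIV and t = "t/\<beta>"]) (auto intro!: holomorphic_intros y)
  have h: "bounded_lipschitz ?D (\<lambda>w. Ehess (w CY) - 1)"
    by (rule bounded_lipschitz_holomorphic[where h = "\<lambda>y. Ehess y - 1" and U = UNIV and t = "t/\<beta>"]) (auto intro!: holomorphic_intros y)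
  have "\<exists>C\<ge>0. (\<forall>w\<in>?D. cmod (vf j w) \<le> C) \<and>
     (\<forall>w\<in>?D. \<forall>w'\<in>?D. \<forall>b. (\<forall>j. cmod (w j - w' j) \<le> b) \<longrightarrow> cmod (vf j w - vf j w') \<le> C * b)" for j
    unfolding bounded_lipschitz_def[symmetric]
    by (cases j; simp only: vf_simps; intro bounded_lipschitz_minus bounded_lipschitz_mult x k p g h)
  then obtain C where C: "\<And>j. 0 \<le> C j" "\<And>j w. w \<in> ?D \<Longrightarrow> cmod (vf j w) \<le> C j"
     "\<And>j w w' b. w \<in> ?D \<Longrightarrow> w' \<in> ?D \<Longrightarrow> (\<And>j. cmod (w j - w' j) \<le> b) \<Longrightarrow> cmod (vf j w - vf j w') \<le> C j * b"
    by metis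
  define B where "B = C CX + C CY + C CK"
  have B: "C j \<le> B" for j using C(1)[of CX] C(1)[of CY] C(1)[of CK] by (cases j) (auto simp: B_def)
  show thesis
  proof (rule that[of B])
    show "0 \<le> B" using C(1) B order_trans by blast
    show "cmod (vf j w) \<le> B" if "w \<in> ?D" for j w using C(2)[OF that] B order_trans by blast
    show "cmod (vf j w - vf j w') \<le> B * b" if "w \<in> ?D" "w' \<in> ?D" "\<And>j. cmod (w j - w' j) \<le> b" for j w w' b
    proof -
      have "0 \<le> b" using that(3) norm_ge_zero order_trans by blast
      then have "C j * b \<le> B * b" by (rule mult_right_mono[OF B])
      then show ?thesis using C(3)[OF that, of j] by linarith
    qed
  qed
qed

text \<open>The slack between \<open>t1\<close> and \<open>t2\<close> leaves room for polydiscs around the points of the smaller box.\<close>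

lemma vf_holomorphic_ode:
  assumes t: "0 \<le> t1" "t1 < t2" "safe t2"
  obtains \<rho> B \<Lambda> r where "holomorphic_ode vf (phase_box t1 R) \<rho> B \<Lambda> r"
    "\<And>w0 w. w0 \<in> phase_box t1 R \<Longrightarrow> w \<in> polydisc w0 \<rho> \<Longrightarrow> w \<in> phase_box t2 (R + 1)"
proof -
  define \<rho> where "\<rho> = min 1 ((t2 - t1) / \<beta>)"
  have rho: "0 < \<rho>" "\<rho> \<le> 1" "\<beta> * \<rho> \<le> t2 - t1"
    using t beta by (auto simp: \<rho>_def min_def field_simps)
  have sub: "w \<in> phase_box t2 (R + 1)" if "w0 \<in> phase_box t1 R" "w \<in> polydisc w0 \<rho>" for w0 w
  proof -
    have tri: "cmod (w j) \<le> cmod (w0 j) + \<rho>" for j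
      using that(2) norm_triangle_ineq[of "w0 j" "w j - w0 j"] by (auto simp: polydisc_def intro: order_trans)
    have "\<beta> * cmod (w CY) \<le> \<beta> * cmod (w0 CY) + \<beta> * \<rho>" using mult_left_mono[OF tri[of CY], of \<beta>] beta by (simp add: algebra_simps)
    then show ?thesis using that(1) rho tri[of CX] tri[of CK] by (auto simp: phase_box_def)
  qed
  have t20: "0 \<le> t2" using t by simp
  obtain C where C: "0 \<le> C" "\<And>j w. w \<in> phase_box t2 (R + 1) \<Longrightarrow> cmod (vf j w) \<le> C"
    "\<And>j w w' b. w \<in> phase_box t2 (R + 1) \<Longrightarrow> w' \<in> phase_box t2 (R + 1) \<Longrightarrow> (\<And>j. cmod (w j - w' j) \<le> b) \<Longrightarrow> cmod (vf j w - vf j w') \<le> C * b"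
    using vf_bounded_lipschitz[OF t20 t(3), of "R + 1"] by metis
  define r where "r = min \<rho> (1/2) / (C + 1)"
  have r: "0 < r" "C * r \<le> min \<rho> (1/2)"
  proof -
    show "0 < r" using C(1) rho by (simp add: r_def)
    have "C * r = C / (C + 1) * min \<rho> (1/2)" by (simp add: r_def)
    also have "\<dots> \<le> 1 * min \<rho> (1/2)" using C(1) rho by (intro mult_right_mono) auto
    finally show "C * r \<le> min \<rho> (1/2)" by simp
  qed
  have "holomorphic_ode vf (phase_box t1 R) \<rho> C C r"
  proof
    show "cmod (vf i w) \<le> C" if "w0 \<in> phase_box t1 R" "w \<in> polydisc w0 \<rho>" for w0 w i
      by (rule C(2)[OF sub[OF that]])
    show "cmod (vf i w - vf i w') \<le> C * b"
      if "w0 \<in> phase_box t1 R" "w \<in> polydisc w0 \<rho>" "w' \<in> polydisc w0 \<rho>" "\<And>j. cmod (w j - w' j) \<le> b" for w0 w w' b i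
      by (rule C(3)[OF sub[OF that(1,2)] sub[OF that(1,3)] that(4)])
    show "(\<lambda>z. vf i (\<lambda>j. W j z)) holomorphic_on A"
      if "w0 \<in> phase_box t1 R" "open A" and W: "\<And>j. W j holomorphic_on A" and P: "\<And>z. z \<in> A \<Longrightarrow> (\<lambda>j. W j z) \<in> polydisc w0 \<rho>"
      for w0 W A i
    proof -
      have "M (W CY z) \<notin> \<real>\<^sub>\<le>\<^sub>0" if "z \<in> A" for z
      proof -
        have "\<beta> * cmod (W CY z) \<le> t2" using sub[OF \<open>w0 \<in> phase_box t1 R\<close> P[OF that]] by (simp add: phase_box_def)
        then have "safe (\<beta> * cmod (W CY z))" using safe_mono[OF t(3)] beta by simp
        then show ?thesis by (rule safe_M_cut)
      qed
      then have "(\<lambda>z. pw (W CY z)) holomorphic_on A" by (intro holomorphic_pw W)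
      then show ?thesis by (cases i) (auto simp: vf_simps intro!: holomorphic_intros W)
    qed
  qed (use r rho C(1) in auto)
  then show thesis using sub that by blast
qed

end

section \<open>Growth along vertical lines\<close>

context curve
begin

lemma DERIV_P: "\<exists>D. (P has_field_derivative D) (at y) \<and> y * D = of_nat m * P (y :: 'a::real_normed_field)"
proof -
  obtain k where k: "m = Suc k" using m by (cases m) auto
  have "(P has_field_derivative of_real \<epsilon> * (of_nat (Suc k) * y ^ k)) (at y)"
  proof -
    have "P = (\<lambda>y::'a. of_real \<epsilon> * y ^ Suc k)" by (rule ext) (simp only: P_def k[symmetric])
    then show ?thesis using DERIV_monomial by metis
  qed
  moreover have "y * (of_real \<epsilon> * (of_nat (Suc k) * y ^ k)) = of_nat m * P y"
  proof -
    have "y ^ m = y * y ^ k" "of_nat (Suc k) = (of_nat m :: 'a)" by (simp_all add: k)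
    then show ?thesis by (simp only: P_def mult_ac)
  qed
  ultimately show ?thesis by blast
qed

end

context small_curve
begin

text \<open>The time at which a solution of the limiting equation, sped up by the factor \<open>1 + 5 err\<close>, reaches
imaginary angle \<open>\<eta>\<close>: the integral of \<open>gain c (level \<eta>) / (1 + 5 err)\<close> in closed form.\<close>

definition time :: "real \<Rightarrow> real" where
  "time \<eta> = (\<eta> - (defect_integral c (level \<eta>) - defect_integral c r0) / n) / (1 + 5 * err)"

lemma time_0 [simp]: "time 0 = 0" by (simp add: time_def level_def)

lemma time_DERIV: "(time has_real_derivative gain c (level \<eta>) / (1 + 5 * err)) (at \<eta>)"
proof -
  have e: "1 + 5 * err \<noteq> 0" using err_pos by simp
  have "((\<lambda>s. (s - (defect_integral c (r0 * exp (n * s)) - defect_integral c r0) / n) / (1 + 5 * err))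
     has_real_derivative (1 - (n * (1 - gain c (r0 * exp (n * \<eta>)))) / n) / (1 + 5 * err)) (at \<eta>)"
    using e n_pos by (auto intro!: derivative_eq_intros defect_integral_exp_DERIV[OF c_pos r0_pos])
  then show ?thesis using n_pos by (simp add: time_def[abs_def] level_def)
qed

lemma time_mono: "\<eta> \<le> \<eta>' \<Longrightarrow> time \<eta> \<le> time \<eta>'"
proof (rule DERIV_nonneg_imp_nondecreasing[of _ _ time])
  show "\<exists>y. (time has_real_derivative y) (at s) \<and> 0 \<le> y" for s
    using time_DERIV[of s] gain_nonneg[OF c_pos less_imp_le[OF level_pos[of s]]] err_pos
    by (intro exI[of _ "gain c (level s) / (1 + 5 * err)"]) simp
qed

lemma time_strict_mono:
  assumes "s < t" "level t < 1" shows "time s < time t"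
proof (rule DERIV_pos_imp_increasing[of _ _ time])
  fix v assume "s \<le> v" "v \<le> t"
  then have "0 < gain c (level v)" using level_mono[of v t] assms(2) level_pos[of v] by (intro gain_pos[OF c_pos]) auto
  then show "\<exists>y. (time has_real_derivative y) (at v) \<and> 0 < y"
    using time_DERIV[of v] err_pos by (intro exI[of _ "gain c (level v) / (1 + 5 * err)"]) simp
qed (rule assms(1))

lemma continuous_on_time: "continuous_on A time"
  using time_DERIV by (meson DERIV_continuous continuous_at_imp_continuous_on)

lemma r0_le_err: "r0 \<le> err"
proof -
  have "\<epsilon> = \<beta>\<^sup>2 * \<beta> ^ m" by (simp add: \<epsilon>_def power2_eq_square)
  also have "\<dots> \<le> \<beta>\<^sup>2 * 1" using beta beta_small by (intro mult_left_mono power_le_one) auto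
  finally have e: "\<epsilon> \<le> \<beta>\<^sup>2" by simp
  have "a * \<epsilon> \<le> n\<^sup>2 / 2 * \<beta>\<^sup>2" using a_le e eps_pos by (intro mult_mono) auto
  then have ae: "a * \<epsilon> \<le> err / 4" using beta_bounds(1) by simp
  have "(1::real) \<le> 2 ^ (m + 2)" by (rule one_le_power) simp
  then have "a * \<epsilon> / 2 ^ (m + 2) \<le> a * \<epsilon> / 1" using a_ge_1 eps_pos by (intro divide_left_mono) auto
  then have "a * \<epsilon> / 2 ^ (m + 2) \<le> err / 4" using ae by simp
  then have "r0 \<le> (err / 4) / (1 - err)" using err unfolding r0_def by (intro divide_right_mono) auto
  also have "\<dots> \<le> err" using err err_pos by (simp add: field_simps)
  finally show ?thesis .
qed

end

text \<open>The real curve, parametrized by \<open>C \<xi>\<close>. The bound on \<open>y\<close> singles out the component near the circle when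
\<open>n\<close> is odd.\<close>

locale real_orbit = small_curve +
  fixes xr yr kr :: "real \<Rightarrow> real"
  assumes dx: "\<And>t. (xr has_real_derivative - (Ygrad (yr t) * kr t * M (yr t) powr (-2/3))) (at t)"
    and dy: "\<And>t. (yr has_real_derivative xr t * kr t * M (yr t) powr (-2/3)) (at t)"
    and dk: "\<And>t. (kr has_real_derivative Ygrad (yr t) * (Ehess (yr t) - 1) * xr t * M (yr t) powr (-2/3)) (at t)"
    and x2: "\<And>t. (xr t)\<^sup>2 = Xsq (yr t)" and k2: "\<And>t. (kr t)\<^sup>2 = Ksq (yr t)" and k_pos: "\<And>t. 0 < kr t"
    and y_le: "\<And>t. \<bar>yr t\<bar> \<le> 2"
begin

definition Vr :: "coord \<Rightarrow> real \<Rightarrow> complex" where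
  "Vr j t = (case j of CX \<Rightarrow> of_real (xr t) | CY \<Rightarrow> of_real (yr t) | CK \<Rightarrow> of_real (kr t))"

lemma Vr_simps [simp]: "Vr CX t = of_real (xr t)" "Vr CY t = of_real (yr t)" "Vr CK t = of_real (kr t)"
  by (simp_all add: Vr_def)

lemma beta_yr: "\<beta> * \<bar>yr t\<bar> \<le> 1"
proof -
  have "\<beta> * \<bar>yr t\<bar> \<le> 1/10 * 2" using y_le[of t] beta beta_tenth by (intro mult_mono) auto
  then show ?thesis by simp
qed

lemma real_level_bounds:
  "a * (\<beta> * \<bar>yr t\<bar>) ^ (m + 2) + n\<^sup>2 * \<beta>\<^sup>2 \<le> (1 - err) * r0 + err"
  "\<bar>Ksq (yr t)\<bar> \<le> (1 + err) * (1 + c * r0)" "(1 - err) * (1 - r0) \<le> \<bar>M (yr t)\<bar>"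
proof -
  have P: "\<bar>P (yr t)\<bar> \<le> 1" using perturbation_bounds(1)[of "yr t"] beta_yr beta_small(2) by fastforce
  have "(yr t)\<^sup>2 * (1 + P (yr t)) = 1 - (xr t)\<^sup>2" by (simp add: x2 Xsq_def S_P algebra_simps)
  then have "(yr t)\<^sup>2 * (1 + P (yr t)) \<le> 1" by simp
  moreover have "0 \<le> (yr t)\<^sup>2 * (1 + P (yr t))" using P by (intro mult_nonneg_nonneg) auto
  ultimately have u: "norm ((yr t)\<^sup>2 * (1 + P (yr t))) \<le> (cosh 0)\<^sup>2" by simp
  have l0: "level 0 = r0" "level 0 < 1" using r0_le_err err by (auto simp: level_def)
  have b: "\<beta> * norm (yr t) \<le> 1" using beta_yr by simp
  note lb = level_bounds[OF order_refl l0(2) b u, unfolded l0]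
  show "a * (\<beta> * \<bar>yr t\<bar>) ^ (m + 2) + n\<^sup>2 * \<beta>\<^sup>2 \<le> (1 - err) * r0 + err"
  "\<bar>Ksq (yr t)\<bar> \<le> (1 + err) * (1 + c * r0)" "(1 - err) * (1 - r0) \<le> \<bar>M (yr t)\<bar>"
    using lb(1-3) by simp_all
qed

lemma real_safe: "safe (\<beta> * \<bar>yr t\<bar>)"
proof -
  have "(1 - err) * r0 \<le> 1 * r0" using err_pos r0_pos by (intro mult_right_mono) auto
  then show ?thesis unfolding safe_def using real_level_bounds(1)[of t] r0_le_err err by linarith
qed

lemma real_M_pos: "0 < M (yr t)"
  using safe_M[of "yr t"] real_safe[of t] by (simp add: abs_if split: if_splits)

lemma Vr_derivative: "(Vr j has_vector_derivative vf j (\<lambda>i. Vr i t)) (at t)"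
proof -
  note D = dx[of t] dy[of t] dk[of t]
  have "((\<lambda>t. complex_of_real (f t)) has_vector_derivative of_real D) (at t)"
    if "(f has_real_derivative D) (at t)" for f D
    using that by (intro has_vector_derivative_of_real) (simp add: has_real_derivative_iff_has_vector_derivative)
  from this[OF dx[of t]] this[OF dy[of t]] this[OF dk[of t]] show ?thesis
    by (cases j) (auto simp: vf_simps Vr_def[abs_def] Ygrad_of_real Ehess_of_real pw_of_real[OF real_M_pos])
qed

end

text \<open>A continuation of the real orbit to complex time along which \<open>M\<close> stays off the cut.\<close>

locale strip_orbit = real_orbit +
  fixes W :: "coord \<Rightarrow> complex \<Rightarrow> complex" and d :: real
  assumes d: "0 < d"
    and W: "\<And>z j. z \<in> strip d \<Longrightarrow> (W j has_field_derivative vf j (\<lambda>i. W i z)) (at z)"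
    and W_real: "\<And>t j. W j (complex_of_real t) = Vr j t"
    and W_safe: "\<And>z. z \<in> strip d \<Longrightarrow> safe (\<beta> * cmod (W CY z))"
begin

abbreviation "x \<equiv> W CX" abbreviation "y \<equiv> W CY" abbreviation "k \<equiv> W CK"

lemma W_holomorphic: "W j holomorphic_on strip d"
  using W by (auto simp: holomorphic_on_open)

lemma invariants:
  assumes "z \<in> strip d" shows "(x z)\<^sup>2 = Xsq (y z)" "(k z)\<^sup>2 = Ksq (y z)"
proof -
  have 0: "complex_of_real 0 \<in> strip d" using d by (rule of_real_in_strip)
  show "(x z)\<^sup>2 = Xsq (y z)"
    by (rule holomorphic_eq_from_reals[of "\<lambda>z. (x z)\<^sup>2" "strip d" "\<lambda>z. Xsq (y z)" 0])
      (use 0 assms W_holomorphic in \<open>auto intro!: holomorphic_intros convex_connected simp: W_real Xsq_of_real simp flip: x2\<close>)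
  show "(k z)\<^sup>2 = Ksq (y z)"
    by (rule holomorphic_eq_from_reals[of "\<lambda>z. (k z)\<^sup>2" "strip d" "\<lambda>z. Ksq (y z)" 0])
      (use 0 assms W_holomorphic in \<open>auto intro!: holomorphic_intros convex_connected simp: W_real Ksq_of_real simp flip: k2\<close>)
qed

text \<open>These functions straighten the curve to the circle \<open>u\<^sup>2 + x\<^sup>2 = 1\<close>. On the real axis \<open>N\<close> is a unit vector
and \<open>\<omega>\<close> its angular speed; \<open>qt\<close> is the derivative of \<open>u\<close> with respect to \<open>y\<close>.\<close>

definition "q z = csqrt (1 + P (y z))"
definition "u z = y z * q z"
definition "N z = u z + \<i> * x z"
definition "qt z = (1 + of_real (n / 2) * P (y z)) / q z"
definition "\<omega> z = qt z * k z * pw (y z)"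

lemma beta_y: "z \<in> strip d \<Longrightarrow> \<beta> * cmod (y z) \<le> 1"
  using safe_le_1[OF W_safe] beta by fastforce

lemma P_small: "z \<in> strip d \<Longrightarrow> cmod (P (y z)) \<le> \<beta>\<^sup>2"
  using perturbation_bounds(1)[OF beta_y] .

lemma one_plus_P: "z \<in> strip d \<Longrightarrow> 0 < Re (1 + P (y z))"
  using P_small[of z] abs_Re_le_cmod[of "P (y z)"] beta_small(2) by simp

lemma q_square: "z \<in> strip d \<Longrightarrow> (q z)\<^sup>2 = 1 + P (y z)"
  by (simp add: q_def)

lemma q_nonzero: "z \<in> strip d \<Longrightarrow> q z \<noteq> 0"
  using one_plus_P[of z] unfolding q_def by (metis csqrt_eq_0 less_irrefl zero_complex.simps(1))

lemma u_square: "z \<in> strip d \<Longrightarrow> (u z)\<^sup>2 = 1 - (x z)\<^sup>2"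
  by (simp add: u_def power_mult_distrib q_square invariants Xsq_def S_P algebra_simps)

lemma u_qt: "z \<in> strip d \<Longrightarrow> u z * qt z = Ygrad (y z)"
  using q_nonzero[of z] by (simp add: u_def qt_def Ygrad_def)

lemma N_factor: "z \<in> strip d \<Longrightarrow> N z * (u z - \<i> * x z) = 1"
  using u_square[of z] by (simp add: N_def power2_eq_square algebra_simps)

lemma N_nonzero: "z \<in> strip d \<Longrightarrow> N z \<noteq> 0"
  using N_factor[of z] by auto

lemma u_derivative:
  assumes z: "z \<in> strip d"
  shows "(u has_field_derivative qt z * (x z * k z * pw (y z))) (at z)"
proof -
  obtain D where D: "(P has_field_derivative D) (at (y z))" "y z * D = of_nat m * P (y z)" using DERIV_P by blast
  define Y where "Y = x z * k z * pw (y z)"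
  have Y: "(y has_field_derivative Y) (at z)" using W[OF z, of CY] by (simp add: vf_simps Y_def)
  have cut: "1 + P (y z) \<notin> \<real>\<^sub>\<le>\<^sub>0" using one_plus_P[OF z] by (auto simp: complex_nonpos_Reals_iff)
  have "((\<lambda>z. 1 + P (y z)) has_field_derivative D * Y) (at z)"
    using DERIV_add[OF DERIV_const DERIV_chain2[OF D(1) Y], of 1] by simp
  from has_field_derivative_csqrt'[OF this cut]
  have "(q has_field_derivative (D * Y) / (2 * q z)) (at z)" by (simp add: q_def[abs_def])
  from DERIV_mult[OF Y this] have "(u has_field_derivative Y * q z + (D * Y) / (2 * q z) * y z) (at z)"
    by (simp add: u_def[abs_def])
  moreover have "Y * q z + (D * Y) / (2 * q z) * y z = Y * (q z * q z + (y z * D) / 2) / q z"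
    using q_nonzero[OF z] by (simp add: field_simps)
  moreover have "q z * q z + (y z * D) / 2 = 1 + of_real (n / 2) * P (y z)"
    using q_square[OF z] unfolding D(2) by (simp add: power2_eq_square n_def field_simps)
  ultimately show ?thesis by (simp add: qt_def Y_def mult_ac)
qed

text \<open>The identity \<open>u qt = Ygrad y\<close> makes the equations for \<open>u\<close> and \<open>x\<close> a rotation with the common factor \<open>\<omega>\<close>.\<close>

lemma N_derivative:
  assumes z: "z \<in> strip d"
  shows "(N has_field_derivative - \<i> * \<omega> z * N z) (at z)"
proof -
  have "(N has_field_derivative qt z * (x z * k z * pw (y z)) + \<i> * (- (Ygrad (y z) * k z * pw (y z)))) (at z)"
    using DERIV_add[OF u_derivative[OF z] DERIV_cmult[OF W[OF z, of CX], of \<i>]] by (simp add: N_def[abs_def] vf_simps)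
  moreover have "qt z * (x z * k z * pw (y z)) + \<i> * (- (Ygrad (y z) * k z * pw (y z))) = - \<i> * \<omega> z * N z"
    unfolding u_qt[OF z, symmetric] by (simp add: \<omega>_def N_def algebra_simps)
  ultimately show ?thesis by simp
qed

lemma N_real: "cmod (N (of_real t)) = 1"
proof -
  have z: "complex_of_real t \<in> strip d" using d by simp
  have P: "\<bar>P (yr t)\<bar> \<le> \<beta>\<^sup>2" using P_small[OF z] by (simp add: W_real P_of_real)
  then have "0 \<le> 1 + P (yr t)" using beta_small by linarith
  then have "csqrt (of_real (1 + P (yr t))) = of_real (sqrt (1 + P (yr t)))"
    by (subst csqrt_of_real_nonneg) auto
  then have "q (of_real t) = of_real (sqrt (1 + P (yr t)))"
    by (simp add: q_def W_real P_of_real)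
  then have u: "u (of_real t) = of_real (yr t * sqrt (1 + P (yr t)))" by (simp add: u_def W_real)
  have "(u (of_real t))\<^sup>2 = 1 - (x (of_real t))\<^sup>2" by (rule u_square[OF z])
  then have "complex_of_real ((yr t * sqrt (1 + P (yr t)))\<^sup>2 + (xr t)\<^sup>2) = of_real 1" unfolding u by (simp add: W_real)
  then have "(yr t * sqrt (1 + P (yr t)))\<^sup>2 + (xr t)\<^sup>2 = 1" by (simp only: of_real_eq_iff)
  then show ?thesis by (simp add: N_def u W_real cmod_def)
qed

text \<open>The modulus of the imaginary angle, as \<open>N\<close> is the exponential of \<open>- \<i>\<close> times the complex angle.\<close>

definition "lev z = \<bar>ln (cmod (N z))\<bar>"

lemma lev_bounds:
  assumes z: "z \<in> strip d"
  shows "cmod (u z) \<le> cosh (lev z)" "cmod (x z) \<le> cosh (lev z)"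
proof -
  have N0: "0 < cmod (N z)" using N_nonzero[OF z] by simp
  have inv: "u z - \<i> * x z = inverse (N z)" using N_factor[OF z] N_nonzero[OF z] by (simp add: field_simps)
  have c: "cosh (lev z) = (cmod (N z) + inverse (cmod (N z))) / 2"
    using cosh_ln_real[OF N0] by (simp add: lev_def)
  have "2 * u z = N z + inverse (N z)" unfolding inv[symmetric] by (simp add: N_def)
  then have "2 * cmod (u z) \<le> cmod (N z) + cmod (inverse (N z))" by (metis norm_mult norm_numeral norm_triangle_ineq)
  then show "cmod (u z) \<le> cosh (lev z)" by (simp add: c norm_inverse)
  have "2 * \<i> * x z = N z - inverse (N z)" unfolding inv[symmetric] by (simp add: N_def)
  then have "cmod (2 * \<i> * x z) \<le> cmod (N z) + cmod (inverse (N z))" by (metis norm_triangle_ineq4)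
  then show "cmod (x z) \<le> cosh (lev z)" by (simp add: c norm_inverse norm_mult)
qed

lemma u_level:
  assumes z: "z \<in> strip d" and "lev z \<le> \<eta>"
  shows "norm ((y z)\<^sup>2 * (1 + P (y z))) \<le> (cosh \<eta>)\<^sup>2"
proof -
  have "(y z)\<^sup>2 * (1 + P (y z)) = (u z)\<^sup>2" by (simp add: u_def power_mult_distrib q_square[OF z])
  moreover have "cosh (lev z) \<le> cosh \<eta>" using assms(2) by (subst cosh_real_nonneg_le_iff) (auto simp: lev_def)
  then have "cmod (u z) \<le> cosh \<eta>" using lev_bounds(1)[OF z] by simp
  ultimately show ?thesis by (simp add: norm_power power_mono)
qed

lemma qt_bound:
  assumes z: "z \<in> strip d" shows "cmod (qt z) \<le> 1 + err"
proof -
  define b where "b = \<beta>\<^sup>2"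
  have b: "0 < b" "b \<le> 1/100" "n * b \<le> err" "b \<le> err" using beta beta_small(2) beta_bounds by (auto simp: b_def)
  have P: "cmod (P (y z)) \<le> b" using P_small[OF z] by (simp add: b_def)
  have "1 - b \<le> cmod (1 + P (y z))" using norm_triangle_ineq4[of "1 + P (y z)" "P (y z)"] P by simp
  also have "\<dots> = (cmod (q z))\<^sup>2" by (simp add: q_square[OF z] flip: norm_power)
  finally have q2: "1 - b \<le> (cmod (q z))\<^sup>2" .
  have q: "1 - b \<le> cmod (q z)"
  proof (rule power2_le_imp_le)
    have "(1 - b)\<^sup>2 \<le> 1 - b" using b by (simp add: power2_eq_square mult_left_le)
    then show "(1 - b)\<^sup>2 \<le> (cmod (q z))\<^sup>2" using q2 by simp
  qed simp
  have "cmod (1 + of_real (n / 2) * P (y z)) \<le> 1 + n / 2 * b"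
  proof -
    have "cmod (of_real (n / 2) * P (y z)) \<le> n / 2 * b"
      unfolding norm_mult using P n_pos by (intro mult_mono) auto
    then show ?thesis using norm_triangle_ineq[of 1 "of_real (n / 2) * P (y z)"] by simp
  qed
  then have "cmod (qt z) \<le> (1 + n / 2 * b) / (1 - b)"
    unfolding qt_def norm_divide using q b n_pos by (intro frac_le) auto
  also have "\<dots> \<le> 1 + err"
  proof -
    have e2: "2 * n\<^sup>2 * b \<le> err" using beta_bounds(1) by (simp add: b_def)
    have "3 * n \<le> n\<^sup>2" using n_pos by (simp add: power2_eq_square)
    then have "2 * (3 * n) * b \<le> 2 * n\<^sup>2 * b" using b by (intro mult_right_mono) auto
    moreover have "2 * (3 * n) * b = 6 * (n * b)" by simp
    ultimately have e6: "6 * (n * b) \<le> err" using e2 by linarith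
    have "3 * b \<le> n * b" using n_pos b by (intro mult_right_mono) auto
    moreover have "err * b \<le> err * (1/100)" using b err_pos by (intro mult_left_mono) auto
    moreover have "(1 + err) * (1 - b) = 1 - b + err - err * b" "n / 2 * b = n * b / 2" by (simp_all add: algebra_simps)
    ultimately have "1 + n / 2 * b \<le> (1 + err) * (1 - b)" using e6 err_pos by linarith
    then show ?thesis using b by (simp add: divide_le_eq)
  qed
  finally show ?thesis .
qed

text \<open>At levels beyond \<open>1\<close> the gain vanishes; below, this is the speed bound at the level of \<open>z\<close>.\<close>

lemma omega_bound:
  assumes z: "z \<in> strip d"
  shows "cmod (\<omega> z) * gain c (level (lev z)) \<le> 1 + 5 * err"
proof (cases "level (lev z) < 1")
  case False
  then show ?thesis using err_pos by (simp add: gain_def)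
next
  case True
  have M0: "M (y z) \<noteq> 0" by (rule safe_M_cut[OF W_safe[OF z]])
  have l0: "0 \<le> lev z" by (simp add: lev_def)
  note lb = level_bounds[OF l0 True beta_y[OF z] u_level[OF z order_refl]]
  have k: "cmod (k z) = sqrt (cmod (Ksq (y z)))"
    by (simp add: norm_power flip: invariants(2)[OF z])
  have "cmod (qt z) * sqrt (cmod (Ksq (y z))) * cmod (M (y z)) powr (-2/3) * gain c (level (lev z)) \<le> 1 + 5 * err"
    by (rule speed_bound) (use lb(2,3) qt_bound[OF z] level_pos M0 in \<open>auto intro: less_imp_le\<close>)
  then show ?thesis by (simp add: \<omega>_def norm_mult k norm_pw[OF M0])
qed

text \<open>On the vertical line through \<open>Re z\<close>, the derivative of \<open>ln \<bar>N\<bar>\<close> is at most \<open>\<bar>\<omega>\<bar>\<close>, and the comparison function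
is \<open>time\<close>.\<close>

lemma growth:
  assumes z: "z \<in> strip d"
  shows "time (lev z) \<le> \<bar>Im z\<bar>"
proof -
  define \<sigma> where "\<sigma> = (if Im z < 0 then - 1 else 1 :: real)"
  have s: "\<bar>\<sigma>\<bar> = 1" "\<sigma> * \<bar>Im z\<bar> = Im z" by (auto simp: \<sigma>_def)
  define p where "p t = complex_of_real (Re z) + of_real t * (of_real \<sigma> * \<i>)" for t
  have pin: "p t \<in> strip d" if "0 \<le> t" "t \<le> \<bar>Im z\<bar>" for t
    using z that s by (simp add: p_def strip_def abs_mult)
  have pz: "p \<bar>Im z\<bar> = z" using s(2) by (simp add: p_def complex_eq_iff mult.commute)
  have dN: "((\<lambda>t. N (p t)) has_vector_derivative (of_real \<sigma> * \<omega> (p t)) * N (p t)) (at t within {0..\<bar>Im z\<bar>})"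
    if "0 \<le> t" "t \<le> \<bar>Im z\<bar>" for t
  proof -
    have "((\<lambda>t. N (p t)) has_vector_derivative (of_real \<sigma> * \<i>) * (- \<i> * \<omega> (p t) * N (p t))) (at t within {0..\<bar>Im z\<bar>})"
    proof -
      have "((\<lambda>t. p t) has_vector_derivative of_real \<sigma> * \<i>) (at t)"
        unfolding p_def by (auto intro!: derivative_eq_intros)
      from field_vector_diff_chain_at[OF this N_derivative[OF pin[OF that]]] show ?thesis
        by (simp add: o_def has_vector_derivative_at_within)
    qed
    then show ?thesis by (simp add: algebra_simps)
  qed
  have "time \<bar>ln (cmod (N (p \<bar>Im z\<bar>)))\<bar> \<le> time 0 + \<bar>Im z\<bar>"
  proof (rule comparison_majorant[where A' = "\<lambda>\<eta>. gain c (level \<eta>) / (1 + 5 * err)"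
        and f' = "\<lambda>t. Re (of_real \<sigma> * \<omega> (p t))" and f = "\<lambda>t. ln (cmod (N (p t)))"])
    show "((\<lambda>t. ln (cmod (N (p t)))) has_real_derivative Re (of_real \<sigma> * \<omega> (p t))) (at t within {0..\<bar>Im z\<bar>})"
      if "0 \<le> t" "t \<le> \<bar>Im z\<bar>" for t
      by (rule ln_norm_derivative[OF dN[OF that] N_nonzero[OF pin[OF that]]])
    show "(time has_real_derivative gain c (level \<eta>) / (1 + 5 * err)) (at \<eta>)" for \<eta> by (rule time_DERIV)
    show "continuous_on {0..} time" by (rule continuous_on_time)
    show "ln (cmod (N (p 0))) = 0" using N_real[of "Re z"] by (simp add: p_def)
    show "0 \<le> gain c (level s) / (1 + 5 * err)" for s
      using gain_nonneg[OF c_pos less_imp_le[OF level_pos]] err_pos by simp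
    show "gain c (level s') / (1 + 5 * err) \<le> gain c (level s) / (1 + 5 * err)" if "s \<le> s'" for s s'
      using gain_antimono[OF c_pos less_imp_le[OF level_pos] level_mono[OF that]] err_pos by (intro divide_right_mono) auto
    show "\<bar>Re (of_real \<sigma> * \<omega> (p t))\<bar> * (gain c (level \<bar>ln (cmod (N (p t)))\<bar>) / (1 + 5 * err)) \<le> 1"
      if "0 \<le> t" "t \<le> \<bar>Im z\<bar>" for t
    proof -
      have "\<bar>Re (of_real \<sigma> * \<omega> (p t))\<bar> \<le> cmod (\<omega> (p t))"
        using abs_Re_le_cmod[of "of_real \<sigma> * \<omega> (p t)"] s by (simp add: norm_mult)
      then have "\<bar>Re (of_real \<sigma> * \<omega> (p t))\<bar> * gain c (level (lev (p t))) \<le> cmod (\<omega> (p t)) * gain c (level (lev (p t)))"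
        using gain_nonneg[OF c_pos less_imp_le[OF level_pos]] by (intro mult_right_mono)
      also have "\<dots> \<le> 1 + 5 * err" by (rule omega_bound[OF pin[OF that]])
      finally show ?thesis using err_pos by (simp add: lev_def divide_le_eq)
    qed
  qed auto
  then show ?thesis by (simp add: pz lev_def)
qed

lemma lev_less:
  assumes z: "z \<in> strip d" "\<bar>Im z\<bar> < time H" shows "lev z < H"
  using growth[OF z(1)] time_mono[of H "lev z"] z(2) by linarith

text \<open>The vertical line is parametrized by the imaginary angle \<open>\<eta>\<close> of the extremal solution rather than by
time. Then the powers of \<open>1 - r\<close> cancel between the speed of this parametrization and
\<open>M powr (- 2/3)\<close>, and the derivative of \<open>k\<close> is bounded by \<open>(n / 2) c r / sqrt (1 + c r)\<close>, the derivative of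
\<open>sqrt (1 + c r)\<close> for \<open>r = level \<eta>\<close>, plus a small constant. Finally \<open>c r \<le> 2\<close>.\<close>

lemma k_variation:
  assumes H: "0 < H" "level H < 1" and z: "z \<in> strip d" "\<bar>Im z\<bar> < time H"
  shows "cmod (k z - of_real (kr (Re z))) \<le> sqrt 3 - 1 + n * err * H / 2"
proof -
  \<comment> \<open>the extremal angle at height \<open>Im z\<close>\<close>
  obtain \<eta>1 where eta1: "0 \<le> \<eta>1" "\<eta>1 \<le> H" "time \<eta>1 = \<bar>Im z\<bar>"
    using IVT'[of time 0 "\<bar>Im z\<bar>" H] z(2) H continuous_on_time by auto
  define \<sigma> where "\<sigma> = (if Im z < 0 then - 1 else 1 :: real)"
  have s: "\<bar>\<sigma>\<bar> = 1" "\<sigma> * \<bar>Im z\<bar> = Im z" by (auto simp: \<sigma>_def)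
  define p where "p \<eta> = complex_of_real (Re z) + of_real (time \<eta>) * (of_real \<sigma> * \<i>)" for \<eta>
  have t: "0 \<le> time \<eta>" "time \<eta> \<le> \<bar>Im z\<bar>" if "0 \<le> \<eta>" "\<eta> \<le> \<eta>1" for \<eta>
    using time_mono[of 0 \<eta>] time_mono[of \<eta> \<eta>1] that eta1 by auto
  have Imp: "\<bar>Im (p \<eta>)\<bar> = time \<eta>" if "0 \<le> \<eta>" "\<eta> \<le> \<eta>1" for \<eta>
    using t[OF that] s by (simp add: p_def abs_mult)
  have pin: "p \<eta> \<in> strip d" if "0 \<le> \<eta>" "\<eta> \<le> \<eta>1" for \<eta>
    using Imp[OF that] t[OF that] z by (simp add: strip_def)
  have pz: "p \<eta>1 = z" "p 0 = of_real (Re z)" using s(2) eta1 by (auto simp: p_def complex_eq_iff mult.commute)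
  define g where "g \<eta> = gain c (level \<eta>) / (1 + 5 * err)" for \<eta>
  have g0: "0 \<le> g \<eta>" for \<eta> using gain_nonneg[OF c_pos less_imp_le[OF level_pos]] err_pos by (simp add: g_def)
  define D where "D \<eta> = (of_real (g \<eta>) * (of_real \<sigma> * \<i>)) * vf CK (\<lambda>j. W j (p \<eta>))" for \<eta>
  define \<phi> where "\<phi> \<eta> = sqrt (1 + c * level \<eta>) + n * err / 2 * \<eta>" for \<eta>
  define \<phi>' where "\<phi>' \<eta> = n / 2 * (c * level \<eta>) / sqrt (1 + c * level \<eta>) + n * err / 2" for \<eta>
  have cl: "0 < 1 + c * level \<eta>" for \<eta> using mult_pos_pos[OF c_pos level_pos[of \<eta>]] by linarith
  have dk': "((\<lambda>\<eta>. k (p \<eta>)) has_vector_derivative D \<eta>) (at \<eta>)" if "0 \<le> \<eta>" "\<eta> \<le> \<eta>1" for \<eta>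
  proof -
    have "((\<lambda>\<eta>. complex_of_real (time \<eta>)) has_vector_derivative of_real (g \<eta>)) (at \<eta>)"
      by (rule has_vector_derivative_of_real) (use time_DERIV[of \<eta>] in \<open>simp add: g_def\<close>)
    then have "(p has_vector_derivative of_real (g \<eta>) * (of_real \<sigma> * \<i>)) (at \<eta>)"
      using has_vector_derivative_add[OF has_vector_derivative_const[of "complex_of_real (Re z)"]
          has_vector_derivative_mult_left[of "\<lambda>\<eta>. complex_of_real (time \<eta>)" "of_real (g \<eta>)" _ "of_real \<sigma> * \<i>"]]
      by (simp add: p_def[abs_def])
    from field_vector_diff_chain_at[OF this W[OF pin[OF that], of CK]] show ?thesis
      by (simp add: o_def D_def)
  qed
  have dphi: "(\<phi> has_real_derivative \<phi>' \<eta>) (at \<eta>)" for \<eta>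
  proof -
    have "((\<lambda>\<eta>. level \<eta>) has_real_derivative n * level \<eta>) (at \<eta>)"
      unfolding level_def by (auto intro!: derivative_eq_intros)
    then show ?thesis unfolding \<phi>_def \<phi>'_def using cl[of \<eta>]
      by (auto intro!: derivative_eq_intros simp: field_simps)
  qed
  have bound: "cmod (D \<eta>) \<le> \<phi>' \<eta>" if e: "0 \<le> \<eta>" "\<eta> \<le> \<eta>1" for \<eta>
  proof -
    note zz = pin[OF e]
    have l1: "level \<eta> < 1" using level_mono[of \<eta> H] e eta1 H by simp
    have lev: "lev (p \<eta>) \<le> \<eta>"
    proof (rule ccontr)
      assume "\<not> lev (p \<eta>) \<le> \<eta>"
      then have "\<eta> < lev (p \<eta>)" by simp
      moreover have "lev (p \<eta>) < H" using lev_less[OF zz, of H] Imp[OF e] t[OF e] z by simp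
      moreover have "level (lev (p \<eta>)) < 1" using level_mono[of "lev (p \<eta>)" H] H calculation by simp
      ultimately have "time \<eta> < time (lev (p \<eta>))" by (intro time_strict_mono)
      then show False using growth[OF zz] Imp[OF e] by simp
    qed
    have M0: "M (y (p \<eta>)) \<noteq> 0" by (rule safe_M_cut[OF W_safe[OF zz]])
    have l0: "0 \<le> lev (p \<eta>)" by (simp add: lev_def)
    note lb = level_bounds[OF e(1) l1 beta_y[OF zz] u_level[OF zz lev]]
    have ch: "cosh (lev (p \<eta>)) \<le> cosh \<eta>" using lev l0 e by (subst cosh_real_nonneg_le_iff) auto
    have u: "cmod (u (p \<eta>)) \<le> cosh \<eta>" "cmod (x (p \<eta>)) \<le> cosh \<eta>" using lev_bounds[OF zz] ch by auto
    define A where "A = cmod (Ygrad (y (p \<eta>)) * (Ehess (y (p \<eta>)) - 1) * x (p \<eta>))"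
    have "cmod (Ehess (y (p \<eta>)) - 1) = n * (n - 1) / 2 * norm (P (y (p \<eta>)))"
    proof -
      have "Ehess (y (p \<eta>)) - 1 = of_real (n * (n - 1) / 2) * P (y (p \<eta>))" by (simp add: Ehess_def)
      then show ?thesis using n_pos by (simp only: norm_mult norm_of_real) simp
    qed
    then have "A = cmod (u (p \<eta>)) * cmod (qt (p \<eta>)) * (n * (n - 1) / 2 * norm (P (y (p \<eta>)))) * cmod (x (p \<eta>))"
      by (simp add: A_def norm_mult flip: u_qt[OF zz])
    also have "\<dots> \<le> cosh \<eta> * (1 + err) * (n * (n - 1) / 2 * norm (P (y (p \<eta>)))) * cosh \<eta>"
      using u qt_bound[OF zz] n_pos err_pos by (intro mult_mono) (auto intro!: mult_nonneg_nonneg)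
    also have "\<dots> = (1 + err) * (n * (n - 1) / 2 * (norm (P (y (p \<eta>))) * (cosh \<eta>)\<^sup>2))" by (simp add: power2_eq_square)
    also have "\<dots> \<le> (1 + err) * (n / 2 * (c * level \<eta> + err))" using lb(4) err_pos by (intro mult_left_mono) auto
    finally have A: "A \<le> (1 + err) * (n / 2 * (c * level \<eta> + err))" .
    have A0: "0 \<le> A" by (simp add: A_def)
    define r where "r = level \<eta>"
    have r: "0 < r" "r < 1" using level_pos l1 by (auto simp: r_def)
    define L where "L = M (y (p \<eta>))"
    have L: "(1 - err) * (1 - r) \<le> cmod L" using lb(3) by (simp add: L_def r_def)
    have e: "0 < err" "err \<le> 1/100" using err_pos err by auto
    have p: "cmod L powr (-2/3) \<le> (1 - r) powr (-2/3) / (1 - err)" by (rule M_power_bound[OF r(2) L])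
    have "g \<eta> * cmod L powr (-2/3) \<le> g \<eta> * ((1 - r) powr (-2/3) / (1 - err))" using p g0 by (intro mult_left_mono)
    also have "\<dots> = ((1 - r) powr (2/3) * (1 - r) powr (-2/3)) / sqrt (1 + c * r) / ((1 + 5 * err) * (1 - err))"
      using r by (simp add: g_def gain_def r_def[symmetric] max_def)
    also have "\<dots> = 1 / sqrt (1 + c * r) / ((1 + 5 * err) * (1 - err))" using r by (simp flip: powr_add)
    finally have gp: "g \<eta> * cmod L powr (-2/3) \<le> 1 / sqrt (1 + c * r) / ((1 + 5 * err) * (1 - err))" .
    have "cmod (D \<eta>) = (g \<eta> * cmod L powr (-2/3)) * A"
      using g0[of \<eta>] s(1) by (simp add: D_def vf_simps A_def L_def norm_mult norm_pw[OF M0] mult_ac)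
    also have "\<dots> \<le> (1 / sqrt (1 + c * r) / ((1 + 5 * err) * (1 - err))) * ((1 + err) * (n / 2 * (c * r + err)))"
      using gp A A0 g0[of \<eta>] cl[of \<eta>] e by (intro mult_mono) (auto simp: r_def)
    also have "\<dots> = ((1 + err) / ((1 + 5 * err) * (1 - err))) * (n / 2 * (c * r + err) / sqrt (1 + c * r))" by simp
    also have "\<dots> \<le> 1 * (n / 2 * (c * r + err) / sqrt (1 + c * r))"
    proof (rule mult_right_mono)
      have "err * err \<le> err * (1/100)" using e by (intro mult_left_mono) auto
      then have "1 + err \<le> (1 + 5 * err) * (1 - err)" using e by (simp add: algebra_simps)
      then show "(1 + err) / ((1 + 5 * err) * (1 - err)) \<le> 1" using e by (simp add: divide_le_eq)
      show "0 \<le> n / 2 * (c * r + err) / sqrt (1 + c * r)" using n_pos c_pos r e cl[of \<eta>] by (auto simp: r_def intro!: divide_nonneg_nonneg mult_nonneg_nonneg add_nonneg_nonneg less_imp_le)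
    qed
    also have "\<dots> = n / 2 * (c * r) / sqrt (1 + c * r) + n * err / 2 / sqrt (1 + c * r)"
      by (simp add: algebra_simps add_divide_distrib)
    also have "n * err / 2 / sqrt (1 + c * r) \<le> n * err / 2 / 1"
      using n_pos e c_pos r cl[of \<eta>, folded r_def] by (intro divide_left_mono) auto
    finally show ?thesis by (simp add: \<phi>'_def r_def)
  qed
  have "cmod (k (p \<eta>1) - k (p 0)) \<le> \<phi> \<eta>1 - \<phi> 0"
  proof (cases "\<eta>1 = 0")
    case False
    show ?thesis
    proof (rule differentiable_bound_general[of 0 \<eta>1 "\<lambda>\<eta>. k (p \<eta>)" \<phi> D \<phi>'])
      show "continuous_on {0..\<eta>1} (\<lambda>\<eta>. k (p \<eta>))"
        by (intro continuous_at_imp_continuous_on ballI) (rule has_vector_derivative_continuous[OF dk'], auto)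
      show "continuous_on {0..\<eta>1} \<phi>" using dphi by (meson DERIV_continuous continuous_at_imp_continuous_on)
    qed (use dk' dphi bound False eta1 in \<open>auto simp: has_real_derivative_iff_has_vector_derivative\<close>)
  qed simp
  also have "\<dots> \<le> sqrt 3 - 1 + n * err * H / 2"
  proof -
    have "c * level \<eta>1 \<le> 2 * 1" using c_pos c_le_2 level_mono[OF eta1(2)] H level_pos[of \<eta>1] by (intro mult_mono) auto
    then have "sqrt (1 + c * level \<eta>1) \<le> sqrt 3" by simp
    moreover have "1 \<le> sqrt (1 + c * level 0)" using c_pos level_pos[of 0] by simp
    moreover have "n * err / 2 * \<eta>1 \<le> n * err / 2 * H" using eta1 n_pos err_pos by (intro mult_left_mono) auto
    moreover have "n * err / 2 * H = n * err * H / 2" "n * err / 2 * 0 = 0" by simp_all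
    ultimately show ?thesis unfolding \<phi>_def by linarith
  qed
  finally show ?thesis by (simp add: pz W_real)
qed

end

section \<open>Extension of the curvature to a strip\<close>

context real_orbit
begin

lemma kr_near_1: "24/25 \<le> kr t"
proof -
  have "(1 - err) * r0 \<le> 1 * r0" using err_pos r0_pos by (intro mult_right_mono) auto
  then have 1: "a * (\<beta> * \<bar>yr t\<bar>) ^ (m + 2) + n\<^sup>2 * \<beta>\<^sup>2 \<le> 2 * err" using real_level_bounds(1)[of t] r0_le_err by linarith
  have "(n - 1) * (\<beta> * \<bar>yr t\<bar>) ^ (m + 2) = c * (a * (\<beta> * \<bar>yr t\<bar>) ^ (m + 2))" using ca by (simp flip: mult.assoc)
  also have "\<dots> \<le> 2 * (a * (\<beta> * \<bar>yr t\<bar>) ^ (m + 2))" using c_le_2 a_ge_1 beta by (intro mult_right_mono) auto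
  finally have "norm (Ksq (yr t) - 1) \<le> 2 * (a * (\<beta> * \<bar>yr t\<bar>) ^ (m + 2)) + n\<^sup>2 * \<beta>\<^sup>2"
    using perturbation_bounds(3)[of "yr t"] beta_yr[of t] by simp
  also have "\<dots> \<le> 4 * err" using 1 by (smt (verit) mult_nonneg_nonneg zero_le_power2)
  finally have "1 - 4 * err \<le> Ksq (yr t)" by simp
  then have "24/25 \<le> (kr t)\<^sup>2" using err by (simp add: k2)
  show ?thesis
  proof (rule power2_le_imp_le)
    show "(24/25)\<^sup>2 \<le> (kr t)\<^sup>2" using \<open>24/25 \<le> (kr t)\<^sup>2\<close> by (simp add: power2_eq_square)
  qed (use k_pos[of t] in simp)
qed

end

context strip_orbit
begin

text \<open>Below the extremal time the level of \<open>z\<close> is smaller than \<open>level H\<close>, so the orbit stays in a fixed box: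
this is the a priori bound for the continuation.\<close>

lemma in_box:
  assumes z: "z \<in> strip d" "\<bar>Im z\<bar> < time H" and H: "level H < 1"
  shows "a * (\<beta> * cmod (y z)) ^ (m + 2) + n\<^sup>2 * \<beta>\<^sup>2 \<le> (1 - err) * level H + err"
    "cmod (x z) \<le> cosh H" "cmod (k z) \<le> 2"
proof -
  have l: "lev z < H" by (rule lev_less[OF z])
  have l0: "0 \<le> lev z" by (simp add: lev_def)
  have l1: "level (lev z) \<le> level H" using l by (intro level_mono) simp
  have l1': "level (lev z) < 1" using l1 H by simp
  note lb = level_bounds[OF l0 l1' beta_y[OF z(1)] u_level[OF z(1) order_refl]]
  have "(1 - err) * level (lev z) \<le> (1 - err) * level H" using l1 err by (intro mult_left_mono) auto
  then show "a * (\<beta> * cmod (y z)) ^ (m + 2) + n\<^sup>2 * \<beta>\<^sup>2 \<le> (1 - err) * level H + err" using lb(1) by simp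
  have "cosh (lev z) \<le> cosh H" using l l0 by (subst cosh_real_nonneg_le_iff) auto
  then show "cmod (x z) \<le> cosh H" using lev_bounds(2)[OF z(1)] by simp
  have "c * level (lev z) \<le> 2 * 1" using c_le_2 c_pos l1' level_pos[of "lev z"] by (intro mult_mono) auto
  then have "(1 + err) * (1 + c * level (lev z)) \<le> (1 + 1/100) * 3" using err err_pos c_pos level_pos[of "lev z"] by (intro mult_mono) (auto intro: add_nonneg_nonneg mult_nonneg_nonneg less_imp_le)
  then have "(cmod (k z))\<^sup>2 \<le> 2\<^sup>2" using lb(2) by (simp flip: norm_power add: invariants(2)[OF z(1)])
  then show "cmod (k z) \<le> 2" by (rule power2_le_imp_le) simp
qed

text \<open>The size of \<open>Ksq\<close> alone does not exclude zeros: for \<open>n = 3\<close> the polynomial \<open>1 + c r\<close> vanishes already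
at \<open>r = - 1/2\<close>. But \<open>k\<close> starts near \<open>1\<close> and moves by at most \<open>sqrt 3 - 1\<close> plus a small amount.\<close>

lemma Re_k_pos:
  assumes H: "0 < H" "level H < 1" "n * err * H \<le> 1/5" and z: "z \<in> strip d" "\<bar>Im z\<bar> < time H"
  shows "0 < Re (k z)"
proof -
  have "sqrt 3 \<le> 1.75" by (rule real_le_lsqrt) (auto simp: power2_eq_square)
  then have "cmod (k z - of_real (kr (Re z))) \<le> 0.85" using k_variation[OF H(1,2) z] H(3) by simp
  then have "kr (Re z) - Re (k z) \<le> 0.85" using abs_Re_le_cmod[of "k z - of_real (kr (Re z))"] by simp
  then show ?thesis using kr_near_1[of "Re z"] by simp
qed

end

context real_orbit
begin

text \<open>The bounds of \<open>in_box\<close> are strictly stronger than the safety condition as long as \<open>level H < 1\<close>, which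
leaves room for the polydiscs in \<open>strip_continuation\<close>.\<close>

lemma complex_extension:
  assumes H: "0 < H" "level H < 1"
  obtains W where "strip_orbit m \<beta> xr yr kr W (time H)"
proof -
  define v1 where "v1 = (1 - err) * level H + err"
  define v2 where "v2 = (1 + v1) / 2"
  \<comment> \<open>the radius at which the safety expression has the value \<open>v\<close>\<close>
  define T where "T v = root (m + 2) ((v - n\<^sup>2 * \<beta>\<^sup>2) / a)" for v
  have v1: "err < v1" "v1 < 1"
  proof -
    show "err < v1" using level_pos[of H] err by (simp add: v1_def)
    have "(1 - err) * level H < (1 - err) * 1" using H err by (intro mult_strict_left_mono) auto
    then show "v1 < 1" by (simp add: v1_def)
  qed
  have v2: "v1 < v2" "v2 < 1" using v1 by (auto simp: v2_def)
  have b: "n\<^sup>2 * \<beta>\<^sup>2 \<le> err"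
  proof -
    have "2 * n\<^sup>2 * \<beta>\<^sup>2 = 2 * (n\<^sup>2 * \<beta>\<^sup>2)" "0 \<le> n\<^sup>2 * \<beta>\<^sup>2" by simp_all
    then show ?thesis using beta_bounds(1) by linarith
  qed
  have T: "0 \<le> T v" "a * T v ^ (m + 2) + n\<^sup>2 * \<beta>\<^sup>2 = v" if "err \<le> v" for v
  proof -
    have p: "0 \<le> (v - n\<^sup>2 * \<beta>\<^sup>2) / a" using that b a_ge_1 by simp
    then show "0 \<le> T v" by (simp add: T_def)
    have "T v ^ (m + 2) = (v - n\<^sup>2 * \<beta>\<^sup>2) / a" unfolding T_def by (rule real_root_pow_pos2[OF _ p]) simp
    then show "a * T v ^ (m + 2) + n\<^sup>2 * \<beta>\<^sup>2 = v" using a_ge_1 by (simp del: power_Suc add_2_eq_Suc')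
  qed
  have Tmono: "T v < T v'" if "v < v'" for v v'
    unfolding T_def using that a_ge_1 by (simp add: divide_strict_right_mono)
  have leT: "s \<le> T v" if "0 \<le> s" "err \<le> v" "a * s ^ (m + 2) + n\<^sup>2 * \<beta>\<^sup>2 \<le> v" for s v
  proof -
    have "s ^ (m + 2) \<le> (v - n\<^sup>2 * \<beta>\<^sup>2) / a" using that(3) a_ge_1 by (simp add: field_simps del: power_Suc add_2_eq_Suc')
    then have "root (m + 2) (s ^ (m + 2)) \<le> T v" unfolding T_def by (intro real_root_le_mono) auto
    moreover have "root (m + 2) (s ^ (m + 2)) = s" using that(1) by (intro real_root_power_cancel) auto
    ultimately show ?thesis by simp
  qed
  have safe2: "safe (T v2)" unfolding safe_def using T(2)[of v2] v1 v2 by simp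
  define R where "R = max 2 (cosh H)"
  have T0: "0 \<le> T v1" "T v1 < T v2" using T(1)[of v1] Tmono[of v1 v2] v1 v2 by auto
  obtain \<rho> B \<Lambda> r where ode: "holomorphic_ode vf (phase_box (T v1) R) \<rho> B \<Lambda> r"
    and sub: "\<And>w0 w. w0 \<in> phase_box (T v1) R \<Longrightarrow> w \<in> polydisc w0 \<rho> \<Longrightarrow> w \<in> phase_box (T v2) (R + 1)"
    using vf_holomorphic_ode[OF T0 safe2] by metis
  interpret ode: holomorphic_ode vf "phase_box (T v1) R" \<rho> B \<Lambda> r by (rule ode)
  have l0: "r0 = level 0" by (simp add: level_def)
  have rl: "r0 \<le> level H" unfolding l0 using H by (intro level_mono) simp
  have box: "(\<lambda>j. Vr j t) \<in> phase_box (T v1) R" for t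
  proof -
    have "(1 - err) * r0 \<le> (1 - err) * level H" using rl err by (intro mult_left_mono) auto
    then have "a * (\<beta> * \<bar>yr t\<bar>) ^ (m + 2) + n\<^sup>2 * \<beta>\<^sup>2 \<le> v1" using real_level_bounds(1)[of t] by (simp add: v1_def)
    then have 1: "\<beta> * \<bar>yr t\<bar> \<le> T v1" using v1 beta by (intro leT) auto
    have "\<bar>P (yr t)\<bar> \<le> 1" using perturbation_bounds(1)[of "yr t"] beta_yr[of t] beta_small(2) by fastforce
    then have "0 \<le> (yr t)\<^sup>2 * (1 + P (yr t))" by (intro mult_nonneg_nonneg) auto
    moreover have "(yr t)\<^sup>2 * (1 + P (yr t)) = 1 - (xr t)\<^sup>2" by (simp add: x2 Xsq_def S_P algebra_simps)
    ultimately have "\<bar>xr t\<bar> \<le> 1" by (simp add: abs_square_le_1)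
    moreover have "c * r0 \<le> 2 * 1" using c_le_2 c_pos rl H r0_pos by (intro mult_mono) auto
    then have "(1 + err) * (1 + c * r0) \<le> (1 + 1/100) * 3" using err err_pos c_pos r0_pos by (intro mult_mono) (auto intro: add_nonneg_nonneg mult_nonneg_nonneg less_imp_le)
    then have "(kr t)\<^sup>2 \<le> 2\<^sup>2" using real_level_bounds(2)[of t] by (simp add: k2)
    then have "kr t \<le> 2" by (rule power2_le_imp_le) simp
    moreover have "2 \<le> R" by (simp add: R_def)
    ultimately show ?thesis using 1 k_pos[of t] by (simp add: phase_box_def)
  qed
  have orbit: "strip_orbit m \<beta> xr yr kr W d'"
    if "0 < d'" "ode.ode_solution (strip d') W" "\<And>t j. W j (complex_of_real t) = Vr j t" for W d'
  proof
    show "0 < d'" by fact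
    show "W j (complex_of_real t) = Vr j t" for t j by (rule that(3))
    show "(W j has_field_derivative vf j (\<lambda>i. W i z)) (at z)" if "z \<in> strip d'" for z j
      using \<open>ode.ode_solution (strip d') W\<close> that by (simp add: ode.ode_solution_def)
    show "safe (\<beta> * cmod (W CY z))" if z: "z \<in> strip d'" for z
    proof -
      obtain w0 where "w0 \<in> phase_box (T v1) R" "(\<lambda>j. W j z) \<in> polydisc w0 \<rho>"
        using \<open>ode.ode_solution (strip d') W\<close> z unfolding ode.ode_solution_def by blast
      from sub[OF this] have "\<beta> * cmod (W CY z) \<le> T v2" by (simp add: phase_box_def)
      then show ?thesis using safe_mono[OF safe2] beta by simp
    qed
  qed
  have time_pos: "0 < time H" using time_strict_mono[OF H] by simp
  obtain W where W: "ode.ode_solution (strip (time H)) W" "\<And>t j. W j (complex_of_real t) = Vr j t"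
  proof (rule ode.strip_continuation[of Vr "time H"])
    fix d' W z assume *: "0 < d'" "d' \<le> time H" "ode.ode_solution (strip d') W" "\<And>x j. W j (complex_of_real x) = Vr j x" "z \<in> strip d'"
    interpret so: strip_orbit m \<beta> xr yr kr W d' by (rule orbit[OF *(1,3,4)])
    have "\<bar>Im z\<bar> < time H" using * by (simp add: strip_def)
    from so.in_box[OF *(5) this H(2)] show "(\<lambda>j. W j z) \<in> phase_box (T v1) R"
      using leT[of "\<beta> * cmod (W CY z)" v1] beta v1 by (auto simp: phase_box_def R_def v1_def)
  qed (use box Vr_derivative time_pos in auto)
  show thesis by (rule that[OF orbit[OF time_pos W]])
qed

definition kappa :: "real \<Rightarrow> real" where
  "kappa t = M (yr t) / kr t ^ 3"

end

context strip_orbit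
begin

lemma kappa_extension:
  assumes "0 < d'" "d' \<le> d" "\<And>z. z \<in> strip d' \<Longrightarrow> k z \<noteq> 0"
  shows "zero_free_ext kappa d' (\<lambda>z. M (y z) / k z ^ 3)"
  unfolding zero_free_ext_def
proof (intro conjI allI ballI)
  have sub: "strip d' \<subseteq> strip d" using assms(2) by (auto simp: strip_def)
  show "(\<lambda>z. M (y z) / k z ^ 3) holomorphic_on strip d'"
    using assms(3) holomorphic_on_subset[OF W_holomorphic sub] by (intro holomorphic_intros) auto
  show "M (y (of_real t)) / k (of_real t) ^ 3 = of_real (kappa t)" for t
    by (simp add: W_real kappa_def M_of_real)
  show "M (y z) / k z ^ 3 \<noteq> 0" if "z \<in> strip d'" for z
    using safe_M_cut(2)[OF W_safe[of z]] assms(3)[OF that] that sub by auto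
qed

end

context real_orbit
begin

lemma kappa_zero_free:
  assumes H: "0 < H" "level H < 1" "n * err * H \<le> 1/5"
  shows "\<exists>F. zero_free_ext kappa (time H) F"
proof -
  obtain W where W: "strip_orbit m \<beta> xr yr kr W (time H)" using complex_extension[OF H(1,2)] .
  interpret strip_orbit m \<beta> xr yr kr W "time H" by (rule W)
  have "k z \<noteq> 0" if "z \<in> strip (time H)" for z
    using Re_k_pos[OF H that] that by (force simp: strip_def)
  then show ?thesis using kappa_extension[OF d order_refl] by blast
qed

end

section \<open>The rotation angle and the period\<close>

lemma real_segment_convex_neighbourhood:
  assumes "open U" "of_real ` {\<alpha>..\<beta>} \<subseteq> (U :: complex set)" "\<alpha> \<le> \<beta>"
  obtains V where "open V" "convex V" "of_real ` {\<alpha>..\<beta>} \<subseteq> V" "V \<subseteq> U"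
proof -
  have "compact (complex_of_real ` {\<alpha>..\<beta>})" by (intro compact_continuous_image continuous_intros compact_Icc)
  then obtain e where e: "e > 0" "(\<Union>x\<in>complex_of_real ` {\<alpha>..\<beta>}. ball x e) \<subseteq> U"
    using compact_subset_open_imp_ball_epsilon_subset assms(1,2) by blast
  define V where "V = {w. \<alpha> - e/2 < Re w} \<inter> {w. Re w < \<beta> + e/2} \<inter> {w. - (e/2) < Im w} \<inter> {w. Im w < e/2}"
  have "open V" unfolding V_def by (intro open_Int open_Collect_less continuous_intros)
  moreover have "convex V"
    unfolding V_def using convex_halfspace_Re_gt[of "\<alpha> - e/2"] convex_halfspace_Re_lt[of "\<beta> + e/2"]
      convex_halfspace_Im_gt[of "- (e/2)"] convex_halfspace_Im_lt[of "e/2"]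
    by (intro convex_Int) auto
  moreover have "of_real ` {\<alpha>..\<beta>} \<subseteq> V" using e by (auto simp: V_def)
  moreover have "V \<subseteq> U"
  proof
    fix w assume w: "w \<in> V"
    define p where "p = max \<alpha> (min \<beta> (Re w))"
    have p: "p \<in> {\<alpha>..\<beta>}" "\<bar>p - Re w\<bar> < e/2" using w assms(3) e by (auto simp: p_def V_def min_def max_def)
    have "cmod (of_real p - w) \<le> \<bar>Re (of_real p - w)\<bar> + \<bar>Im (of_real p - w)\<bar>" by (rule cmod_le)
    also have "\<dots> < e/2 + e/2" using p w by (intro add_strict_mono) (auto simp: V_def)
    finally have "w \<in> ball (of_real p) e" by (simp add: dist_norm)
    then show "w \<in> U" using e p by blast
  qed
  ultimately show thesis by (rule that)
qed

context small_curve
begin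

lemma P_real_small: "\<bar>y\<bar> \<le> 2 \<Longrightarrow> \<bar>P y\<bar> \<le> \<beta>\<^sup>2"
proof -
  assume y: "\<bar>y\<bar> \<le> 2"
  have "\<beta> * \<bar>y\<bar> \<le> 1/10 * 2" using y beta beta_tenth by (intro mult_mono) auto
  then show ?thesis using perturbation_bounds(1)[of y] by simp
qed

definition ur :: "real \<Rightarrow> real" where "ur y = y * sqrt (1 + P y)"

lemma DERIV_ur:
  assumes "0 < 1 + P y"
  shows "(ur has_real_derivative (1 + n / 2 * P y) / sqrt (1 + P y)) (at y)"
proof -
  obtain D where D: "(P has_field_derivative D) (at y)" "y * D = of_nat m * P y" using DERIV_P by blast
  have s: "sqrt (1 + P y) * sqrt (1 + P y) = 1 + P y" "sqrt (1 + P y) \<noteq> 0" using assms by auto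
  have "((\<lambda>y. sqrt (1 + P y)) has_real_derivative D / (2 * sqrt (1 + P y))) (at y)"
    using assms by (auto intro!: derivative_eq_intros D(1) simp: field_simps)
  from DERIV_mult[OF DERIV_ident this]
  have "(ur has_real_derivative sqrt (1 + P y) + (y * D) / (2 * sqrt (1 + P y))) (at y)"
    by (simp add: ur_def[abs_def] mult.commute)
  moreover have "sqrt (1 + P y) + (y * D) / (2 * sqrt (1 + P y)) = (1 + n / 2 * P y) / sqrt (1 + P y)"
    using s unfolding D(2) by (simp add: field_simps n_def)
  ultimately show ?thesis by simp
qed

lemma ur_square: "0 < 1 + P y \<Longrightarrow> (ur y)\<^sup>2 = 1 - Xsq y"
  by (simp add: ur_def power_mult_distrib Xsq_def S_P algebra_simps)

text \<open>Together with \<open>xr\<close> the value \<open>u\<close> determines the point of the curve, which is needed to count turns.\<close>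

lemma ur_inj:
  assumes "\<bar>y\<bar> \<le> 2" "\<bar>y'\<bar> \<le> 2" "ur y = ur y'" shows "y = y'"
proof (rule ccontr)
  have less: "ur s < ur t" if "s < t" "\<bar>s\<bar> \<le> 2" "\<bar>t\<bar> \<le> 2" for s t
  proof (rule DERIV_pos_imp_increasing[OF that(1)])
    fix v assume "s \<le> v" "v \<le> t"
    then have P: "\<bar>P v\<bar> \<le> \<beta>\<^sup>2" using that by (intro P_real_small) auto
    then have 1: "0 < 1 + P v" using beta_small by linarith
    have "\<bar>n / 2 * P v\<bar> \<le> n / 2 * \<beta>\<^sup>2" using P n_pos by (simp add: abs_mult mult_left_mono)
    moreover have "n * \<beta>\<^sup>2 \<le> 1/100" using beta_bounds(2) err by simp
    ultimately have "0 < 1 + n / 2 * P v" by linarith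
    then show "\<exists>y. (ur has_real_derivative y) (at v) \<and> 0 < y" using DERIV_ur[OF 1] 1
      by (intro exI[of _ "(1 + n / 2 * P v) / sqrt (1 + P v)"]) simp
  qed
  assume "y \<noteq> y'"
  then show False using less[of y y'] less[of y' y] assms by linarith
qed

end

context real_orbit
begin

definition speed :: "real \<Rightarrow> real" where
  "speed t = (1 + n / 2 * P (yr t)) / sqrt (1 + P (yr t)) * kr t * M (yr t) powr (-2/3)"

lemma P_yr: "\<bar>P (yr t)\<bar> \<le> \<beta>\<^sup>2" "0 < 1 + P (yr t)"
  using P_real_small[OF y_le[of t]] beta_small by auto

lemma speed_near_1: "\<bar>speed t - 1\<bar> \<le> 10 * err"
proof -
  define e where "e = err"
  have e: "0 < e" "e \<le> 1/100" using err_pos err by (auto simp: e_def)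
  have "(1 - err) * r0 \<le> 1 * r0" using err_pos r0_pos by (intro mult_right_mono) auto
  then have 1: "a * (\<beta> * \<bar>yr t\<bar>) ^ (m + 2) + n\<^sup>2 * \<beta>\<^sup>2 \<le> 2 * e" using real_level_bounds(1)[of t] r0_le_err by (simp add: e_def)
  have M: "\<bar>M (yr t) - 1\<bar> \<le> 2 * e" using perturbation_bounds(2)[of "yr t"] beta_yr[of t] 1 by simp
  have "(n - 1) * (\<beta> * \<bar>yr t\<bar>) ^ (m + 2) = c * (a * (\<beta> * \<bar>yr t\<bar>) ^ (m + 2))" using ca by (simp flip: mult.assoc)
  also have "\<dots> \<le> 2 * (a * (\<beta> * \<bar>yr t\<bar>) ^ (m + 2))" using c_le_2 a_ge_1 beta by (intro mult_right_mono) auto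
  finally have "\<bar>Ksq (yr t) - 1\<bar> \<le> 2 * (a * (\<beta> * \<bar>yr t\<bar>) ^ (m + 2)) + n\<^sup>2 * \<beta>\<^sup>2"
    using perturbation_bounds(3)[of "yr t"] beta_yr[of t] by simp
  moreover have "0 \<le> n\<^sup>2 * \<beta>\<^sup>2" by simp
  ultimately have K: "\<bar>(kr t)\<^sup>2 - 1\<bar> \<le> 4 * e" using 1 unfolding k2 by linarith
  have kr: "\<bar>kr t - 1\<bar> \<le> 4 * e"
  proof -
    have "(kr t)\<^sup>2 - 1 = (kr t - 1) * (kr t + 1)" by (simp add: power2_eq_square algebra_simps)
    then have "\<bar>kr t - 1\<bar> * 1 \<le> \<bar>(kr t)\<^sup>2 - 1\<bar>" unfolding abs_mult
      using k_pos[of t] by (simp add: abs_mult) (intro mult_left_mono[of 1 "kr t + 1" "\<bar>kr t - 1\<bar>", simplified], simp)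
    then show ?thesis using K by simp
  qed
  define q where "q = (1 + n / 2 * P (yr t)) / sqrt (1 + P (yr t))"
  have q: "\<bar>q - 1\<bar> \<le> e"
  proof -
    define p where "p = P (yr t)"
    have p: "\<bar>p\<bar> \<le> \<beta>\<^sup>2" using P_yr by (simp add: p_def)
    have b: "2 * n\<^sup>2 * \<beta>\<^sup>2 \<le> e" using beta_bounds by (simp add: e_def)
    have "3 * n \<le> n\<^sup>2" using n_pos by (simp add: power2_eq_square)
    then have "2 * (3 * n) * \<beta>\<^sup>2 \<le> 2 * n\<^sup>2 * \<beta>\<^sup>2" by (intro mult_right_mono) auto
    moreover have "2 * (3 * n) * \<beta>\<^sup>2 = 6 * (n * \<beta>\<^sup>2)" by simp
    ultimately have nb: "6 * (n * \<beta>\<^sup>2) \<le> e" using b by linarith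
    have b3: "3 * \<beta>\<^sup>2 \<le> n * \<beta>\<^sup>2" using n_pos by (intro mult_right_mono) auto
    have np: "\<bar>n / 2 * p\<bar> \<le> n * \<beta>\<^sup>2 / 2" using mult_left_mono[OF p, of "n/2"] n_pos by (simp add: abs_mult)
    have p': "\<bar>p\<bar> \<le> e / 18" "\<bar>n / 2 * p\<bar> \<le> e / 12" using p nb b3 np by linarith+
    have s: "1 - e/18 \<le> sqrt (1 + p)" "sqrt (1 + p) \<le> 1 + e/18"
    proof -
      have "(1 - e/18)\<^sup>2 \<le> 1 - e/18" using e by (simp add: power2_eq_square mult_left_le)
      then show "1 - e/18 \<le> sqrt (1 + p)" using p' by (intro real_le_rsqrt) linarith
      have "1 + e/18 \<le> (1 + e/18)\<^sup>2" using e by (simp add: power2_eq_square algebra_simps)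
      then show "sqrt (1 + p) \<le> 1 + e/18" using p' e by (intro real_le_lsqrt) linarith+
    qed
    have sp: "0 < sqrt (1 + p)" using s e by linarith
    have "q \<le> 1 + e"
    proof -
      have "e * sqrt (1 + p) \<ge> e * (1/2)" using s e by (intro mult_left_mono) auto
      moreover have "(1 + e) * sqrt (1 + p) = sqrt (1 + p) + e * sqrt (1 + p)" by (simp add: algebra_simps)
      ultimately have "1 + n / 2 * p \<le> (1 + e) * sqrt (1 + p)" using p' s e by linarith
      then show ?thesis using sp by (simp add: q_def p_def[symmetric] divide_le_eq)
    qed
    moreover have "1 - e \<le> q"
    proof -
      have "e * sqrt (1 + p) \<ge> e * (1/2)" using s e by (intro mult_left_mono) auto
      moreover have "(1 - e) * sqrt (1 + p) = sqrt (1 + p) - e * sqrt (1 + p)" by (simp add: algebra_simps)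
      ultimately have "(1 - e) * sqrt (1 + p) \<le> 1 + n / 2 * p" using p' s e by linarith
      then show ?thesis using sp by (simp add: q_def p_def[symmetric] le_divide_eq)
    qed
    ultimately show ?thesis by linarith
  qed
  define p where "p = M (yr t) powr (-2/3)"
  have p: "1 - 3 * e \<le> p" "p \<le> 1 + 3 * e"
  proof -
    have Mb: "1 - 2 * e \<le> M (yr t)" "M (yr t) \<le> 1 + 2 * e" using M by linarith+
    have "p \<le> (1 - 2 * e) powr (-2/3)" unfolding p_def using Mb e by (intro powr_mono2') auto
    also have "\<dots> \<le> (1 - 2 * e) powr (-1)" using e powr_mono'[of "-1" "-2/3" "1 - 2 * e"] by simp
    also have "\<dots> = 1 / (1 - 2 * e)" using e powr_neg_one[of "1 - 2 * e"] by simp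
    also have "\<dots> \<le> 1 + 3 * e"
    proof -
      have "e * e \<le> e * (1/100)" using e by (intro mult_left_mono) auto
      moreover have "(1 + 3 * e) * (1 - 2 * e) = 1 + e - 6 * (e * e)" by (simp add: algebra_simps)
      ultimately have "1 \<le> (1 + 3 * e) * (1 - 2 * e)" using e by linarith
      then show ?thesis using e by (simp add: divide_le_eq)
    qed
    finally show "p \<le> 1 + 3 * e" .
    have "1 - 3 * e \<le> 1 / (1 + 2 * e)"
    proof -
      have "(1 - 3 * e) * (1 + 2 * e) \<le> 1" using e by (simp add: algebra_simps)
      then show ?thesis using e by (simp add: le_divide_eq)
    qed
    also have "\<dots> = (1 + 2 * e) powr (-1)" using e powr_neg_one[of "1 + 2 * e"] by simp
    also have "\<dots> \<le> (1 + 2 * e) powr (-2/3)" using e by (intro powr_mono) auto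
    also have "\<dots> \<le> p" unfolding p_def using Mb e by (intro powr_mono2') auto
    finally show "1 - 3 * e \<le> p" .
  qed
  have qb: "1 - e \<le> q" "q \<le> 1 + e" and kb: "1 - 4 * e \<le> kr t" "kr t \<le> 1 + 4 * e" using q kr by linarith+
  have ee: "e * e \<le> e * (1/100)" "e * (e * e) \<le> e * (1/100 * (1/100))" using e by (intro mult_left_mono mult_mono; simp)+
  have "q * kr t * p \<le> (1 + e) * (1 + 4 * e) * (1 + 3 * e)" using qb kb p e k_pos[of t] by (intro mult_mono) auto
  also have "\<dots> = 1 + 8 * e + 19 * (e * e) + 12 * (e * (e * e))" by (simp add: algebra_simps)
  also have "\<dots> \<le> 1 + 10 * e" using ee e by linarith
  finally have up: "q * kr t * p \<le> 1 + 10 * e" .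
  have "(1 - e) * (1 - 4 * e) * (1 - 3 * e) \<le> q * kr t * p" using qb kb p e k_pos[of t] by (intro mult_mono) auto
  moreover have "(1 - e) * (1 - 4 * e) * (1 - 3 * e) = 1 - 8 * e + 19 * (e * e) - 12 * (e * (e * e))" by (simp add: algebra_simps)
  moreover have "0 \<le> e * e" using e by simp
  ultimately have lo: "1 - 10 * e \<le> q * kr t * p" using ee e by linarith
  show ?thesis using up lo by (simp add: speed_def q_def p_def e_def abs_le_iff)
qed

end

context strip_orbit
begin

lemma u_of_real: "u (of_real t) = of_real (ur (yr t))" and q_of_real: "q (of_real t) = of_real (sqrt (1 + P (yr t)))"
proof -
  have "csqrt (of_real (1 + P (yr t))) = of_real (sqrt (1 + P (yr t)))"
    using P_yr(2)[of t] by (subst csqrt_of_real_nonneg) auto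
  then show "q (of_real t) = of_real (sqrt (1 + P (yr t)))" by (simp add: q_def W_real P_of_real)
  then show "u (of_real t) = of_real (ur (yr t))" by (simp add: u_def W_real ur_def)
qed

lemma omega_of_real: "\<omega> (of_real t) = of_real (speed t)"
  by (simp add: \<omega>_def qt_def q_of_real W_real P_of_real pw_of_real[OF real_M_pos] speed_def)

end

context real_orbit
begin

text \<open>A lift of the angle of \<open>N\<close> along the real orbit.\<close>

definition angle_fun :: "(real \<Rightarrow> real) \<Rightarrow> bool" where
  "angle_fun \<phi> \<longleftrightarrow> (\<forall>t. (\<phi> has_real_derivative speed t) (at t)) \<and>
     (\<forall>t. Complex (ur (yr t)) (xr t) = exp (- \<i> * of_real (\<phi> t)))"

lemma small_level_exists: "\<exists>H>0. level H < 1 \<and> n * err * H \<le> 1/5"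
proof -
  define H0 where "H0 = ln (1 / (2 * r0)) / n"
  have r: "0 < r0" "r0 \<le> 1/100" using r0_pos r0_le_err err by auto
  then have "1 < 1 / (2 * r0)" by (simp add: field_simps)
  then have "0 < ln (1 / (2 * r0))" by (rule ln_gt_zero)
  then have "0 < H0" using n_pos unfolding H0_def by (intro divide_pos_pos) auto
  moreover have "level H0 = 1/2" using r n_pos by (simp add: level_def H0_def)
  moreover define H where "H = min H0 (1 / (5 * n * err))"
  ultimately have H: "0 < H" "level H < 1" using n_pos err_pos level_mono[of H H0] by auto
  have "n * err * H \<le> n * err * (1 / (5 * n * err))" using n_pos err_pos by (intro mult_left_mono) (auto simp: H_def)
  also have "\<dots> = 1/5" using n_pos err_pos by simp
  finally show ?thesis using H by blast
qed

text \<open>A primitive of \<open>\<omega>\<close> along the real axis is such a lift up to a constant, since \<open>N exp (\<i> \<psi>)\<close> is constant.\<close>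

lemma angle_fun_exists: obtains \<phi> where "angle_fun \<phi>"
proof -
  obtain H where H: "0 < H" "level H < 1" using small_level_exists by blast
  obtain W where W: "strip_orbit m \<beta> xr yr kr W (time H)" using complex_extension[OF H] .
  interpret strip_orbit m \<beta> xr yr kr W "time H" by (rule W)
  have sub: "complex_of_real t \<in> strip (time H)" for t using d by simp
  have "q holomorphic_on strip (time H)"
    unfolding q_def[abs_def] using one_plus_P W_holomorphic
    by (intro holomorphic_intros) (force simp: complex_nonpos_Reals_iff)+
  moreover have "(\<lambda>z. pw (y z)) holomorphic_on strip (time H)"
    by (intro holomorphic_pw W_holomorphic safe_M_cut(1) W_safe)
  ultimately have "\<omega> holomorphic_on strip (time H)"
    unfolding \<omega>_def[abs_def] qt_def using q_nonzero W_holomorphic by (intro holomorphic_intros) auto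
  then obtain G where G: "\<And>z. z \<in> strip (time H) \<Longrightarrow> (G has_field_derivative \<omega> z) (at z within strip (time H))"
    using holomorphic_convex_primitive'[OF convex_strip open_strip] by blast
  then have G: "\<And>z. z \<in> strip (time H) \<Longrightarrow> (G has_field_derivative \<omega> z) (at z)" by (metis at_within_open open_strip)
  define \<psi> where "\<psi> t = Re (G (of_real t))" for t
  have dG: "((\<lambda>t. G (of_real t)) has_vector_derivative of_real (speed t)) (at t)" for t
  proof -
    have "((\<lambda>t. complex_of_real t) has_vector_derivative 1) (at t)"
      by (auto intro!: derivative_eq_intros)
    from field_vector_diff_chain_at[OF this G[OF sub]] show ?thesis by (simp add: o_def omega_of_real)
  qed
  have psi: "(\<psi> has_real_derivative speed t) (at t)" for t
    using bounded_linear.has_vector_derivative[OF bounded_linear_Re dG[of t]]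
    by (simp add: \<psi>_def[abs_def] has_real_derivative_iff_has_vector_derivative)
  have dN: "((\<lambda>t. N (of_real t)) has_vector_derivative - \<i> * of_real (speed t) * N (of_real t)) (at t)" for t
  proof -
    have "((\<lambda>t. complex_of_real t) has_vector_derivative 1) (at t)"
      by (auto intro!: derivative_eq_intros)
    from field_vector_diff_chain_at[OF this N_derivative[OF sub]] show ?thesis by (simp add: o_def omega_of_real)
  qed
  define E where "E t = N (of_real t) * exp (\<i> * of_real (\<psi> t))" for t
  have "(E has_vector_derivative 0) (at t)" for t
  proof -
    have 1: "((\<lambda>t. \<i> * complex_of_real (\<psi> t)) has_vector_derivative \<i> * of_real (speed t)) (at t)"
      by (rule has_vector_derivative_mult_right[OF has_vector_derivative_of_real[OF psi]])
    have "((\<lambda>t. exp (\<i> * complex_of_real (\<psi> t))) has_vector_derivative (\<i> * of_real (speed t)) * exp (\<i> * complex_of_real (\<psi> t))) (at t)"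
      using field_vector_diff_chain_at[OF 1 DERIV_exp] by (simp add: o_def)
    from has_vector_derivative_mult[OF dN this] show ?thesis
      unfolding E_def[abs_def] by (simp add: algebra_simps)
  qed
  then have "\<exists>c. \<forall>t. E t = c"
    by (metis UNIV_I has_vector_derivative_zero_constant convex_UNIV)
  then obtain e0 where e0: "\<And>t. E t = e0" by blast
  have "cmod e0 = 1" using e0[of 0, symmetric] N_real[of 0] by (simp add: E_def norm_mult)
  moreover from this have "e0 \<noteq> 0" by auto
  ultimately obtain \<alpha> where \<alpha>: "e0 = exp (\<i> * of_real \<alpha>)" using Arg_eq[of e0] by auto
  have "angle_fun (\<lambda>t. \<psi> t - \<alpha>)"
    unfolding angle_fun_def
  proof (intro conjI allI)
    show "((\<lambda>t. \<psi> t - \<alpha>) has_real_derivative speed t) (at t)" for t using psi by (auto intro!: derivative_eq_intros)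
    show "Complex (ur (yr t)) (xr t) = exp (- \<i> * of_real (\<psi> t - \<alpha>))" for t
    proof -
      have "N (of_real t) = e0 * exp (- (\<i> * of_real (\<psi> t)))"
        using e0[of t, symmetric] by (simp add: E_def mult.assoc flip: exp_add)
      also have "\<dots> = exp (- \<i> * of_real (\<psi> t - \<alpha>))" by (simp add: \<alpha> algebra_simps flip: exp_add)
      finally show ?thesis by (simp add: N_def u_of_real W_real complex_eq_iff)
    qed
  qed
  then show thesis by (rule that)
qed

lemma angle_strict_mono:
  assumes "angle_fun \<phi>" "s < t"
  shows "(1 - 10 * err) * (t - s) \<le> \<phi> t - \<phi> s" "\<phi> t - \<phi> s \<le> (1 + 10 * err) * (t - s)"
proof -
  obtain z where z: "\<phi> t - \<phi> s = (t - s) * speed z"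
    using MVT2[OF assms(2), of \<phi> speed] assms(1) unfolding angle_fun_def by auto
  have "1 - 10 * err \<le> speed z" "speed z \<le> 1 + 10 * err" using speed_near_1[of z] by linarith+
  then show "(1 - 10 * err) * (t - s) \<le> \<phi> t - \<phi> s" "\<phi> t - \<phi> s \<le> (1 + 10 * err) * (t - s)"
    unfolding z using assms(2) by (simp_all add: mult.commute)
qed

lemma angle_surj:
  assumes "angle_fun \<phi>" obtains t where "\<phi> t = v"
proof -
  have cont: "continuous_on A \<phi>" for A
    using assms unfolding angle_fun_def by (meson DERIV_continuous continuous_at_imp_continuous_on)
  define w where "w = 2 * \<bar>v - \<phi> 0\<bar> + 1"
  have w: "0 < w" unfolding w_def by (intro add_nonneg_pos mult_nonneg_nonneg) auto
  have e: "1/2 \<le> 1 - 10 * err" using err by simp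
  have "1/2 * w \<le> (1 - 10 * err) * w" using e w by (intro mult_right_mono) auto
  moreover have "\<bar>v - \<phi> 0\<bar> \<le> 1/2 * w" by (simp add: w_def)
  then have "v - \<phi> 0 \<le> 1/2 * w" "\<phi> 0 - v \<le> 1/2 * w" unfolding abs_le_iff by simp_all
  moreover have "(1 - 10 * err) * w \<le> \<phi> w - \<phi> 0" using angle_strict_mono(1)[OF assms, of 0 w] w by simp
  moreover have "(1 - 10 * err) * w \<le> \<phi> 0 - \<phi> (-w)" using angle_strict_mono(1)[OF assms, of "-w" 0] w by simp
  ultimately have "\<phi> (-w) \<le> v" "v \<le> \<phi> w" by linarith+
  then obtain t where "\<phi> t = v" using IVT'[of \<phi> "-w" v w] cont w by auto
  then show thesis by (rule that)
qed

text \<open>The angle is unbounded in both directions, hence takes the value \<open>0\<close>, where \<open>N = 1\<close>.\<close>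

lemma top_point: obtains Z where "xr Z = 0" "0 < yr Z"
proof -
  obtain \<phi> where \<phi>: "angle_fun \<phi>" by (rule angle_fun_exists)
  obtain Z where "\<phi> Z = 0" by (rule angle_surj[OF \<phi>])
  then have "Complex (ur (yr Z)) (xr Z) = 1" using \<phi> by (simp add: angle_fun_def)
  then have Z: "xr Z = 0" "ur (yr Z) = 1" by (auto simp: complex_eq_iff)
  have "0 < yr Z" using Z(2) P_yr(2)[of Z]
    by (smt (verit) ur_def mult_nonpos_nonneg real_sqrt_ge_zero)
  with Z(1) show thesis by (rule that)
qed

text \<open>Over a period the angle increases by a positive multiple of \<open>2 \<pi>\<close>. It is \<open>2 \<pi>\<close> exactly, because after one
full turn \<open>N\<close>, and hence the point of the curve, is repeated. The angular speed is \<open>1 + O(err)\<close>.\<close>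

lemma period_bounds:
  assumes C: "0 < C" and per: "\<And>t. xr (t + C) = xr t" "\<And>t. yr (t + C) = yr t"
    and inj: "\<And>s t. s \<in> {0..<C} \<Longrightarrow> t \<in> {0..<C} \<Longrightarrow> xr s = xr t \<Longrightarrow> yr s = yr t \<Longrightarrow> s = t"
  shows "(1 - 10 * err) * C \<le> 2 * pi" "2 * pi \<le> (1 + 10 * err) * C"
proof -
  obtain \<phi> where \<phi>: "angle_fun \<phi>" by (rule angle_fun_exists)
  have N: "Complex (ur (yr t)) (xr t) = exp (- \<i> * of_real (\<phi> t))" for t using \<phi> by (simp add: angle_fun_def)
  have e: "1/2 \<le> 1 - 10 * err" using err by simp
  have up: "0 < \<phi> t - \<phi> s" if "s < t" for s t
  proof -
    have "1/2 * (t - s) \<le> (1 - 10 * err) * (t - s)" using e that by (intro mult_right_mono) auto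
    moreover have "0 < 1/2 * (t - s)" using that by simp
    ultimately show ?thesis using angle_strict_mono(1)[OF \<phi> that] by linarith
  qed
  have "exp (- \<i> * of_real (\<phi> C)) = exp (- \<i> * of_real (\<phi> 0))" using N[of C] N[of 0] per[of 0] by simp
  then obtain j :: int where "- \<i> * of_real (\<phi> C) = - \<i> * of_real (\<phi> 0) + of_int (2 * j) * complex_of_real pi * \<i>"
    unfolding exp_eq by auto
  then have j: "\<phi> C - \<phi> 0 = 2 * pi * of_int (- j)" by (simp add: complex_eq_iff algebra_simps)
  have "0 < 2 * pi * of_int (- j)" using up[OF C] j by simp
  then have "0 < (of_int (- j) :: real)" using pi_gt_zero by (simp add: zero_less_mult_iff mult_less_0_iff)
  then have j1: "1 \<le> - j" by simp
  have "- j = 1"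
  proof (rule ccontr)
    assume "- j \<noteq> 1"
    then have "2 \<le> - j" using j1 by simp
    then have "(2::real) \<le> of_int (- j)" by (metis of_int_le_iff of_int_numeral)
    then have "2 * pi * 2 \<le> 2 * pi * of_int (- j)" by (intro mult_left_mono) auto
    then have "\<phi> 0 + 2 * pi < \<phi> C" using j pi_gt_zero by linarith
    obtain t where t: "\<phi> t = \<phi> 0 + 2 * pi" by (rule angle_surj[OF \<phi>])
    have t0: "0 < t" using up[of t 0] t pi_gt_zero by (cases t "0::real" rule: linorder_cases) auto
    have tC: "t < C" using up[of C t] t \<open>\<phi> 0 + 2 * pi < \<phi> C\<close> by (cases t C rule: linorder_cases) auto
    have "exp (- \<i> * of_real (\<phi> t)) = exp (- \<i> * of_real (\<phi> 0))"
      unfolding exp_eq t by (intro exI[of _ "-1"]) (simp add: algebra_simps)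
    then have "ur (yr t) = ur (yr 0)" "xr t = xr 0" using N[of t] N[of 0] by (metis complex.inject)+
    then have "t = 0" using inj[of t 0] t0 tC C ur_inj[OF y_le y_le] by auto
    then show False using t0 by simp
  qed
  then have "\<phi> C - \<phi> 0 = 2 * pi" using j by simp
  then show "(1 - 10 * err) * C \<le> 2 * pi" "2 * pi \<le> (1 + 10 * err) * C"
    using angle_strict_mono[OF \<phi> C] by auto
qed

end

section \<open>The zero of the curvature above the top point\<close>

context small_curve
begin

text \<open>The level on the real axis, scaled so that \<open>M y \<le> (1 + err) (1 - rlev y)\<close>; this time the error is absorbed
on the other side.\<close>

definition rlev :: "real \<Rightarrow> real" where "rlev y = a * S y / (1 + err)"

text \<open>An upper bound for the travel time along the real \<open>y\<close>-axis above the top point. There \<open>u\<^sup>2 - 1 = - Xsq y\<close>, so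
the logarithm is the inverse hyperbolic cosine of \<open>u\<close>, that is, the imaginary angle; the defect
integral accounts for the speed as in \<open>time\<close>.\<close>

definition upper :: "real \<Rightarrow> real" where
  "upper y = (1 + err) * (ln (ur y + sqrt (- Xsq y)) - defect_integral c (rlev y) / n)"

definition upper' :: "real \<Rightarrow> real" where
  "upper' y = (1 + err) * ((1 + n / 2 * P y) / sqrt (1 + P y) / sqrt (- Xsq y) - (1 - gain c (rlev y)) / y)"

lemma Xsq_strict_antimono:
  assumes "0 < s" "s < (t :: real)" shows "Xsq t < Xsq s"
proof -
  have "s\<^sup>2 < t\<^sup>2" "s ^ (m + 2) < t ^ (m + 2)" using assms by (intro power_strict_mono; simp)+
  then have "s\<^sup>2 + \<epsilon> * s ^ (m + 2) < t\<^sup>2 + \<epsilon> * t ^ (m + 2)"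
    using eps_pos by (intro add_strict_mono mult_strict_left_mono)
  moreover have "Xsq t = 1 - (t\<^sup>2 + \<epsilon> * t ^ (m + 2))" "Xsq s = 1 - (s\<^sup>2 + \<epsilon> * s ^ (m + 2))"
    by (simp_all add: Xsq_def S_def)
  ultimately show ?thesis by linarith
qed

lemma positive_y:
  assumes "0 < (y :: real)"
  shows "0 < P y" "0 < S y" "0 < rlev y" "0 < ur y"
proof -
  show P: "0 < P y" "0 < S y" using assms eps_pos by (auto simp: P_def S_def)
  show "0 < rlev y" using P a_ge_1 err_pos by (simp add: rlev_def)
  show "0 < ur y" using P assms by (simp add: ur_def)
qed

lemma DERIV_rlev: "0 < y \<Longrightarrow> (rlev has_real_derivative n * rlev y / y) (at y)"
proof -
  assume y: "0 < y"
  have "rlev = (\<lambda>y. (a * \<epsilon> / (1 + err)) * y ^ Suc (m + 1))" by (auto simp: rlev_def S_def)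
  moreover have "((\<lambda>y. (a * \<epsilon> / (1 + err)) * y ^ Suc (m + 1)) has_real_derivative
      (a * \<epsilon> / (1 + err)) * (of_nat (Suc (m + 1)) * y ^ (m + 1))) (at y)" by (rule DERIV_monomial)
  moreover have "(a * \<epsilon> / (1 + err)) * (of_nat (Suc (m + 1)) * y ^ (m + 1)) = n * rlev y / y"
  proof -
    have "rlev y = (a * \<epsilon> / (1 + err)) * y ^ (m + 1) * y" by (simp add: rlev_def S_def)
    then have "n * rlev y / y = n * ((a * \<epsilon> / (1 + err)) * y ^ (m + 1))" using y by simp
    then show ?thesis by (simp add: n_def del: power_Suc)
  qed
  ultimately show ?thesis by simp
qed

lemma DERIV_upper:
  assumes y: "0 < y" "Xsq y < 0" shows "(upper has_real_derivative upper' y) (at y)"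
proof -
  note pos = positive_y[OF y(1)]
  define X where "X = sqrt (- Xsq y)"
  define U' where "U' = (1 + n / 2 * P y) / sqrt (1 + P y)"
  have X: "0 < X" using y by (simp add: X_def)
  have dX: "((\<lambda>y. sqrt (- Xsq y)) has_real_derivative Ygrad y / X) (at y)"
    using y by (auto intro!: derivative_eq_intros DERIV_Xsq simp: X_def field_simps)
  have uU: "Ygrad y = ur y * U'" using pos by (simp add: Ygrad_def ur_def U'_def)
  have dU: "(ur has_real_derivative U') (at y)" unfolding U'_def using pos by (intro DERIV_ur) simp
  have p: "0 < ur y + sqrt (- Xsq y)" using pos(4) X unfolding X_def by linarith
  have 1: "((\<lambda>y. ln (ur y + sqrt (- Xsq y))) has_real_derivative 1 / (ur y + X) * (U' + Ygrad y / X)) (at y)"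
    using DERIV_chain2[OF DERIV_ln_divide[OF p] DERIV_add[OF dU dX]] by (simp add: X_def)
  have "U' + Ygrad y / X = U' * (ur y + X) / X" using X by (simp add: uU field_simps)
  moreover have "ur y + X \<noteq> 0" using pos X by simp
  ultimately have 2: "1 / (ur y + X) * (U' + Ygrad y / X) = U' / X" by simp
  have 3: "((\<lambda>y. defect_integral c (rlev y)) has_real_derivative defect c (rlev y) * (n * rlev y / y)) (at y)"
    by (rule DERIV_chain2[OF defect_integral_DERIV[OF c_pos pos(3)] DERIV_rlev[OF y(1)]])
  have 4: "defect c (rlev y) * (n * rlev y / y) = n * ((1 - gain c (rlev y)) / y)"
    using pos y by (simp add: defect_def)
  have "(upper has_real_derivative (1 + err) * (U' / X - n * ((1 - gain c (rlev y)) / y) / n)) (at y)"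
    unfolding upper_def[abs_def] using 1 3 unfolding 2 4
    by (intro DERIV_cmult DERIV_diff DERIV_cdivide)
  then show ?thesis using n_pos by (simp add: upper'_def U'_def X_def)
qed

text \<open>For \<open>y > 0\<close> all terms of the expansions have known signs, so the one-sided estimates remain valid up to
\<open>\<beta> y = 2\<close>, beyond the first zero of \<open>M\<close>.\<close>

lemma positive_bounds:
  assumes y: "0 < y" "\<beta> * y \<le> 2"
  shows "M y \<le> (1 + err) * (1 - rlev y)" "1 + c * rlev y \<le> Ksq y" "P y \<le> err" "M y = 0 \<Longrightarrow> 1 - err \<le> a * S y"
proof -
  note pos = positive_y[OF y(1)]
  have n3: "3 \<le> n" by (rule n_pos)
  have "P y = \<beta>\<^sup>2 * (\<beta> * y) ^ m" using norm_P[of y] pos y by simp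
  also have "\<dots> \<le> \<beta>\<^sup>2 * 2 ^ m" using y beta by (intro mult_left_mono power_mono) auto
  finally have P: "P y \<le> \<beta>\<^sup>2 * 2 ^ m" .
  have S: "S y \<le> 2 ^ (m + 2)" using norm_S[of y] pos y beta power_mono[of "\<beta> * y" 2 "m + 2"] by simp
  have n1: "1 \<le> n" "1 \<le> n ^ 3" "n\<^sup>2 \<le> n ^ 3" using n3 by (auto intro: power_increasing)
  have pw4: "(2::real) ^ m * 2 ^ (m + 2) \<le> 4 ^ (m + 4)" "(2::real) ^ m \<le> 4 ^ (m + 4)"
  proof -
    have "(2::real) ^ m * 2 ^ (m + 2) = 4 * 4 ^ m" by (simp add: power_add flip: power_mult_distrib)
    moreover have "(4::real) ^ (m + 4) = 256 * 4 ^ m" by (simp add: power_add)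
    moreover have "(1::real) \<le> 4 ^ m" by (rule one_le_power) simp
    moreover have "(2::real) ^ m \<le> 4 ^ m" by (intro power_mono) auto
    ultimately show "(2::real) ^ m * 2 ^ (m + 2) \<le> 4 ^ (m + 4)" "(2::real) ^ m \<le> 4 ^ (m + 4)" by linarith+
  qed
  have PSe: "n\<^sup>2 * (\<beta>\<^sup>2 * 2 ^ m * 2 ^ (m + 2)) \<le> err" and Pe: "n\<^sup>2 * (\<beta>\<^sup>2 * 2 ^ m) \<le> err"
  proof -
    have "n\<^sup>2 * (2 ^ m * 2 ^ (m + 2)) * \<beta>\<^sup>2 \<le> n ^ 3 * 4 ^ (m + 4) * \<beta>\<^sup>2"
      using n1 pw4 by (intro mult_mono mult_right_mono) auto
    then show "n\<^sup>2 * (\<beta>\<^sup>2 * 2 ^ m * 2 ^ (m + 2)) \<le> err" by (simp add: err_def mult_ac)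
    have "n\<^sup>2 * 2 ^ m * \<beta>\<^sup>2 \<le> n ^ 3 * 4 ^ (m + 4) * \<beta>\<^sup>2"
      using n1 pw4 by (intro mult_mono mult_right_mono) auto
    then show "n\<^sup>2 * (\<beta>\<^sup>2 * 2 ^ m) \<le> err" by (simp add: err_def mult_ac)
  qed
  have nP: "n\<^sup>2 * P y \<le> err" using Pe mult_left_mono[OF P, of "n\<^sup>2"] by simp
  have "1 * P y \<le> n\<^sup>2 * P y" using pos n1 by (intro mult_right_mono) (auto simp: power2_eq_square intro: order_trans[OF n1(1)])
  then show "P y \<le> err" using nP by simp
  have eq: "(1 + err) * rlev y = a * S y" using err_pos by (simp add: rlev_def)
  have M: "M y = 1 + n * (n - 1) / 2 * P y - a * S y - n * (n - 2) / 4 * P y * S y" using M_expand[of y] by simp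
  have "n * (n - 1) / 2 * P y \<le> n\<^sup>2 * P y"
    using pos n3 by (intro mult_right_mono) (auto simp: power2_eq_square field_simps)
  moreover have PS0: "0 \<le> n * (n - 2) / 4 * P y * S y" using pos n3 by (intro mult_nonneg_nonneg) auto
  ultimately have "M y \<le> 1 + err - a * S y" using nP M by linarith
  then show "M y \<le> (1 + err) * (1 - rlev y)" by (simp add: algebra_simps eq[symmetric])
  have "c * rlev y \<le> c * (a * S y)" using eq pos err_pos c_pos by (intro mult_left_mono) (auto simp: algebra_simps simp flip: eq)
  also have "\<dots> = (n - 1) * S y" using ca by (simp flip: mult.assoc)
  finally have "c * rlev y \<le> (n - 1) * S y" .
  moreover have "0 \<le> n\<^sup>2 / 4 * P y * S y" using pos by (intro mult_nonneg_nonneg) auto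
  moreover have "Ksq y = 1 + (n - 1) * S y + n\<^sup>2 / 4 * P y * S y" using Ksq_expand[of y] by simp
  ultimately show "1 + c * rlev y \<le> Ksq y" by linarith
  show "1 - err \<le> a * S y" if True: "M y = 0"
  proof -
    have "n * (n - 2) / 4 * (P y * S y) \<le> n\<^sup>2 * (\<beta>\<^sup>2 * 2 ^ m * 2 ^ (m + 2))"
      using pos n3 P S by (intro mult_mono) (auto simp: power2_eq_square field_simps)
    moreover have "0 \<le> n * (n - 1) / 2 * P y" using pos n3 by simp
    moreover have "n * (n - 2) / 4 * P y * S y = n * (n - 2) / 4 * (P y * S y)" by simp
    ultimately show ?thesis using M True PSe by linarith
  qed
qed

text \<open>The left-hand side is the modulus of the derivative of time with respect to \<open>y\<close>. It is at most
\<open>(1 + err) gain / X\<close> with \<open>X = sqrt (- Xsq y)\<close>, and the remaining inequality splits \<open>u' / X\<close> into the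
parts with weights \<open>gain\<close> and \<open>1 - gain\<close>, using \<open>u' \<ge> 1\<close> for the first and \<open>X \<le> u \<le> y u'\<close> for the second.\<close>

lemma slope_bound:
  assumes y: "0 < y" "\<beta> * y \<le> 2" "Xsq y < 0" "0 < M y"
  shows "1 / (sqrt (- Xsq y) * sqrt (Ksq y) * M y powr (-2/3)) \<le> upper' y"
proof -
  note pos = positive_y[OF y(1)] and bd = positive_bounds[OF y(1,2)]
  define r where "r = rlev y"
  define X where "X = sqrt (- Xsq y)"
  have X: "0 < X" using y by (simp add: X_def)
  have e: "0 < err" by (rule err_pos)
  have r: "0 < r" "r < 1"
    using bd(1) y(4) pos e by (auto simp: r_def) (smt (verit) mult_nonneg_nonpos)
  have cr: "0 < 1 + c * r" using mult_pos_pos[OF c_pos r(1)] by simp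
  have K: "1 + c * r \<le> Ksq y" using bd(2) by (simp add: r_def)
  have "M y powr (2/3) \<le> ((1 + err) * (1 - r)) powr (2/3)" using bd(1) y(4) by (intro powr_mono2) (auto simp: r_def)
  also have "\<dots> = (1 + err) powr (2/3) * (1 - r) powr (2/3)" using e r by (simp add: powr_mult)
  also have "\<dots> \<le> (1 + err) powr 1 * (1 - r) powr (2/3)" using e by (intro mult_right_mono powr_mono) auto
  finally have Mp: "M y powr (2/3) \<le> (1 + err) * (1 - r) powr (2/3)" using e by simp
  have "1 / (X * sqrt (Ksq y) * M y powr (-2/3)) = M y powr (2/3) / sqrt (Ksq y) / X"
    using y by (simp add: powr_minus field_simps)
  also have "\<dots> \<le> (1 + err) * (1 - r) powr (2/3) / sqrt (1 + c * r) / X"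
    using Mp K cr X e by (intro divide_right_mono frac_le) auto
  also have "\<dots> = (1 + err) * (gain c r / X)" using r by (simp add: gain_def max_def)
  also have "gain c r / X \<le> (1 + n / 2 * P y) / sqrt (1 + P y) / X - (1 - gain c r) / y"
  proof -
    define U' where "U' = (1 + n / 2 * P y) / sqrt (1 + P y)"
    have s: "1 \<le> sqrt (1 + P y)" "sqrt (1 + P y) * sqrt (1 + P y) = 1 + P y" using pos by auto
    have "1 + P y \<le> 1 + n / 2 * P y" using pos n_pos mult_right_mono[of 1 "n/2" "P y"] by simp
    then have Us: "sqrt (1 + P y) \<le> U'" unfolding U'_def using s by (simp add: le_divide_eq)
    have "X \<le> ur y"
    proof (rule power2_le_imp_le)
      have "(ur y)\<^sup>2 = 1 - Xsq y" using pos by (intro ur_square) simp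
      then show "X\<^sup>2 \<le> (ur y)\<^sup>2" using y(3) by (simp add: X_def)
    qed (use pos in simp)
    also have "ur y \<le> y * U'" unfolding ur_def using Us y by (intro mult_left_mono) auto
    finally have "1 / y \<le> U' / X" using y X by (simp add: field_simps)
    moreover have "gain c r \<le> 1" using gain_le_1[OF c_pos] r by simp
    ultimately have "(1 - gain c r) * (1 / y) \<le> (1 - gain c r) * (U' / X)" by (intro mult_left_mono) auto
    moreover have "1 \<le> U'" using s(1) Us by linarith
    then have "1 / X \<le> U' / X" using X by (intro divide_right_mono) auto
    then have "gain c r * (1 / X) \<le> gain c r * (U' / X)"
      by (rule mult_left_mono) (use gain_nonneg[OF c_pos, of r] r in simp)
    moreover have "gain c r * (U' / X) + (1 - gain c r) * (U' / X) = U' / X" by (simp add: algebra_simps flip: add_divide_distrib)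
    ultimately show ?thesis unfolding U'_def[symmetric] by simp
  qed
  finally show ?thesis using e by (simp add: upper'_def X_def r_def)
qed

text \<open>At \<open>y = 2 / \<beta>\<close> the leading term \<open>a S\<close> is at least \<open>4\<close>, which makes \<open>M\<close> negative.\<close>

lemma first_zero:
  assumes y0: "0 < y0" "y0 < 2 / \<beta>" "0 < M y0"
  obtains y1 where "y0 < y1" "y1 \<le> 2 / \<beta>" "M y1 = 0" "\<And>y. y0 \<le> y \<Longrightarrow> y < y1 \<Longrightarrow> 0 < M y"
proof -
  define b where "b = 2 / \<beta>"
  have b: "0 < b" "\<beta> * b \<le> 2" using beta by (auto simp: b_def)
  have cont: "continuous_on A (M :: real \<Rightarrow> real)" for A by (intro continuous_intros)
  have Sb: "S b = 2 ^ (m + 2)" using norm_S[of b] positive_y[OF b(1)] b beta by (simp add: b_def)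
  have "1 + err < a * S b"
  proof -
    have "(1::real) \<le> 2 ^ m" by (rule one_le_power) simp
    then have "4 \<le> S b" by (simp add: Sb power_add)
    then have "1 * 4 \<le> a * S b" using a_ge_1 by (intro mult_mono) auto
    then show ?thesis using err by simp
  qed
  moreover have "(1 + err) * rlev b = a * S b" using err_pos by (simp add: rlev_def)
  ultimately have Mb: "M b < 0" using positive_bounds(1)[OF b] by (simp add: algebra_simps)
  have y0b: "y0 \<le> b" using y0 by (simp add: b_def)
  define Z where "Z = {y0..b} \<inter> M -` {0}"
  have "\<exists>x\<ge>y0. x \<le> b \<and> M x = 0" by (rule IVT2') (use Mb y0 y0b cont in auto)
  then have ne: "Z \<noteq> {}" by (auto simp: Z_def)
  have "closed Z" unfolding Z_def by (intro continuous_closed_preimage cont) auto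
  then have "compact Z" unfolding Z_def by (metis bounded_Int bounded_closed_interval cbox_interval compact_eq_bounded_closed)
  then obtain y1 where y1: "y1 \<in> Z" "\<And>y. y \<in> Z \<Longrightarrow> y1 \<le> y" using compact_attains_inf[OF _ ne] by metis
  have "0 < M y" if "y0 \<le> y" "y < y1" for y
  proof (rule ccontr)
    assume "\<not> 0 < M y"
    then have "\<exists>x\<ge>y0. x \<le> y \<and> M x = 0" by (intro IVT2') (use that y0 cont in auto)
    then obtain x where "y0 \<le> x" "x \<le> y" "M x = 0" by blast
    then have "x \<in> Z" using that y1 by (auto simp: Z_def)
    then show False using y1(2)[of x] \<open>x \<le> y\<close> that by simp
  qed
  moreover have "y0 < y1" using y1(1) y0(3) by (cases "y1 = y0") (auto simp: Z_def)
  ultimately show thesis using y1(1) by (intro that[of y1]) (auto simp: Z_def b_def)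
qed

end

context strip_orbit
begin

text \<open>The idea is to invert the orbit: near \<open>z0\<close> the map \<open>z \<mapsto> y z\<close> has the inverse \<open>T\<close>, a primitive of
\<open>1 / (x k M powr (- 2/3))\<close>, and this primitive makes sense along the whole real segment above \<open>y0\<close>, although
the orbit itself is known only near the real axis. The curvature at time \<open>T y\<close> equals
\<open>M y / k\<^sup>3\<close> near \<open>y0\<close>, hence along the segment by the identity theorem, as long as \<open>T\<close> stays in the
domain of \<open>F\<close>. The length of the path of \<open>T\<close> is controlled by \<open>upper\<close>.\<close>

lemma y_inverse_path:
  assumes z0: "z0 \<in> strip d" "y z0 = of_real y0" and y0: "0 < y0" "Xsq y0 < 0" "0 < M y0"
    and k: "\<And>z. z \<in> strip d \<Longrightarrow> 0 < Re (k z)"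
    and y1: "y0 < y1" "y1 \<le> 2 / \<beta>" "\<And>y. y0 \<le> y \<Longrightarrow> y < y1 \<Longrightarrow> 0 < M y"
    and F: "F holomorphic_on strip d'" "d \<le> d'" "\<And>z. z \<in> strip d \<Longrightarrow> F z = M (y z) / k z ^ 3"
    and room: "\<bar>Im z0\<bar> + (upper y1 - upper y0) < d'" and y2: "y0 \<le> y2" "y2 < y1"
  shows "\<exists>\<zeta>\<in>cball z0 (upper y1 - upper y0). F \<zeta> = of_real (M y2 / sqrt (Ksq y2) ^ 3)"
proof -
  have Xneg: "Xsq t < 0" if "y0 \<le> t" for t
    using Xsq_strict_antimono[OF y0(1), of t] that y0(2) by (cases "t = y0") auto
  have bt: "\<beta> * t \<le> 2" if "t \<le> y1" for t
    using mult_left_mono[of t "2 / \<beta>" \<beta>] that y1(2) beta by simp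
  have Kpos: "0 < Ksq t" if "y0 \<le> t" "t \<le> y1" for t
    using positive_bounds(2)[of t] positive_y(3)[of t] mult_pos_pos[OF c_pos, of "rlev t"] bt[OF that(2)] that y0 by auto
  define O2 where "O2 = {w. 0 < Re (M w)} \<inter> {w. 0 < Re (Ksq w)} \<inter> {w. 0 < Re (- Xsq w)}"
  have oO: "open O2" unfolding O2_def by (intro open_Int open_Collect_less continuous_intros)
  have segO: "of_real ` {y0..y2} \<subseteq> O2"
    using Xneg Kpos y1(3) y2 by (auto simp: O2_def M_of_real Ksq_of_real Xsq_of_real)
  obtain V where V: "open V" "convex V" "of_real ` {y0..y2} \<subseteq> V" "V \<subseteq> O2"
    using real_segment_convex_neighbourhood[OF oO segO y2(1)] by metis
  define X0 where "X0 = sqrt (- Xsq y0)"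
  have X0: "0 < X0" using y0 by (simp add: X0_def)
  have "(x z0)\<^sup>2 = (\<i> * of_real X0)\<^sup>2"
    using y0(2) by (simp add: invariants(1)[OF z0(1)] z0(2) Xsq_of_real power_mult_distrib X0_def flip: of_real_power)
  then have "x z0 = \<i> * of_real X0 \<or> x z0 = - (\<i> * of_real X0)" unfolding power2_eq_iff .
  \<comment> \<open>\<open>x\<close> is purely imaginary over real \<open>y\<close> above the top point; \<open>\<sigma>\<close> fixes the branch of the square root\<close>
  then obtain \<sigma> :: real where \<sigma>: "\<sigma> * \<sigma> = 1" "x z0 = of_real \<sigma> * \<i> * of_real X0"
    by (elim disjE) (rule that[of 1], simp, simp, rule that[of "-1"], simp, simp)
  define xs where "xs w = of_real \<sigma> * \<i> * csqrt (- Xsq w)" for w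
  define g where "g w = 1 / (xs w * csqrt (Ksq w) * pw w)" for w
  have cutO: "M w \<notin> \<real>\<^sub>\<le>\<^sub>0" "Ksq w \<notin> \<real>\<^sub>\<le>\<^sub>0" "- Xsq w \<notin> \<real>\<^sub>\<le>\<^sub>0" "Ksq w \<noteq> 0" "Xsq w \<noteq> 0" if "w \<in> V" for w
    using that V(4) by (auto simp: O2_def complex_nonpos_Reals_iff)
  have s0: "\<sigma> \<noteq> 0" using \<sigma> by auto
  have holpw: "pw holomorphic_on V" using cutO by (intro holomorphic_pw[of "\<lambda>w. w"]) (auto intro: holomorphic_intros)
  have "g holomorphic_on V"
    unfolding g_def[abs_def] xs_def using cutO s0
    by (intro holomorphic_intros holpw holomorphic_on_polys(2,5)[of "\<lambda>w. w"]) (auto simp: pw_def)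
  then obtain Z where Z: "\<And>w. w \<in> V \<Longrightarrow> (Z has_field_derivative g w) (at w within V)"
    using holomorphic_convex_primitive'[OF V(2,1)] by blast
  define T where "T w = Z w - Z (of_real y0) + z0" for w
  have T: "(T has_field_derivative g w) (at w)" if "w \<in> V" for w
    using Z[OF that] at_within_open[OF that V(1)] by (auto simp: T_def[abs_def] intro!: derivative_eq_intros)
  have T0: "T (of_real y0) = z0" by (simp add: T_def)
  have up: "upper s \<le> upper t" if "y0 \<le> s" "s \<le> t" "t \<le> y1" for s t
  proof (cases "s = t")
    case False
    have "\<exists>z>s. z < t \<and> upper t - upper s = (t - s) * upper' z"
      by (rule MVT2) (use that False y0 Xneg in \<open>auto intro!: DERIV_upper\<close>)
    then obtain z where z: "s < z" "z < t" "upper t - upper s = (t - s) * upper' z" by blast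
    have "0 \<le> 1 / (sqrt (- Xsq z) * sqrt (Ksq z) * M z powr (-2/3))"
      using Xneg[of z] Kpos[of z] z that by (intro divide_nonneg_nonneg mult_nonneg_nonneg) auto
    also have "\<dots> \<le> upper' z" by (rule slope_bound) (use z that y0 bt Xneg y1(3) in auto)
    finally show ?thesis using z that by (smt (verit) mult_nonneg_nonneg)
  qed simp
  have Tb: "cmod (T (of_real t) - z0) \<le> upper y1 - upper y0" if t: "t \<in> {y0..y2}" for t
  proof -
    have "cmod (T (of_real t) - T (of_real y0)) \<le> upper t - upper y0"
    proof (cases "t = y0")
      case False
      have dT: "((\<lambda>t. T (of_real t)) has_vector_derivative g (of_real s)) (at s)" if "s \<in> {y0..y2}" for s
      proof -
        have "((\<lambda>t. complex_of_real t) has_vector_derivative 1) (at s)" by (auto intro!: derivative_eq_intros)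
        from field_vector_diff_chain_at[OF this T] V(3) that show ?thesis by (force simp: o_def)
      qed
      have du: "(upper has_vector_derivative upper' s) (at s)" if "s \<in> {y0..y2}" for s
        using DERIV_upper[of s] Xneg[of s] that y0 by (auto simp: has_real_derivative_iff_has_vector_derivative)
      show ?thesis
      proof (rule differentiable_bound_general[where f' = "\<lambda>s. g (of_real s)" and \<phi>' = upper'])
        show "y0 < t" using t False by auto
        show "continuous_on {y0..t} (\<lambda>t. T (of_real t))"
          by (intro continuous_at_imp_continuous_on ballI has_vector_derivative_continuous[OF dT]) (use t in auto)
        show "continuous_on {y0..t} upper"
          by (intro continuous_at_imp_continuous_on ballI has_vector_derivative_continuous[OF du]) (use t in auto)
        fix s assume s: "y0 < s" "s < t"
        show "((\<lambda>t. T (of_real t)) has_vector_derivative g (of_real s)) (at s)" using dT s t by auto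
        show "(upper has_vector_derivative upper' s) (at s)" using du s t by auto
        have st: "Xsq s < 0" "0 < Ksq s" "0 < M s" using Xneg[of s] Kpos[of s] y1(3)[of s] s t y2 by auto
        have s1: "\<bar>\<sigma>\<bar> = 1" using \<sigma>(1) by (metis abs_mult_self_eq abs_1 abs_square_eq_1 power2_eq_square)
        have "cmod (g (of_real s)) = 1 / (sqrt (- Xsq s) * sqrt (Ksq s) * M s powr (-2/3))"
          using st s1 by (simp add: g_def xs_def norm_divide norm_mult Xsq_of_real Ksq_of_real pw_of_real)
        also have "\<dots> \<le> upper' s" by (rule slope_bound) (use s t y2 y0 bt st in auto)
        finally show "norm (g (of_real s)) \<le> upper' s" .
      qed
    qed simp
    also have "\<dots> \<le> upper y1 - upper y0" using up[of t y1] t y2 by simp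
    finally show ?thesis by (simp add: T0)
  qed
  have Timg: "T (of_real t) \<in> strip d'" if "t \<in> {y0..y2}" for t
  proof -
    have "\<bar>Im (T (of_real t) - z0)\<bar> \<le> upper y1 - upper y0" using Tb[OF that] abs_Im_le_cmod order_trans by blast
    then show ?thesis using room by (simp add: strip_def)
  qed
  have contT: "continuous_on V T" using T by (meson DERIV_continuous continuous_at_imp_continuous_on)
  have oV': "open (V \<inter> T -` strip d')" by (rule continuous_open_preimage[OF contT V(1) open_strip])
  have segV': "of_real ` {y0..y2} \<subseteq> V \<inter> T -` strip d'" using V(3) Timg by auto
  obtain V1 where V1: "open V1" "convex V1" "of_real ` {y0..y2} \<subseteq> V1" "V1 \<subseteq> V \<inter> T -` strip d'"
    using real_segment_convex_neighbourhood[OF oV' segV' y2(1)] by metis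
  have cW: "continuous_on (strip d) (W j)" for j using W_holomorphic by (rule holomorphic_on_imp_continuous_on)
  define B where "B = (strip d \<inter> y -` V1) \<inter> (strip d \<inter> (\<lambda>z. Re (x z * (- \<i> * of_real \<sigma>))) -` {0<..})"
  have "open B" unfolding B_def
    by (intro open_Int continuous_open_preimage cW V1(1) continuous_intros open_strip open_greaterThan)
  moreover have "z0 \<in> B"
  proof -
    have "x z0 * (- \<i> * of_real \<sigma>) = of_real (\<sigma> * \<sigma> * X0)" unfolding \<sigma>(2) by (simp add: mult_ac)
    then have "0 < Re (x z0 * (- \<i> * of_real \<sigma>))" using X0 by (simp only: Re_complex_of_real \<sigma>(1))
    then show ?thesis unfolding B_def using z0 V1(3) y2 by auto
  qed
  ultimately obtain r where r: "r > 0" "ball z0 r \<subseteq> B" by (meson openE)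
  have Bd: "z \<in> strip d" "y z \<in> V1" "0 < Re (x z * (- \<i> * of_real \<sigma>))" if "z \<in> ball z0 r" for z
    using r(2) that by (auto simp: B_def)
  \<comment> \<open>near \<open>z0\<close> the chosen branches are the actual values along the orbit, so \<open>T\<close> inverts \<open>y\<close>\<close>
  have xsx: "xs (y z) = x z" "csqrt (Ksq (y z)) = k z" if "z \<in> ball z0 r" for z
  proof -
    note b = Bd[OF that]
    have s2: "complex_of_real \<sigma> * of_real \<sigma> = 1" using \<sigma>(1) by (simp flip: of_real_mult)
    have "csqrt (- Xsq (y z)) = x z * (- \<i> * of_real \<sigma>)"
    proof (rule csqrt_unique)
      have "(x z * (- \<i> * of_real \<sigma>))\<^sup>2 = (x z)\<^sup>2 * (of_real \<sigma> * of_real \<sigma>) * (\<i> * \<i>)"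
        by (simp add: power2_eq_square mult_ac)
      then show "(x z * (- \<i> * of_real \<sigma>))\<^sup>2 = - Xsq (y z)" by (simp add: s2 invariants(1)[OF b(1)])
    qed (use b in simp)
    then have "xs (y z) = (of_real \<sigma> * of_real \<sigma>) * (- (\<i> * \<i>)) * x z" by (simp add: xs_def mult_ac)
    then show "xs (y z) = x z" by (simp add: s2)
    show "csqrt (Ksq (y z)) = k z" by (rule csqrt_unique) (use invariants(2)[OF b(1)] k[OF b(1)] in auto)
  qed
  have Tinv: "T (y z) = z" if z: "z \<in> ball z0 r" for z
  proof -
    have D: "((\<lambda>z. T (y z) - z) has_field_derivative 0) (at w within ball z0 r)" if w: "w \<in> ball z0 r" for w
    proof -
      note b = Bd[OF w]
      have yV: "y w \<in> V" using b V1 by auto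
      have nz: "x w \<noteq> 0" "k w \<noteq> 0" "pw (y w) \<noteq> 0" using b(3) k[OF b(1)] by (auto simp: pw_def)
      have "((\<lambda>z. T (y z)) has_field_derivative g (y w) * (x w * k w * pw (y w))) (at w)"
        using DERIV_chain2[OF T[OF yV] W[OF b(1), of CY]] by (simp add: vf_simps)
      moreover have "g (y w) * (x w * k w * pw (y w)) = 1" using nz by (simp add: g_def xsx[OF w])
      ultimately have "((\<lambda>z. T (y z) - z) has_field_derivative 1 - 1) (at w)"
        by (intro DERIV_diff DERIV_ident) simp
      then have "((\<lambda>z. T (y z) - z) has_field_derivative 0) (at w)" by simp
      then show ?thesis by (rule has_field_derivative_at_within)
    qed
    obtain c0 where "\<And>w. w \<in> ball z0 r \<Longrightarrow> T (y w) - w = c0"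
      using has_field_derivative_zero_constant[OF convex_ball D] by metis
    from this[OF z] this[of z0] show ?thesis using r(1) z0(2) T0 by simp
  qed
  have conr: "connected (ball z0 r)" "open (ball z0 r)" by auto
  have holy: "y holomorphic_on ball z0 r" using W_holomorphic Bd(1) by (meson holomorphic_on_subset subsetI)
  have "\<not> y constant_on ball z0 r"
  proof
    assume "y constant_on ball z0 r"
    then have eqc: "z = w" if "z \<in> ball z0 r" "w \<in> ball z0 r" for z w
      using Tinv that by (metis constant_on_def)
    have "z0 + of_real (r / 2) \<in> ball z0 r" using r(1) by (simp add: dist_norm norm_divide)
    from eqc[OF this, of z0] show False using r(1) by simp
  qed
  \<comment> \<open>the identity theorem needs an open set of agreement, which the open mapping theorem provides\<close>
  then have oy: "open (y ` ball z0 r)" using open_mapping_thm[OF holy conr(2) conr(1) conr(2) order_refl] by simp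
  define \<kappa> where "\<kappa> w = M w / csqrt (Ksq w) ^ 3" for w
  have "F (T (of_real y2)) = \<kappa> (of_real y2)"
  proof (rule analytic_continuation_open[of "y ` ball z0 r" V1 "\<lambda>w. F (T w)" \<kappa>])
    show "open (y ` ball z0 r)" by (rule oy)
    show "y ` ball z0 r \<noteq> {}" using r by auto
    show "connected V1" using V1 by (simp add: convex_connected)
    show "y ` ball z0 r \<subseteq> V1" using Bd by auto
    have holT: "T holomorphic_on V1"
      unfolding holomorphic_on_open[OF V1(1)] using T V1(4) by blast
    show "(\<lambda>w. F (T w)) holomorphic_on V1"
      by (rule holomorphic_on_compose_gen[OF holT F(1), unfolded o_def]) (use V1 in auto)
    have "w \<in> V1 \<Longrightarrow> Ksq w \<notin> \<real>\<^sub>\<le>\<^sub>0 \<and> Ksq w \<noteq> 0" for w using cutO V1(4) by blast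
    then show "\<kappa> holomorphic_on V1"
      unfolding \<kappa>_def[abs_def] by (intro holomorphic_intros holomorphic_on_polys(5,6)[of "\<lambda>w. w"]) auto
    show "F (T w) = \<kappa> w" if "w \<in> y ` ball z0 r" for w
    proof -
      obtain z where z: "z \<in> ball z0 r" "w = y z" using \<open>w \<in> y ` ball z0 r\<close> by blast
      then show ?thesis using Tinv[OF z(1)] F(3)[OF Bd(1)[OF z(1)]] xsx(2)[OF z(1)] by (simp add: \<kappa>_def)
    qed
    show "of_real y2 \<in> V1" using V1(3) y2 by auto
  qed (use V1 in auto)
  moreover have "\<kappa> (of_real y2) = of_real (M y2 / sqrt (Ksq y2) ^ 3)"
  proof -
    have "csqrt (of_real (Ksq y2)) = of_real (sqrt (Ksq y2))" using Kpos[of y2] y2 by (subst csqrt_of_real_nonneg) auto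
    then show ?thesis by (simp add: \<kappa>_def M_of_real Ksq_of_real)
  qed
  moreover have "T (of_real y2) \<in> cball z0 (upper y1 - upper y0)"
    using Tb[of y2] y2 by (simp add: dist_norm norm_minus_commute)
  ultimately show ?thesis by metis
qed

end

section \<open>Upper and lower bounds for the width of the strip\<close>

lemma (in strip_orbit) restrict:
  assumes "0 < d'" "d' \<le> d" shows "strip_orbit m \<beta> xr yr kr W d'"
proof
  have sub: "z \<in> strip d" if "z \<in> strip d'" for z using that assms by (simp add: strip_def)
  show "(W j has_field_derivative vf j (\<lambda>i. W i z)) (at z)" if "z \<in> strip d'" for z j
    using W sub that by blast
  show "safe (\<beta> * cmod (W CY z))" if "z \<in> strip d'" for z using W_safe sub that by blast
qed (use assms W_real in auto)

context small_curve
begin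

text \<open>At a zero of \<open>M\<close> the level is within \<open>2 err\<close> of \<open>1\<close>, which determines both \<open>y\<close> and the defect integral.\<close>

lemma upper_at_zero:
  assumes y1: "0 < y1" "\<beta> * y1 \<le> 2" "M y1 = 0" "Xsq y1 < 0"
    and D: "0 \<le> D" "\<And>r s. r \<in> {0..1} \<Longrightarrow> s \<in> {0..1} \<Longrightarrow> \<bar>defect_integral c r - defect_integral c s\<bar> \<le> D * \<bar>r - s\<bar>"
  shows "upper y1 \<le> (1 + err) * (ln 2 + (- ln \<epsilon> - ln a - defect_integral c 1) / n + err / n + err + 2 * D * err / n)"
proof -
  note pos = positive_y[OF y1(1)] and bd = positive_bounds[OF y1(1,2)]
  have e: "0 < err" "err \<le> 1/100" using err_pos err by auto
  have n0: "0 < n" using n_pos by simp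
  have "0 \<le> (1 + err) * (1 - rlev y1)" using bd(1) y1(3) by simp
  then have r1: "rlev y1 \<le> 1" using e by (simp add: zero_le_mult_iff)
  have eq: "(1 + err) * rlev y1 = a * S y1" using e by (simp add: rlev_def)
  have r2: "1 - 2 * err \<le> rlev y1"
  proof -
    have "(1 + err) * (1 - 2 * err) \<le> 1 - err" using e by (simp add: algebra_simps)
    also have "\<dots> \<le> (1 + err) * rlev y1" using bd(4)[OF y1(3)] eq by simp
    finally show ?thesis using e by simp
  qed
  have "\<bar>defect_integral c 1 - defect_integral c (rlev y1)\<bar> \<le> D * \<bar>1 - rlev y1\<bar>"
    by (rule D(2)) (use r1 pos in auto)
  also have "\<dots> \<le> D * (2 * err)" using r1 r2 D(1) by (intro mult_left_mono) auto
  finally have J: "- defect_integral c (rlev y1) / n \<le> (- defect_integral c 1 + 2 * D * err) / n"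
    using n0 by (intro divide_right_mono) auto
  have "X \<le> ur y1" if "X = sqrt (- Xsq y1)" for X
  proof (rule power2_le_imp_le)
    have "(ur y1)\<^sup>2 = 1 - Xsq y1" using pos by (intro ur_square) simp
    then show "X\<^sup>2 \<le> (ur y1)\<^sup>2" using y1(4) that by simp
  qed (use pos in simp)
  then have "ur y1 + sqrt (- Xsq y1) \<le> 2 * ur y1" by simp
  moreover have "0 < ur y1 + sqrt (- Xsq y1)" using pos y1(4) by (intro add_pos_nonneg) auto
  ultimately have "ln (ur y1 + sqrt (- Xsq y1)) \<le> ln (2 * ur y1)" by simp
  also have "\<dots> = ln 2 + (ln y1 + ln (1 + P y1) / 2)"
    using pos y1(1) by (simp add: ln_mult ur_def ln_sqrt)
  also have "ln (1 + P y1) \<le> P y1" using pos by (intro ln_add_one_self_le_self) simp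
  then have "ln 2 + (ln y1 + ln (1 + P y1) / 2) \<le> ln 2 + (ln y1 + err)" using bd(3) pos by simp
  also have "ln y1 \<le> (err - ln a - ln \<epsilon>) / n"
  proof -
    have "(1 + err) * rlev y1 \<le> (1 + err) * 1" using r1 e by (intro mult_left_mono) auto
    then have "a * (\<epsilon> * y1 ^ (m + 2)) \<le> 1 + err" using eq by (simp add: S_def)
    then have "ln (a * (\<epsilon> * y1 ^ (m + 2))) \<le> ln (1 + err)" using a_ge_1 eps_pos y1(1) e by (subst ln_le_cancel_iff) auto
    also have "\<dots> \<le> err" using e by (intro ln_add_one_self_le_self) simp
    finally have "ln a + (ln \<epsilon> + n * ln y1) \<le> err"
      using a_ge_1 eps_pos y1(1) by (simp add: ln_mult ln_realpow n_nat del: power_Suc)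
    then show ?thesis using n0 by (simp add: field_simps)
  qed
  finally have L: "ln (ur y1 + sqrt (- Xsq y1)) \<le> ln 2 + ((err - ln a - ln \<epsilon>) / n + err)" by simp
  have "upper y1 = (1 + err) * (ln (ur y1 + sqrt (- Xsq y1)) + - defect_integral c (rlev y1) / n)" by (simp add: upper_def)
  also have "\<dots> \<le> (1 + err) * ((ln 2 + ((err - ln a - ln \<epsilon>) / n + err)) + (- defect_integral c 1 + 2 * D * err) / n)"
    using L J e by (intro mult_left_mono add_mono) auto
  also have "(ln 2 + ((err - ln a - ln \<epsilon>) / n + err)) + (- defect_integral c 1 + 2 * D * err) / n =
     ln 2 + (- ln \<epsilon> - ln a - defect_integral c 1) / n + err / n + err + 2 * D * err / n"
    by (simp add: add_divide_distrib diff_divide_distrib)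
  finally show ?thesis .
qed

text \<open>The logarithm is nonnegative, and the level is at most \<open>err\<close>, which makes the defect integral negligible.\<close>

lemma upper_at_start:
  assumes y0: "0 < y0" "y0 \<le> 3" "Xsq y0 < 0"
    and D: "0 \<le> D" "\<And>r s. r \<in> {0..1} \<Longrightarrow> s \<in> {0..1} \<Longrightarrow> \<bar>defect_integral c r - defect_integral c s\<bar> \<le> D * \<bar>r - s\<bar>"
  shows "- ((1 + err) * (D * err / n)) \<le> upper y0"
proof -
  note pos = positive_y[OF y0(1)]
  have e: "0 < err" "err \<le> 1/100" using err_pos err by auto
  have n0: "0 < n" using n_pos by simp
  have "(ur y0)\<^sup>2 = 1 - Xsq y0" using pos by (intro ur_square) simp
  then have "1\<^sup>2 \<le> (ur y0)\<^sup>2" using y0 by simp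
  then have "1 \<le> ur y0" by (rule power2_le_imp_le) (use pos in simp)
  moreover have "0 \<le> sqrt (- Xsq y0)" using y0 by simp
  ultimately have "1 \<le> ur y0 + sqrt (- Xsq y0)" by linarith
  then have L: "0 \<le> ln (ur y0 + sqrt (- Xsq y0))" by (rule ln_ge_zero)
  have "\<epsilon> = \<beta>\<^sup>2 * \<beta> ^ m" by (simp add: \<epsilon>_def power2_eq_square)
  also have "\<dots> \<le> \<beta>\<^sup>2 * 1" using beta beta_small by (intro mult_left_mono power_le_one) auto
  finally have eb: "\<epsilon> \<le> \<beta>\<^sup>2" by simp
  have "y0 ^ (m + 2) \<le> 4 ^ (m + 2)" using y0 by (intro power_mono) auto
  also have "\<dots> \<le> (4::real) ^ (m + 4)" by (intro power_increasing) auto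
  finally have y4: "y0 ^ (m + 2) \<le> 4 ^ (m + 4)" .
  have "a \<le> n ^ 3"
  proof -
    have "n\<^sup>2 \<le> n ^ 3" using n_pos by (intro power_increasing) auto
    then show ?thesis using a_le zero_le_power2[of n] by linarith
  qed
  then have "a * (\<epsilon> * y0 ^ (m + 2)) \<le> n ^ 3 * (\<beta>\<^sup>2 * 4 ^ (m + 4))"
    using eb y4 a_ge_1 eps_pos y0 n0 by (intro mult_mono) auto
  then have aS: "a * S y0 \<le> err" by (simp add: S_def err_def mult_ac)
  have "rlev y0 \<le> a * S y0 / 1" unfolding rlev_def using e a_ge_1 pos by (intro divide_left_mono) auto
  then have r: "0 \<le> rlev y0" "rlev y0 \<le> err" using aS pos by auto
  have "defect_integral c (rlev y0) \<le> D * rlev y0" using D(2)[of "rlev y0" 0] r e c_pos by auto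
  also have "\<dots> \<le> D * err" using r D by (intro mult_left_mono)
  finally have "- (D * err / n) \<le> - (defect_integral c (rlev y0) / n)" using n0 by (simp add: divide_right_mono)
  then have "(1 + err) * (- (D * err / n)) \<le> (1 + err) * (ln (ur y0 + sqrt (- Xsq y0)) - defect_integral c (rlev y0) / n)"
    using L e by (intro mult_left_mono) linarith+
  then show ?thesis by (simp add: upper_def)
qed

end

context real_orbit
begin

text \<open>If \<open>d\<close> exceeded the bound by some \<open>\<delta> > 0\<close>, start at a complex time close to the top point where \<open>y\<close> is real
and slightly larger than at the top; such a time exists by the open mapping theorem. The path
to the first zero of \<open>M\<close> then stays in a compact disc inside the strip, on which \<open>\<bar>F\<bar>\<close> has a positive
minimum. But \<open>F\<close> takes the values \<open>M / k\<^sup>3\<close>, which tend to \<open>0\<close> along the path.\<close>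

lemma upper_bound:
  assumes F: "zero_free_ext kappa d F" "0 < d"
    and D: "0 \<le> D" "\<And>r s. r \<in> {0..1} \<Longrightarrow> s \<in> {0..1} \<Longrightarrow> \<bar>defect_integral c r - defect_integral c s\<bar> \<le> D * \<bar>r - s\<bar>"
  shows "d \<le> (1 + err) * (ln 2 + (- ln \<epsilon> - ln a - defect_integral c 1) / n + err / n + err + 3 * D * err / n)" (is "d \<le> ?R")
proof (rule field_le_epsilon)
  fix \<delta> :: real assume \<delta>: "0 < \<delta>"
  show "d \<le> ?R + \<delta>"
  proof (rule ccontr)
    assume neg: "\<not> d \<le> ?R + \<delta>"
    obtain H where H: "0 < H" and H1: "level H < 1" and H2: "n * err * H \<le> 1/5" using small_level_exists by blast
    obtain W where W0: "strip_orbit m \<beta> xr yr kr W (time H)" using complex_extension[OF H H1] .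
    interpret W0: strip_orbit m \<beta> xr yr kr W "time H" by (rule W0)
    define dm where "dm = min d (time H)"
    have dm: "0 < dm" "dm \<le> d" "dm \<le> time H" using F(2) W0.d by (auto simp: dm_def)
    interpret strip_orbit m \<beta> xr yr kr W dm by (rule W0.restrict[OF dm(1,3)])
    have kre: "0 < Re (k z)" if "z \<in> strip dm" for z
      by (rule Re_k_pos[OF H H1 H2 that]) (use that dm in \<open>auto simp: strip_def\<close>)
    have "zero_free_ext kappa dm (\<lambda>z. M (y z) / k z ^ 3)"
    proof (rule kappa_extension)
      show "k z \<noteq> 0" if "z \<in> strip dm" for z using kre[OF that] by auto
    qed (use dm in auto)
    from zero_free_ext_unique[OF this F(1) dm(1,2)]
    have FM: "F z = M (y z) / k z ^ 3" if "z \<in> strip dm" for z using that by simp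
    obtain Z where Z: "xr Z = 0" "0 < yr Z" by (rule top_point)
    define \<delta>' where "\<delta>' = min \<delta> dm"
    have \<delta>': "0 < \<delta>'" "\<delta>' \<le> \<delta>" "\<delta>' \<le> dm" using \<delta> dm by (auto simp: \<delta>'_def)
    let ?S = "ball (complex_of_real Z) \<delta>'"
    have SIm: "\<bar>Im z\<bar> < \<delta>'" if "z \<in> ?S" for z
      using abs_Im_le_cmod[of "of_real Z - z"] that by (simp add: dist_norm)
    have Sd: "z \<in> strip dm" if "z \<in> ?S" for z using SIm[OF that] \<delta>' by (simp add: strip_def)
    have conS: "connected ?S" "open ?S" by auto
    have holy: "y holomorphic_on ?S" using W_holomorphic Sd by (meson holomorphic_on_subset subsetI)
    have "\<not> y constant_on ?S"
    proof
      assume "y constant_on ?S"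
      then obtain v where v: "\<And>z. z \<in> ?S \<Longrightarrow> y z = v" unfolding constant_on_def by blast
      have x0: "x z = 0" if z: "z \<in> ?S" for z
      proof -
        have "(y has_field_derivative 0) (at z)"
          by (rule has_field_derivative_transform_within_open[OF DERIV_const[of v] conS(2) z]) (use v in simp)
        from DERIV_unique[OF W[OF Sd[OF z], of CY] this] have "x z * k z * pw (y z) = 0" by (simp only: vf_simps)
        then show ?thesis using kre[OF Sd[OF z]] by (auto simp: pw_def)
      qed
      have Zs: "complex_of_real Z \<in> ?S" using \<delta>' by simp
      have "(x has_field_derivative 0) (at (of_real Z))"
        by (rule has_field_derivative_transform_within_open[OF DERIV_const[of 0] conS(2) Zs]) (use x0 in simp)
      from DERIV_unique[OF W[OF Sd[OF Zs], of CX] this]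
      have "Ygrad (y (of_real Z)) * k (of_real Z) * pw (y (of_real Z)) = 0"
        by (simp only: vf_simps neg_equal_0_iff_equal)
      then have "Ygrad (y (of_real Z)) = 0" using kre[OF Sd[OF Zs]] by (auto simp: pw_def)
      then have "Ygrad (yr Z) = 0" by (simp add: W_real Ygrad_of_real)
      then have "1 + n / 2 * P (yr Z) = 0" using Z by (simp add: Ygrad_def)
      moreover have "0 < P (yr Z)" by (rule positive_y[OF Z(2)])
      ultimately show False using n_pos mult_pos_pos[of "n / 2" "P (yr Z)"] by linarith
    qed
    then have "open (y ` ?S)" using open_mapping_thm[OF holy conS(2) conS(1) conS(2) order_refl] by simp
    moreover have "complex_of_real (yr Z) \<in> y ` ?S"
      using \<delta>' by (intro image_eqI[of _ _ "of_real Z"]) (auto simp: W_real)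
    ultimately obtain \<rho> where \<rho>: "0 < \<rho>" "ball (complex_of_real (yr Z)) \<rho> \<subseteq> y ` ?S" by (meson openE)
    have oM: "open {s :: real. 0 < M s}" by (intro open_Collect_less continuous_intros)
    have "yr Z \<in> {s. 0 < M s}" using real_M_pos by simp
    then obtain \<rho>' where \<rho>': "0 < \<rho>'" "ball (yr Z) \<rho>' \<subseteq> {s. 0 < M s}" by (rule openE[OF oM])
    define h where "h = min (min \<rho> \<rho>') 1 / 2"
    have h: "0 < h" "h < \<rho>" "h < \<rho>'" "h \<le> 1" using \<rho> \<rho>' by (auto simp: h_def)
    \<comment> \<open>strictly above the top point, where \<open>Xsq\<close> is negative, but close enough for the image of \<open>y\<close> to contain it\<close>
    define y0 where "y0 = yr Z + h"
    have y0: "0 < y0" "y0 \<le> 3" using Z h y_le[of Z] by (auto simp: y0_def)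
    have "y0 \<in> ball (yr Z) \<rho>'" using h by (simp add: y0_def dist_real_def)
    then have My0: "0 < M y0" using \<rho>'(2) by blast
    have "complex_of_real y0 \<in> ball (complex_of_real (yr Z)) \<rho>"
      using h by (simp add: y0_def dist_norm)
    then obtain z0 where z0: "z0 \<in> ?S" "y z0 = of_real y0" using \<rho>(2) by (metis imageE subsetD)
    have Xy0: "Xsq y0 < 0"
      using Xsq_strict_antimono[OF Z(2), of y0] h x2[of Z] Z by (simp add: y0_def)
    have "\<beta> * y0 \<le> 1/10 * 3" using y0 beta beta_tenth by (intro mult_mono) auto
    then have y0b: "y0 < 2 / \<beta>" using beta by (simp add: field_simps)
    obtain y1 where y1: "y0 < y1" "y1 \<le> 2 / \<beta>" "M y1 = 0" "\<And>t. y0 \<le> t \<Longrightarrow> t < y1 \<Longrightarrow> 0 < M t"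
      using first_zero[OF y0(1) y0b My0] by metis
    have y1b: "0 < y1" "\<beta> * y1 \<le> 2" using y0 y1 beta by (auto simp: field_simps)
    have Xy1: "Xsq y1 < 0" using Xsq_strict_antimono[OF y0(1) y1(1)] Xy0 by simp
    define B where "B = upper y1 - upper y0"
    have "B \<le> ?R"
    proof -
      have U1: "upper y1 \<le> (1 + err) * (ln 2 + (- ln \<epsilon> - ln a - defect_integral c 1) / n + err / n + err + 2 * D * err / n)"
        by (rule upper_at_zero[OF y1b y1(3) Xy1 D])
      have U0: "- ((1 + err) * (D * err / n)) \<le> upper y0" by (rule upper_at_start[OF y0 Xy0 D])
      have "B \<le> (1 + err) * (ln 2 + (- ln \<epsilon> - ln a - defect_integral c 1) / n + err / n + err + 2 * D * err / n) + (1 + err) * (D * err / n)"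
        using add_mono[OF U1 minus_le_iff[THEN iffD1, OF U0]] by (simp only: B_def add_uminus_conv_diff)
      also have "\<dots> = (1 + err) * (ln 2 + (- ln \<epsilon> - ln a - defect_integral c 1) / n + err / n + err + (2 * D * err / n + D * err / n))"
        by (simp only: distrib_left add.assoc)
      also have "2 * D * err / n + D * err / n = 3 * D * err / n" by (simp flip: add_divide_distrib)
      finally show ?thesis .
    qed
    then have room: "\<bar>Im z0\<bar> + B < d" using neg SIm[OF z0(1)] \<delta>' by linarith
    have holF: "F holomorphic_on strip d" using F(1) by (simp add: zero_free_ext_def)
    have path: "\<exists>\<zeta>\<in>cball z0 B. F \<zeta> = of_real (M y2 / sqrt (Ksq y2) ^ 3)" if "y0 \<le> y2" "y2 < y1" for y2
      unfolding B_def
      by (rule y_inverse_path[OF Sd[OF z0(1)] z0(2) y0(1) Xy0 My0 kre y1(1,2,4) holF dm(2) FM room[unfolded B_def] that])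
    have sub: "cball z0 B \<subseteq> strip d"
    proof
      fix w assume "w \<in> cball z0 B"
      then have "\<bar>Im (w - z0)\<bar> \<le> B" using abs_Im_le_cmod[of "w - z0"] by (simp add: dist_norm norm_minus_commute)
      then show "w \<in> strip d" using room by (simp add: strip_def)
    qed
    have ne: "cball z0 B \<noteq> {}" using path[of y0] y1 by blast
    have "continuous_on (cball z0 B) (\<lambda>w. cmod (F w))"
      using holomorphic_on_imp_continuous_on[OF holomorphic_on_subset[OF holF sub]] by (intro continuous_intros)
    then obtain w0 where w0: "w0 \<in> cball z0 B" "\<And>w. w \<in> cball z0 B \<Longrightarrow> cmod (F w0) \<le> cmod (F w)"
      using continuous_attains_inf[OF compact_cball ne] by metis
    define \<mu> where "\<mu> = cmod (F w0)"
    have \<mu>: "0 < \<mu>" using F(1) sub w0(1) by (auto simp: \<mu>_def zero_free_ext_def)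
    have oM': "open {s :: real. M s < \<mu>}" by (intro open_Collect_less continuous_intros)
    have "y1 \<in> {s. M s < \<mu>}" using y1(3) \<mu> by simp
    then obtain \<tau> where \<tau>: "0 < \<tau>" "ball y1 \<tau> \<subseteq> {s. M s < \<mu>}" by (rule openE[OF oM'])
    define y2 where "y2 = max y0 (y1 - \<tau> / 2)"
    have y2: "y0 \<le> y2" "y2 < y1" using y1 \<tau> by (auto simp: y2_def)
    have "y2 \<in> ball y1 \<tau>" using \<tau>(1) y2 by (auto simp: y2_def dist_real_def)
    then have "M y2 < \<mu>" using \<tau>(2) by blast
    obtain \<zeta> where \<zeta>: "\<zeta> \<in> cball z0 B" "F \<zeta> = of_real (M y2 / sqrt (Ksq y2) ^ 3)" using path[OF y2] by blast
    have M2: "0 < M y2" by (rule y1(4)[OF y2])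
    have "\<beta> * y2 \<le> \<beta> * y1" using y2 beta by (intro mult_left_mono) auto
    then have "\<beta> * y2 \<le> 2" using y1b(2) by linarith
    then have "1 + c * rlev y2 \<le> Ksq y2" using y0 y2 by (intro positive_bounds(2)) auto
    moreover have "0 < c * rlev y2" using c_pos positive_y(3)[of y2] y0 y2 by simp
    ultimately have K1: "1 \<le> sqrt (Ksq y2) ^ 3" by (intro one_le_power) simp
    have "cmod (F \<zeta>) = M y2 / sqrt (Ksq y2) ^ 3" unfolding \<zeta>(2) using M2 K1 by (simp only: norm_of_real) simp
    also have "\<dots> \<le> M y2 / 1" using M2 by (intro frac_le K1) auto
    finally have "cmod (F \<zeta>) < \<mu>" using \<open>M y2 < \<mu>\<close> by simp
    then show False using w0(2)[OF \<zeta>(1)] by (simp add: \<mu>_def)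
  qed
qed

text \<open>The imaginary angle at which the level reaches \<open>1\<close>.\<close>

definition "level_max = - ln r0 / n"

text \<open>All strips of half-width \<open>time H\<close> with \<open>H\<close> below \<open>level_max\<close> carry a zero-free extension; let \<open>H\<close> increase to
\<open>level_max\<close>.\<close>

lemma lower_bound:
  assumes "n * err * level_max \<le> 1/5"
    and bd: "\<And>d F. zero_free_ext kappa d F \<Longrightarrow> 0 < d \<Longrightarrow> d \<le> \<delta>"
  shows "(ln 2 + (- ln \<epsilon> - ln a - defect_integral c 1) / n - 2 * err / n) / (1 + 5 * err) \<le> \<delta>"
proof -
  have e: "0 < err" "err \<le> 1/100" using err_pos err by auto
  have n0: "0 < n" using n_pos by simp
  have r0: "0 < r0" "r0 < 1" using r0_pos r0_le_err e by auto
  have "ln r0 < 0" using r0 by (intro ln_less_zero)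
  then have Hm: "0 < level_max" using n0 by (simp add: level_max_def divide_neg_pos)
  have lvl: "level level_max = 1" using r0 n0 by (simp add: level_def level_max_def exp_minus)
  have below: "time H \<le> \<delta>" if H: "0 < H" "H < level_max" for H
  proof -
    have "level H < level level_max" using H r0 n0 by (simp add: level_def)
    then have l: "level H < 1" using lvl by simp
    have "n * err * H \<le> n * err * level_max" using H n0 e by (intro mult_left_mono) auto
    then obtain F where "zero_free_ext kappa (time H) F" using kappa_zero_free[OF H(1) l] assms(1) by auto
    moreover obtain W where "strip_orbit m \<beta> xr yr kr W (time H)" using complex_extension[OF H(1) l] .
    then have "0 < time H" by (rule strip_orbit.d)
    ultimately show ?thesis by (rule bd)
  qed
  have "time level_max \<le> \<delta>"
  proof (rule tendsto_upperbound)
    show "(time \<longlongrightarrow> time level_max) (at_left level_max)"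
      using time_DERIV[of level_max, THEN DERIV_isCont] by (simp add: isCont_def filterlim_at_split)
    show "\<forall>\<^sub>F H in at_left level_max. time H \<le> \<delta>"
      using eventually_at_left_real[OF Hm] by eventually_elim (use below in auto)
  qed simp
  moreover have "(ln 2 + (- ln \<epsilon> - ln a - defect_integral c 1) / n - 2 * err / n) / (1 + 5 * err) \<le> time level_max"
    unfolding time_def lvl
  proof (rule divide_right_mono)
    have l1: "- 2 * err \<le> ln (1 - err)"
    proof -
      have "exp (- 2 * err) \<le> 1 - err"
      proof -
        have "exp (- 2 * err) = 1 / exp (2 * err)" by (simp add: exp_minus divide_inverse)
        also have "\<dots> \<le> 1 / (1 + 2 * err)" using e exp_ge_add_one_self[of "2 * err"] by (intro divide_left_mono) auto
        also have "\<dots> \<le> 1 - err"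
        proof -
          have "err * err \<le> err * (1/100)" using e by (intro mult_left_mono) auto
          moreover have "(1 - err) * (1 + 2 * err) = 1 + err - 2 * (err * err)" by (simp add: algebra_simps)
          ultimately have "1 \<le> (1 - err) * (1 + 2 * err)" using e by linarith
          then show ?thesis using e by (simp only: divide_le_eq) simp
        qed
        finally show ?thesis .
      qed
      then show ?thesis using e by (simp add: ln_ge_iff)
    qed
    have "ln r0 = ln a + ln \<epsilon> - n * ln 2 - ln (1 - err)"
      using a_ge_1 eps_pos e by (simp add: r0_def ln_div ln_mult ln_realpow n_nat del: power_Suc)
    then have "level_max = (- ln a - ln \<epsilon> + n * ln 2 + ln (1 - err)) / n" by (simp add: level_max_def)
    also have "\<dots> = ln 2 + (- ln \<epsilon> - ln a + ln (1 - err)) / n" using n0 by (simp add: field_simps)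
    also have "\<dots> \<ge> ln 2 + (- ln \<epsilon> - ln a + (- 2 * err)) / n"
      using l1 n0 by (intro add_left_mono divide_right_mono) auto
    finally have 1: "ln 2 + (- ln \<epsilon> - ln a + (- 2 * err)) / n \<le> level_max" .
    have 2: "(defect_integral c 1 - defect_integral c r0) / n \<le> defect_integral c 1 / n"
      using defect_integral_nonneg[OF c_pos, of r0] r0 n0 by (intro divide_right_mono) auto
    have "ln 2 + (- ln \<epsilon> - ln a - defect_integral c 1) / n - 2 * err / n =
       ln 2 + (- ln \<epsilon> - ln a + (- 2 * err)) / n - defect_integral c 1 / n"
      by (simp add: add_divide_distrib diff_divide_distrib)
    then show "ln 2 + (- ln \<epsilon> - ln a - defect_integral c 1) / n - 2 * err / n
       \<le> level_max - (defect_integral c 1 - defect_integral c r0) / n" using 1 2 by linarith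
  qed (use e in simp)
  ultimately show ?thesis by linarith
qed

end

section \<open>The arc-length parametrization\<close>

lemma real_analytic_derivative:
  assumes "real_analytic f"
  shows "\<exists>f'. real_analytic f' \<and> (\<forall>s. (f has_real_derivative f' s) (at s))"
proof -
  obtain g where g: "g analytic_on \<real>" "\<And>t. g (complex_of_real t) = complex_of_real (f t)"
    using assms unfolding real_analytic_def by blast
  have d: "((\<lambda>t. g (of_real t)) has_vector_derivative deriv g (of_real s)) (at s)" for s
  proof -
    have "g analytic_on {complex_of_real s}" using g(1) by (rule analytic_on_subset) auto
    then have "(g has_field_derivative deriv g (of_real s)) (at (of_real s))"
      using analytic_on_imp_differentiable_at field_differentiable_derivI by blast
    moreover have "((\<lambda>t. complex_of_real t) has_vector_derivative 1) (at s)" by (auto intro!: derivative_eq_intros)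
    ultimately show ?thesis using field_vector_diff_chain_at[of complex_of_real 1 s g] by (simp add: o_def)
  qed
  have R: "(f has_real_derivative Re (deriv g (of_real s))) (at s)" for s
    using bounded_linear.has_vector_derivative[OF bounded_linear_Re d[of s]]
    by (simp add: g(2) has_real_derivative_iff_has_vector_derivative)
  have "((\<lambda>t::real. 0::real) has_vector_derivative Im (deriv g (of_real s))) (at s)" for s
    using bounded_linear.has_vector_derivative[OF bounded_linear_Im d[of s]] by (simp add: g(2))
  then have "Im (deriv g (of_real s)) = 0" for s
    using vector_derivative_unique_at[of "\<lambda>t::real. 0::real" _ s 0] by fastforce
  then have "deriv g (of_real s) = of_real (Re (deriv g (of_real s)))" for s by (simp add: complex_eq_iff)
  moreover have "deriv g analytic_on \<real>" using g(1) by (rule analytic_deriv)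
  ultimately have "real_analytic (\<lambda>s. Re (deriv g (of_real s)))" unfolding real_analytic_def by blast
  then show ?thesis using R by blast
qed

locale arclength_curve = small_curve +
  fixes \<gamma> :: "real \<Rightarrow> real \<times> real" and L :: real
  assumes arc: "arclength_param (Q (m + 2) \<epsilon>) L \<gamma>"
begin

definition "X s = fst (\<gamma> s)"
definition "Y s = snd (\<gamma> s)"

lemma L_pos: "0 < L" and gamma_periodic: "\<gamma> (s + L) = \<gamma> s" and gamma_inj: "inj_on \<gamma> {0..<L}"
  and unit_speed: "norm (vector_derivative \<gamma> (at s)) = 1"
  using arc by (auto simp: arclength_param_def)

lemma gamma_XY: "\<gamma> s = (X s, Y s)" by (simp add: X_def Y_def)

lemma curve_equation: "(X s)\<^sup>2 = Xsq (Y s)"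
proof -
  have "\<gamma> s \<in> Q (m + 2) \<epsilon>" using arc by (auto simp: arclength_param_def)
  moreover have "Q (m + 2) \<epsilon> \<subseteq> algebraic_curve (m + 2) \<epsilon>"
    unfolding Q_def using connected_component_subset by auto
  ultimately have "\<gamma> s \<in> algebraic_curve (m + 2) \<epsilon>" by blast
  then show ?thesis by (simp add: gamma_XY algebraic_curve_def Xsq_def S_def)
qed

text \<open>For even \<open>n\<close> the defining equation bounds \<open>y\<close> by \<open>1\<close>. For odd \<open>n\<close> the algebraic curve has points far away,
and the bound comes from the component being close to the circle.\<close>

lemma Y_le: "\<bar>Y s\<bar> \<le> 2"
proof (cases "even (m + 2)")
  case True
  then have "0 \<le> Y s ^ (m + 2)" by (rule zero_le_even_power)
  then have "0 \<le> S (Y s)" using eps_pos by (simp add: S_def del: power_Suc add_2_eq_Suc')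
  then have "(Y s)\<^sup>2 \<le> 1" using curve_equation[of s] zero_le_power2[of "X s"] unfolding Xsq_def by linarith
  then show ?thesis using abs_square_le_1[of "Y s"] by simp
next
  case False
  have e2: "\<epsilon> * 2 ^ (m + 2) \<le> 1"
  proof -
    have "\<epsilon> * 2 ^ (m + 2) = (\<beta> * 2) ^ (m + 2)" by (simp add: \<epsilon>_def power_mult_distrib)
    also have "\<dots> \<le> 1" using beta beta_tenth by (intro power_le_one) auto
    finally show ?thesis .
  qed
  have "\<gamma> s \<in> Q (m + 2) \<epsilon>" using arc by (auto simp: arclength_param_def)
  then obtain q where q: "q \<in> sphere 0 1" "dist (\<gamma> s) q \<le> \<epsilon> * 2 ^ (m + 2)"
    using Q_near_circle[OF False eps_pos] e2 by fastforce
  have "norm (\<gamma> s) \<le> norm q + dist (\<gamma> s) q" by (metis dist_0_norm dist_commute dist_triangle2 add.commute)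
  then have "norm (\<gamma> s) \<le> 2" using q e2 by simp
  moreover have "\<bar>Y s\<bar> \<le> norm (\<gamma> s)" using norm_snd_le[where x = "X s" and y = "Y s"] by (simp add: gamma_XY)
  ultimately show ?thesis by simp
qed

lemma small_y: 
  assumes "\<bar>y\<bar> \<le> 2" shows "\<bar>M y - 1\<bar> \<le> err" "\<bar>Ksq y - 1\<bar> \<le> 2 * err"
proof -
  have n3: "3 \<le> n" by (rule n_pos)
  have b: "\<beta> * norm y \<le> 2 * \<beta>" using assms beta by simp
  then have b1: "\<beta> * norm y \<le> 1" using beta_tenth by simp
  define s where "s = (\<beta> * norm y) ^ (m + 2)"
  have "s \<le> (2 * \<beta>) ^ (m + 2)" unfolding s_def using b beta by (intro power_mono) auto
  also have "\<dots> = \<beta>\<^sup>2 * (2 ^ (m + 2) * \<beta> ^ m)" by (simp add: power_mult_distrib power_add power2_eq_square)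
  also have "\<dots> \<le> \<beta>\<^sup>2 * (2 ^ (m + 2) * 1)" using beta beta_small by (intro mult_left_mono power_le_one) auto
  finally have s: "s \<le> \<beta>\<^sup>2 * 2 ^ (m + 2)" by simp
  have s0: "0 \<le> s" using beta by (simp add: s_def)
  have "a * s \<le> n\<^sup>2 / 2 * (\<beta>\<^sup>2 * 2 ^ (m + 2))" using a_le s s0 a_ge_1 by (intro mult_mono) auto
  moreover have "n\<^sup>2 * 2 ^ (m + 2) * \<beta>\<^sup>2 + 2 * n\<^sup>2 * \<beta>\<^sup>2 \<le> n\<^sup>2 * (n * 2 ^ (m + 4) + 2) * \<beta>\<^sup>2"
  proof -
    have "1 * (2::real) ^ (m + 2) \<le> n * 2 ^ (m + 4)" using n3 by (intro mult_mono power_increasing) auto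
    then have "n\<^sup>2 * \<beta>\<^sup>2 * (2 ^ (m + 2) + 2) \<le> n\<^sup>2 * \<beta>\<^sup>2 * (n * 2 ^ (m + 4) + 2)" by (intro mult_left_mono) auto
    then show ?thesis by (simp add: algebra_simps)
  qed
  moreover have "n\<^sup>2 * 2 ^ (m + 2) * \<beta>\<^sup>2 = 2 * (n\<^sup>2 / 2 * (\<beta>\<^sup>2 * 2 ^ (m + 2)))" "2 * n\<^sup>2 * \<beta>\<^sup>2 = 2 * (n\<^sup>2 * \<beta>\<^sup>2)" by simp_all
  ultimately have as: "2 * (a * s) + 2 * (n\<^sup>2 * \<beta>\<^sup>2) \<le> err" using beta_le_err by linarith
  have nn: "0 \<le> n\<^sup>2 * \<beta>\<^sup>2" "0 \<le> a * s" using s0 a_ge_1 by auto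
  show "\<bar>M y - 1\<bar> \<le> err" using perturbation_bounds(2)[OF b1] as nn unfolding s_def real_norm_def by linarith
  have "(n - 1) * s = c * (a * s)" using ca by (simp flip: mult.assoc)
  also have "\<dots> \<le> 2 * (a * s)" using c_le_2 nn by (intro mult_right_mono) auto
  finally show "\<bar>Ksq y - 1\<bar> \<le> 2 * err" using perturbation_bounds(3)[OF b1] as nn unfolding s_def real_norm_def by linarith
qed

lemma M_pos: "0 < M (Y s)" and Ksq_pos: "0 < Ksq (Y s)"
  using small_y[OF Y_le[of s]] err by linarith+

definition "k s = sqrt (Ksq (Y s))"

lemma k_pos: "0 < k s" and k_square: "(k s)\<^sup>2 = Ksq (Y s)"
  using Ksq_pos[of s] by (auto simp: k_def)

lemma Ksq_Y: "Ksq (Y s) = (X s)\<^sup>2 + (Ygrad (Y s))\<^sup>2"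
  by (simp add: Ksq_def curve_equation)

text \<open>The velocity is a unit vector orthogonal to the half gradient \<open>(X, Ygrad Y)\<close>, hence one of two unit
vectors. The sign \<open>\<sigma>\<close> is continuous in \<open>s\<close>, so it is constant; it is the orientation of the
parametrization.\<close>

lemma frame:
  obtains \<sigma> :: real where "\<sigma> * \<sigma> = 1"
    "\<And>s. (X has_real_derivative - \<sigma> * Ygrad (Y s) / k s) (at s)"
    "\<And>s. (Y has_real_derivative \<sigma> * X s / k s) (at s)"
proof -
  have "real_analytic X" "real_analytic Y" using arc by (auto simp: arclength_param_def X_def[abs_def] Y_def[abs_def])
  then obtain X' Y' where ra: "real_analytic X'" "real_analytic Y'"
    and dX: "\<And>s. (X has_real_derivative X' s) (at s)" and dY: "\<And>s. (Y has_real_derivative Y' s) (at s)"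
    using real_analytic_derivative by metis
  have contf: "continuous_on UNIV f" if "real_analytic f" for f
    using real_analytic_derivative[OF that] by (meson DERIV_continuous continuous_at_imp_continuous_on)
  have c: "continuous_on UNIV X'" "continuous_on UNIV Y'" using contf ra by auto
  have cXY: "continuous_on UNIV X" "continuous_on UNIV Y" using dX dY by (meson DERIV_continuous continuous_at_imp_continuous_on)+
  have unit: "(X' s)\<^sup>2 + (Y' s)\<^sup>2 = 1" for s
  proof -
    have "((\<lambda>s. (X s, Y s)) has_vector_derivative (X' s, Y' s)) (at s)"
      using dX[of s] dY[of s] by (intro has_vector_derivative_Pair) (auto simp: has_real_derivative_iff_has_vector_derivative)
    then have "vector_derivative \<gamma> (at s) = (X' s, Y' s)"
      by (intro vector_derivative_at) (simp add: X_def Y_def)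
    then show ?thesis using unit_speed[of s] by (simp add: norm_Pair real_sqrt_eq_1_iff)
  qed
  have tang: "X s * X' s + Ygrad (Y s) * Y' s = 0" for s
  proof -
    have "((\<lambda>s. (X s)\<^sup>2 - Xsq (Y s)) has_real_derivative 2 * X s * X' s - - 2 * Ygrad (Y s) * Y' s) (at s)"
      by (intro DERIV_diff DERIV_chain2[OF DERIV_Xsq dY]) (auto intro!: derivative_eq_intros dX)
    moreover have "(\<lambda>s. (X s)\<^sup>2 - Xsq (Y s)) = (\<lambda>s. 0)" by (simp add: curve_equation)
    ultimately have "2 * X s * X' s - - 2 * Ygrad (Y s) * Y' s = 0"
      using DERIV_unique[OF _ DERIV_const[of 0]] by metis
    then show ?thesis by simp
  qed
  define \<sigma> where "\<sigma> s = (- Ygrad (Y s) * X' s + X s * Y' s) / k s" for s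
  have sk: "\<sigma> s * k s = - Ygrad (Y s) * X' s + X s * Y' s" for s using k_pos[of s] by (simp add: \<sigma>_def)
  have s2: "(\<sigma> s)\<^sup>2 = 1" for s
  proof -
    have "(\<sigma> s)\<^sup>2 * (k s)\<^sup>2 = (- Ygrad (Y s) * X' s + X s * Y' s)\<^sup>2 + (X s * X' s + Ygrad (Y s) * Y' s)\<^sup>2"
      unfolding tang sk[symmetric] by (simp add: power_mult_distrib)
    also have "\<dots> = ((X s)\<^sup>2 + (Ygrad (Y s))\<^sup>2) * ((X' s)\<^sup>2 + (Y' s)\<^sup>2)" by (simp add: power2_eq_square algebra_simps)
    also have "\<dots> = (k s)\<^sup>2" by (simp add: unit k_square Ksq_Y)
    finally show ?thesis using k_pos[of s] by simp
  qed
  have k0: "k s \<noteq> 0" for s using k_pos[of s] by simp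
  have "continuous_on UNIV \<sigma>" unfolding \<sigma>_def using k0 by (intro continuous_intros c cXY) (auto simp: k_def intro!: continuous_intros cXY)
  then have con: "connected (range \<sigma>)" by (intro connected_continuous_image) auto
  have "0 \<notin> range \<sigma>" using s2 by (metis imageE power_zero_numeral zero_neq_one)
  then have no: "\<not> (1 \<in> range \<sigma> \<and> - 1 \<in> range \<sigma>)"
    using connectedD_interval[OF con, of "-1" 1 0] by auto
  have pm: "\<sigma> s = 1 \<or> \<sigma> s = - 1" for s using s2[of s] by (simp add: power2_eq_1_iff)
  have const: "\<sigma> s = \<sigma> 0" for s using pm[of s] pm[of 0] no by (metis rangeI)
  show thesis
  proof (rule that[of "\<sigma> 0"])
    show "\<sigma> 0 * \<sigma> 0 = 1" using s2[of 0] by (simp add: power2_eq_square)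
    fix s
    have s: "\<sigma> 0 * k s = - Ygrad (Y s) * X' s + X s * Y' s" using sk[of s] const[of s] by simp
    have kk: "k s * k s = (X s)\<^sup>2 + (Ygrad (Y s))\<^sup>2" using k_square[of s] by (simp add: Ksq_Y power2_eq_square)
    have "k s * k s * X' s = - \<sigma> 0 * Ygrad (Y s) * k s"
    proof -
      have "- \<sigma> 0 * Ygrad (Y s) * k s = - Ygrad (Y s) * (\<sigma> 0 * k s)" by simp
      also have "\<dots> = (Ygrad (Y s))\<^sup>2 * X' s - X s * (Ygrad (Y s) * Y' s)" unfolding s by (simp add: power2_eq_square algebra_simps)
      also have "Ygrad (Y s) * Y' s = - X s * X' s" using tang[of s] by simp
      finally show ?thesis unfolding kk by (simp add: power2_eq_square algebra_simps)
    qed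
    then have "k s * (k s * X' s) = k s * (- \<sigma> 0 * Ygrad (Y s))" by (simp only: mult_ac)
    then have "k s * X' s = - \<sigma> 0 * Ygrad (Y s)" by (rule mult_left_cancel[OF k0[of s], THEN iffD1])
    then have "X' s = - \<sigma> 0 * Ygrad (Y s) / k s" using k0[of s] by (simp add: field_simps)
    then show "(X has_real_derivative - \<sigma> 0 * Ygrad (Y s) / k s) (at s)" using dX[of s] by simp
    have "k s * k s * Y' s = \<sigma> 0 * X s * k s"
    proof -
      have "\<sigma> 0 * X s * k s = X s * (\<sigma> 0 * k s)" by simp
      also have "\<dots> = (X s)\<^sup>2 * Y' s - Ygrad (Y s) * (X s * X' s)" unfolding s by (simp add: power2_eq_square algebra_simps)
      also have "X s * X' s = - Ygrad (Y s) * Y' s" using tang[of s] by simp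
      finally show ?thesis unfolding kk by (simp add: power2_eq_square algebra_simps)
    qed
    then have "k s * (k s * Y' s) = k s * (\<sigma> 0 * X s)" by (simp only: mult_ac)
    then have "k s * Y' s = \<sigma> 0 * X s" by (rule mult_left_cancel[OF k0[of s], THEN iffD1])
    then have "Y' s = \<sigma> 0 * X s / k s" using k0[of s] by (simp add: field_simps)
    then show "(Y has_real_derivative \<sigma> 0 * X s / k s) (at s)" using dY[of s] by simp
  qed
qed

definition "\<kappa> s = M (Y s) / k s ^ 3"

context
  fixes \<sigma> :: real
  assumes \<sigma>: "\<sigma> * \<sigma> = 1"
    and dX: "\<And>s. (X has_real_derivative - \<sigma> * Ygrad (Y s) / k s) (at s)"
    and dY: "\<And>s. (Y has_real_derivative \<sigma> * X s / k s) (at s)"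
begin

lemma dk: "(k has_real_derivative \<sigma> * X s * Ygrad (Y s) * (Ehess (Y s) - 1) / (k s)\<^sup>2) (at s)"
proof -
  have "((\<lambda>s. Ksq (Y s)) has_real_derivative 2 * Ygrad (Y s) * (Ehess (Y s) - 1) * (\<sigma> * X s / k s)) (at s)"
    by (rule DERIV_chain2[OF DERIV_Ksq dY])
  from DERIV_chain2[OF DERIV_real_sqrt[OF Ksq_pos] this]
  have "(k has_real_derivative inverse (k s) / 2 * (2 * Ygrad (Y s) * (Ehess (Y s) - 1) * (\<sigma> * X s / k s))) (at s)"
    unfolding k_def[abs_def] .
  moreover have "inverse (k s) / 2 * (2 * Ygrad (Y s) * (Ehess (Y s) - 1) * (\<sigma> * X s / k s)) =
      \<sigma> * X s * Ygrad (Y s) * (Ehess (Y s) - 1) / (k s)\<^sup>2"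
    using k_pos[of s] by (simp add: field_simps power2_eq_square)
  ultimately show ?thesis by metis
qed

text \<open>Differentiating the unit tangent gives \<open>- M / k ^ 4\<close> times the half gradient \<open>(X, Ygrad Y)\<close>, which has
length \<open>k\<close>.\<close>

lemma curvature_eq: "curvature \<gamma> s = \<kappa> s"
proof -
  have v: "vector_derivative \<gamma> (at t) = (- \<sigma> * Ygrad (Y t) / k t, \<sigma> * X t / k t)" for t
  proof -
    have "((\<lambda>s. (X s, Y s)) has_vector_derivative (- \<sigma> * Ygrad (Y t) / k t, \<sigma> * X t / k t)) (at t)"
      using dX[of t] dY[of t] by (intro has_vector_derivative_Pair) (auto simp: has_real_derivative_iff_has_vector_derivative)
    then show ?thesis by (intro vector_derivative_at) (simp add: X_def Y_def)
  qed
  have k0: "k s \<noteq> 0" using k_pos[of s] by simp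
  define x y q g E where defs: "x = X s" "y = Y s" "q = k s" "g = Ygrad y" "E = Ehess y"
  have kk: "q * q = x * x + g * g" using k_square[of s] by (simp add: Ksq_Y power2_eq_square defs)
  have Mxy: "M y = E * (x * x) + g * g"
    using curve_equation[of s] by (simp add: M_def defs power2_eq_square)
  have "((\<lambda>t. - \<sigma> * Ygrad (Y t) / k t) has_real_derivative
      (- \<sigma> * (E * (\<sigma> * x / q)) * q - (- \<sigma> * g) * (\<sigma> * x * g * (E - 1) / q\<^sup>2)) / (q * q)) (at s)"
    using DERIV_divide[OF DERIV_cmult[OF DERIV_chain2[OF DERIV_Ygrad dY[of s]], of "- \<sigma>"] dk[of s] k0]
    by (simp add: defs)
  also have "(- \<sigma> * (E * (\<sigma> * x / q)) * q - (- \<sigma> * g) * (\<sigma> * x * g * (E - 1) / q\<^sup>2)) / (q * q) = - (M y * x / q ^ 4)"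
  proof -
    have q0: "q \<noteq> 0" using k0 by (simp add: defs)
    have "- \<sigma> * (E * (\<sigma> * x / q)) * q = - (\<sigma> * \<sigma>) * (E * x)" using q0 by simp
    moreover have "(- \<sigma> * g) * (\<sigma> * x * g * (E - 1) / q\<^sup>2) = - (\<sigma> * \<sigma>) * (x * (g * g) * (E - 1)) / (q * q)"
      by (simp add: power2_eq_square)
    ultimately have "(- \<sigma> * (E * (\<sigma> * x / q)) * q - (- \<sigma> * g) * (\<sigma> * x * g * (E - 1) / q\<^sup>2)) / (q * q)
        = (- (E * x) + x * (g * g) * (E - 1) / (q * q)) / (q * q)" by (simp add: \<sigma>)
    also have "\<dots> = (- (E * x) * (q * q) + x * (g * g) * (E - 1)) / (q * q) / (q * q)" using q0 by (simp add: field_simps)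
    also have "- (E * x) * (q * q) + x * (g * g) * (E - 1) = - (M y * x)" unfolding kk Mxy by (simp add: algebra_simps)
    finally show ?thesis by (simp add: power4_eq_xxxx mult.assoc)
  qed
  finally have d1: "((\<lambda>t. - \<sigma> * Ygrad (Y t) / k t) has_real_derivative - (M y * x / q ^ 4)) (at s)" .
  have "((\<lambda>t. \<sigma> * X t / k t) has_real_derivative
      (\<sigma> * (- \<sigma> * g / q) * q - (\<sigma> * x) * (\<sigma> * x * g * (E - 1) / q\<^sup>2)) / (q * q)) (at s)"
    using DERIV_divide[OF DERIV_cmult[OF dX[of s], of \<sigma>] dk[of s] k0]
    by (simp add: defs)
  also have "(\<sigma> * (- \<sigma> * g / q) * q - (\<sigma> * x) * (\<sigma> * x * g * (E - 1) / q\<^sup>2)) / (q * q) = - (M y * g / q ^ 4)"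
  proof -
    have q0: "q \<noteq> 0" using k0 by (simp add: defs)
    have "\<sigma> * (- \<sigma> * g / q) * q = - (\<sigma> * \<sigma>) * g" using q0 by simp
    moreover have "(\<sigma> * x) * (\<sigma> * x * g * (E - 1) / q\<^sup>2) = (\<sigma> * \<sigma>) * (x * x * g * (E - 1)) / (q * q)"
      by (simp add: power2_eq_square)
    ultimately have "(\<sigma> * (- \<sigma> * g / q) * q - (\<sigma> * x) * (\<sigma> * x * g * (E - 1) / q\<^sup>2)) / (q * q)
        = (- g - x * x * g * (E - 1) / (q * q)) / (q * q)" by (simp add: \<sigma>)
    also have "\<dots> = (- g * (q * q) - x * x * g * (E - 1)) / (q * q) / (q * q)" using q0 by (simp add: field_simps)
    also have "- g * (q * q) - x * x * g * (E - 1) = - (M y * g)" unfolding kk Mxy by (simp add: algebra_simps)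
    finally show ?thesis by (simp add: power4_eq_xxxx mult.assoc)
  qed
  finally have d2: "((\<lambda>t. \<sigma> * X t / k t) has_real_derivative - (M y * g / q ^ 4)) (at s)" .
  have "((\<lambda>t. vector_derivative \<gamma> (at t)) has_vector_derivative (- (M y * x / q ^ 4), - (M y * g / q ^ 4))) (at s)"
    unfolding v using d1 d2 by (intro has_vector_derivative_Pair) (auto simp: has_real_derivative_iff_has_vector_derivative)
  then have "curvature \<gamma> s = norm (- (M y * x / q ^ 4), - (M y * g / q ^ 4))"
    unfolding curvature_def by (simp add: vector_derivative_at)
  also have "\<dots> = sqrt ((M y / q ^ 3)\<^sup>2)"
  proof -
    have q0: "q \<noteq> 0" using k0 by (simp add: defs)
    have "(M y * x / q ^ 4)\<^sup>2 + (M y * g / q ^ 4)\<^sup>2 = (M y)\<^sup>2 * (q * q) / (q ^ 4)\<^sup>2"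
      unfolding kk by (simp add: power_divide power_mult_distrib power2_eq_square algebra_simps add_divide_distrib)
    also have "\<dots> = (M y / q ^ 3)\<^sup>2" using q0 by (simp add: field_simps power2_eq_square power4_eq_xxxx power3_eq_cube)
    finally have "(- (M y * x / q ^ 4))\<^sup>2 + (- (M y * g / q ^ 4))\<^sup>2 = (M y / q ^ 3)\<^sup>2" by (simp only: power2_minus)
    then show ?thesis by (simp only: norm_Pair real_norm_def power2_abs)
  qed
  also have "\<dots> = M y / q ^ 3" using M_pos[of s] k_pos[of s] by (simp add: defs)
  finally show ?thesis by (simp add: \<kappa>_def defs)
qed

end

end

section \<open>From arc length to the normalized variable\<close>

context arclength_curve
begin

text \<open>The integral \<open>Z\<close> of \<open>\<kappa> powr (2/3)\<close> is an increasing bijection that adds \<open>C\<close> per period, and \<open>\<xi>\<^sub>0 = Z / C\<close>.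
In the variable \<open>Z\<close>, and with \<open>x\<close> reflected when the orientation sign is negative, the curve is a real
orbit, so the bounds for \<open>kappa\<close> apply. Passing to \<open>\<xi>\<close> divides the width of the strip by \<open>C\<close>.\<close>

lemma delta_bounds:
  assumes small: "n * err * (- ln r0 / n) \<le> 1/5"
    and D: "0 \<le> D" "\<And>r s. r \<in> {0..1} \<Longrightarrow> s \<in> {0..1} \<Longrightarrow> \<bar>defect_integral c r - defect_integral c s\<bar> \<le> D * \<bar>r - s\<bar>"
  defines "C \<equiv> C_const L \<gamma>"
  shows "0 < C" "(1 - 10 * err) * C \<le> 2 * pi" "2 * pi \<le> (1 + 10 * err) * C"
    "(ln 2 + (- ln \<epsilon> - ln a - defect_integral c 1) / n - 2 * err / n) / (1 + 5 * err) \<le> C * delta L \<gamma>"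
    "C * delta L \<gamma> \<le> (1 + err) * (ln 2 + (- ln \<epsilon> - ln a - defect_integral c 1) / n + err / n + err + 3 * D * err / n)"
proof -
  obtain \<sigma> :: real where \<sigma>: "\<sigma> * \<sigma> = 1"
    and dX: "\<And>s. (X has_real_derivative - \<sigma> * Ygrad (Y s) / k s) (at s)"
    and dY: "\<And>s. (Y has_real_derivative \<sigma> * X s / k s) (at s)"
    using frame by metis
  note dk = dk[OF \<sigma> dX dY] and curv = curvature_eq[OF \<sigma> dX dY]
  have cY: "continuous_on UNIV Y" using dY by (meson DERIV_continuous continuous_at_imp_continuous_on)
  have ck: "continuous_on UNIV k" using dk by (meson DERIV_continuous continuous_at_imp_continuous_on)
  have kap_pos: "0 < \<kappa> s" for s using M_pos[of s] k_pos[of s] by (simp add: \<kappa>_def)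
  have k0: "k s \<noteq> 0" for s using k_pos[of s] by simp
  define h where "h s = \<kappa> s powr (2/3)" for s
  have h_eq: "h s = M (Y s) powr (2/3) / (k s)\<^sup>2" for s
  proof -
    have "(k s ^ 3) powr (2/3) = (k s)\<^sup>2"
    proof -
      have "(k s ^ 3) powr (2/3) = (k s powr 3) powr (2/3)" using k_pos[of s] powr_realpow[of "k s" 3] by simp
      also have "\<dots> = k s powr 2" by (simp add: powr_powr)
      also have "\<dots> = (k s)\<^sup>2" using k_pos[of s] powr_realpow[of "k s" 2] by simp
      finally show ?thesis .
    qed
    then show ?thesis using M_pos[of s] k_pos[of s] by (simp add: h_def \<kappa>_def powr_divide)
  qed
  have h_pos: "0 < h s" for s using kap_pos[of s] by (simp add: h_def)
  have "continuous_on UNIV \<kappa>"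
    unfolding \<kappa>_def[abs_def] using k0 by (intro continuous_intros cY ck) auto
  then have ch: "continuous_on UNIV h"
    unfolding h_def[abs_def] using kap_pos by (intro continuous_intros) (auto simp: less_imp_neq[symmetric])
  have "\<exists>F. \<forall>x::real. - \<infinity> < ereal x \<longrightarrow> ereal x < \<infinity> \<longrightarrow> (F has_vector_derivative h x) (at x)"
    by (rule einterval_antiderivative) (use ch in \<open>auto simp: continuous_on_eq_continuous_at\<close>)
  then obtain F0 where F0: "\<And>x. (F0 has_real_derivative h x) (at x)"
    by (auto simp: has_real_derivative_iff_has_vector_derivative)
  define Z where "Z s = F0 s - F0 0" for s
  have dZ: "(Z has_real_derivative h s) (at s)" for s
    unfolding Z_def[abs_def] using F0 by (auto intro!: derivative_eq_intros)
  have Z0: "Z 0 = 0" by (simp add: Z_def)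
  have Zmono: "Z s < Z t" if "s < t" for s t
    by (rule DERIV_pos_imp_increasing[OF that]) (use dZ h_pos in blast)
  have hC: "integral {0..L} h = Z L"
    using fundamental_theorem_of_calculus[of 0 L Z h] dZ L_pos Z0
    by (auto intro!: integral_unique simp: has_real_derivative_iff_has_vector_derivative has_vector_derivative_at_within)
  have "C = integral {0..L} h" unfolding C_def C_const_def h_def curv ..
  then have CZ: "C = Z L" using hC by simp
  show C0: "0 < C" using Zmono[OF L_pos] by (simp add: CZ Z0)
  have XL: "X (s + L) = X s" and YL: "Y (s + L) = Y s" for s
    using gamma_periodic[of s] by (auto simp: X_def Y_def)
  have hL: "h (s + L) = h s" for s by (simp add: h_def \<kappa>_def k_def YL)
  have ZL: "Z (s + L) = Z s + C" for s
  proof -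
    have "((\<lambda>s. Z (s + L) - Z s) has_real_derivative 0) (at s)" for s
    proof -
      have "((\<lambda>s. Z (s + L)) has_real_derivative h (s + L) * 1) (at s)"
        by (rule DERIV_chain2[OF dZ]) (auto intro!: derivative_eq_intros)
      from DERIV_diff[OF this dZ[of s]] show ?thesis by (simp add: hL)
    qed
    then have "Z (s + L) - Z s = Z (0 + L) - Z 0" by (rule DERIV_isconst_all[rule_format])
    then show ?thesis by (simp add: CZ Z0)
  qed
  have Zk: "Z (of_nat j * L) = of_nat j * C" for j
    by (induction j) (use ZL in \<open>auto simp: Z0 algebra_simps\<close>, metis add.commute)
  have contZ: "continuous_on A Z" for A using dZ by (meson DERIV_continuous continuous_at_imp_continuous_on)
  have Zsurj: "\<exists>s. Z s = v" for v
  proof -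
    obtain j :: nat where j: "\<bar>v\<bar> / C \<le> of_nat j" using real_arch_simple by blast
    then have j': "\<bar>v\<bar> \<le> of_nat j * C" using C0 by (simp add: field_simps)
    have "Z (- (of_nat j * L)) = - (of_nat j * C)"
    proof -
      have "Z (- (of_nat i * L)) = - (of_nat i * C)" for i
      proof (induction i)
        case (Suc i)
        have "Z (- (of_nat (Suc i) * L) + L) = Z (- (of_nat (Suc i) * L)) + C" by (rule ZL)
        moreover have "- (of_nat (Suc i) * L) + L = - (of_nat i * L)" by (simp add: algebra_simps)
        ultimately show ?case using Suc by (simp add: algebra_simps)
      qed (simp add: Z0)
      then show ?thesis .
    qed
    then have "Z (- (of_nat j * L)) \<le> v" "v \<le> Z (of_nat j * L)" using j' Zk[of j] by (auto simp: abs_le_iff)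
    then show ?thesis using IVT'[of Z "- (of_nat j * L)" v "of_nat j * L"] contZ L_pos by auto
  qed
  have Zinj: "inj Z" by (rule linorder_injI) (use Zmono in \<open>auto simp: less_imp_neq\<close>)
  define T where "T = inv Z"
  have "surj Z" unfolding surj_def using Zsurj by metis
  then have ZT: "Z (T v) = v" for v unfolding T_def by (rule surj_f_inv_f)
  have TZ: "T (Z s) = s" for s unfolding T_def by (rule inv_f_f[OF Zinj])
  have dT: "(T has_real_derivative inverse (h (T v))) (at v)" for v
  proof -
    have "(T has_real_derivative inverse (h (T v))) (at (Z (T v)))"
      by (rule has_field_derivative_inverse_strong[OF dZ _ open_UNIV]) (use h_pos[of "T v"] contZ TZ in auto)
    then show ?thesis by (simp add: ZT)
  qed
  have invh: "inverse (h s) = (k s)\<^sup>2 * M (Y s) powr (-2/3)" for s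
  proof -
    have "M (Y s) powr (-2/3) = inverse (M (Y s) powr (2/3))" using powr_minus[of "M (Y s)" "2/3"] by simp
    moreover have "inverse (A / B) = B * inverse A" for A B :: real by (simp add: divide_inverse)
    ultimately show ?thesis by (simp only: h_eq)
  qed
  define xr where "xr t = \<sigma> * X (T t)" for t
  define yr where "yr t = Y (T t)" for t
  define kr where "kr t = k (T t)" for t
  interpret real_orbit m \<beta> xr yr kr
  proof
    fix t
    have kT: "k (T t) \<noteq> 0" by (rule k0)
    show "(xr has_real_derivative - (Ygrad (yr t) * kr t * M (yr t) powr (-2/3))) (at t)"
    proof -
      have "(xr has_real_derivative \<sigma> * ((- \<sigma> * Ygrad (Y (T t)) / k (T t)) * inverse (h (T t)))) (at t)"
        unfolding xr_def[abs_def] by (rule DERIV_cmult[OF DERIV_chain2[OF dX dT]])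
      moreover have "\<sigma> * ((- \<sigma> * Ygrad (Y (T t)) / k (T t)) * inverse (h (T t)))
          = - (\<sigma> * \<sigma>) * (Ygrad (Y (T t)) * k (T t) * M (Y (T t)) powr (-2/3))"
        unfolding invh using kT by (simp add: power2_eq_square)
      ultimately show ?thesis by (simp add: \<sigma> yr_def kr_def)
    qed
    show "(yr has_real_derivative xr t * kr t * M (yr t) powr (-2/3)) (at t)"
    proof -
      have "(yr has_real_derivative (\<sigma> * X (T t) / k (T t)) * inverse (h (T t))) (at t)"
        unfolding yr_def[abs_def] by (rule DERIV_chain2[OF dY dT])
      moreover have "(\<sigma> * X (T t) / k (T t)) * inverse (h (T t)) = xr t * kr t * M (yr t) powr (-2/3)"
        unfolding invh xr_def yr_def kr_def using kT by (simp add: power2_eq_square)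
      ultimately show ?thesis by simp
    qed
    show "(kr has_real_derivative Ygrad (yr t) * (Ehess (yr t) - 1) * xr t * M (yr t) powr (-2/3)) (at t)"
    proof -
      have "(kr has_real_derivative (\<sigma> * X (T t) * Ygrad (Y (T t)) * (Ehess (Y (T t)) - 1) / (k (T t))\<^sup>2) * inverse (h (T t))) (at t)"
        unfolding kr_def[abs_def] by (rule DERIV_chain2[OF dk dT])
      moreover have "(\<sigma> * X (T t) * Ygrad (Y (T t)) * (Ehess (Y (T t)) - 1) / (k (T t))\<^sup>2) * inverse (h (T t))
          = Ygrad (yr t) * (Ehess (yr t) - 1) * xr t * M (yr t) powr (-2/3)"
        unfolding invh xr_def yr_def using kT by simp
      ultimately show ?thesis by simp
    qed
    show "(xr t)\<^sup>2 = Xsq (yr t)"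
      using curve_equation[of "T t"] \<sigma> by (simp add: xr_def yr_def power_mult_distrib) (simp add: power2_eq_square)
    show "(kr t)\<^sup>2 = Ksq (yr t)" using k_square[of "T t"] by (simp add: kr_def yr_def)
    show "0 < kr t" using k_pos[of "T t"] by (simp add: kr_def)
    show "\<bar>yr t\<bar> \<le> 2" using Y_le[of "T t"] by (simp add: yr_def)
  qed
  have TC: "T (v + C) = T v + L" for v
    using TZ[of "T v + L"] by (simp add: ZL ZT)
  have perx: "xr (t + C) = xr t" and pery: "yr (t + C) = yr t" for t
    by (simp_all add: xr_def yr_def TC XL YL)
  have Trange: "T v \<in> {0..<L}" if "v \<in> {0..<C}" for v
  proof -
    have "\<not> T v < 0" using Zmono[of "T v" 0] that by (auto simp: ZT Z0)
    moreover have "\<not> L < T v" "T v \<noteq> L" using Zmono[of L "T v"] that ZT[of v] by (auto simp: CZ)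
    ultimately show ?thesis by auto
  qed
  have s0: "\<sigma> \<noteq> 0" using \<sigma> by auto
  have inj: "s = t" if "s \<in> {0..<C}" "t \<in> {0..<C}" "xr s = xr t" "yr s = yr t" for s t
  proof -
    have "\<gamma> (T s) = \<gamma> (T t)" using that(3,4) s0 by (simp add: gamma_XY xr_def yr_def)
    then have "T s = T t" using gamma_inj Trange[OF that(1)] Trange[OF that(2)] by (meson inj_onD)
    then show "s = t" by (metis ZT)
  qed
  show "(1 - 10 * err) * C \<le> 2 * pi" "2 * pi \<le> (1 + 10 * err) * C"
    using period_bounds[OF C0 perx pery inj] by blast+
  have xi: "xi0 L \<gamma> = (\<lambda>s. Z s / C)"
    unfolding xi0_def
  proof (rule the_equality)
    have "((\<lambda>s. Z s / C) has_real_derivative h s / C) (at s)" for s by (rule DERIV_cdivide[OF dZ])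
    then show "Z 0 / C = 0 \<and> (\<forall>s. ((\<lambda>s. Z s / C) has_real_derivative curvature \<gamma> s powr (2/3) / C_const L \<gamma>) (at s))"
      by (simp add: Z0 curv h_def C_def)
    fix f assume f: "f 0 = 0 \<and> (\<forall>s. (f has_real_derivative curvature \<gamma> s powr (2/3) / C_const L \<gamma>) (at s))"
    show "f = (\<lambda>s. Z s / C)"
    proof
      fix s
      have "((\<lambda>s. f s - Z s / C) has_real_derivative 0) (at s)" for s
        using DERIV_diff[OF f[THEN conjunct2, rule_format, of s] DERIV_cdivide[OF dZ[of s], of C]]
        by (simp add: curv h_def C_def)
      then have "f s - Z s / C = f 0 - Z 0 / C" by (rule DERIV_isconst_all[rule_format])
      then show "f s = Z s / C" using f Z0 by simp
    qed
  qed
  have invxi: "inv (xi0 L \<gamma>) v = T (C * v)" for v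
  proof (rule inv_f_eq)
    show "inj (xi0 L \<gamma>)" unfolding xi using Zinj C0 by (auto simp: inj_def)
    show "xi0 L \<gamma> (T (C * v)) = v" using C0 by (simp add: xi ZT)
  qed
  have kx: "kappa_xi L \<gamma> v = kappa (C * v)" for v
    by (simp add: kappa_xi_def invxi curv \<kappa>_def kappa_def yr_def kr_def)
  have period1: "kappa_xi L \<gamma> (v + 1) = kappa_xi L \<gamma> v" for v
  proof -
    have "C * (v + 1) = C * v + C" by (simp add: algebra_simps)
    then have "T (C * (v + 1)) = T (C * v) + L" by (simp add: TC)
    then show ?thesis by (simp add: kappa_xi_def invxi curv \<kappa>_def k_def YL)
  qed
  have scale: "zero_free_ext (kappa_xi L \<gamma>) (d / C) (\<lambda>z. F (of_real C * z))" if F: "zero_free_ext kappa d F" for d F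
    unfolding zero_free_ext_def
  proof (intro conjI allI ballI)
    have str: "of_real C * z \<in> strip d" if "z \<in> strip (d / C)" for z
      using that C0 by (simp add: strip_def abs_mult field_simps)
    show "(\<lambda>z. F (of_real C * z)) holomorphic_on strip (d / C)"
      by (rule holomorphic_on_compose_gen[unfolded o_def, where g = F and t = "strip d"])
        (use F str in \<open>auto simp: zero_free_ext_def intro!: holomorphic_intros\<close>)
    show "F (of_real C * of_real x) = of_real (kappa_xi L \<gamma> x)" for x
      using F by (metis kx of_real_mult zero_free_ext_def)
    show "F (of_real C * z) \<noteq> 0" if "z \<in> strip (d / C)" for z
      using F str[OF that] by (auto simp: zero_free_ext_def)
  qed
  have unscale: "zero_free_ext kappa (C * d) (\<lambda>z. F (z / of_real C))" if F: "zero_free_ext (kappa_xi L \<gamma>) d F" for d F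
    unfolding zero_free_ext_def
  proof (intro conjI allI ballI)
    have str: "z / of_real C \<in> strip d" if "z \<in> strip (C * d)" for z
      using that C0 by (simp add: strip_def field_simps)
    show "(\<lambda>z. F (z / of_real C)) holomorphic_on strip (C * d)"
      by (rule holomorphic_on_compose_gen[unfolded o_def, where g = F and t = "strip d"])
        (use F str C0 in \<open>auto simp: zero_free_ext_def intro!: holomorphic_intros\<close>)
    show "F (of_real x / of_real C) = of_real (kappa x)" for x
    proof -
      have "F (of_real (x / C)) = of_real (kappa_xi L \<gamma> (x / C))" using F unfolding zero_free_ext_def by blast
      moreover have "C * (x / C) = x" using C0 by simp
      ultimately show ?thesis unfolding kx by simp
    qed
    show "F (z / of_real C) \<noteq> 0" if "z \<in> strip (C * d)" for z
      using F str[OF that] by (auto simp: zero_free_ext_def)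
  qed
  define R where "R = (1 + err) * (ln 2 + (- ln \<epsilon> - ln a - defect_integral c 1) / n + err / n + err + 3 * D * err / n)"
  have ub: "d \<le> R" if "zero_free_ext kappa d F" "0 < d" for d F
    unfolding R_def by (rule upper_bound[OF that D])
  have e: "0 < err" "err \<le> 1/100" using err_pos err by auto
  have lm: "n * err * level_max \<le> 1/5" using small by (simp add: level_max_def)
  obtain H1 where H1: "0 < H1" "level H1 < 1" "n * err * H1 \<le> 1/5" using small_level_exists by blast
  obtain F1 where F1: "zero_free_ext kappa (time H1) F1" using kappa_zero_free[OF H1] by blast
  obtain W where "strip_orbit m \<beta> xr yr kr W (time H1)" using complex_extension[OF H1(1,2)] .
  then have t1: "0 < time H1" by (rule strip_orbit.d)
  then have R0: "0 < R" using ub[OF F1] by simp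
  have ub': "d \<le> R / C" if "zero_free_ext (kappa_xi L \<gamma>) d F" for d F
  proof (cases "0 < d")
    case True
    then have "C * d \<le> R" using ub[OF unscale[OF that]] C0 by simp
    then show ?thesis using C0 by (simp add: field_simps)
  next
    case False
    moreover have "0 < R / C" using R0 C0 by simp
    ultimately show ?thesis by linarith
  qed
  have dd: "d \<le> delta L \<gamma>" "delta L \<gamma> \<le> R / C" if "zero_free_ext (kappa_xi L \<gamma>) d F" "0 < d" for d F
    using THE_strip_halfwidth[OF that(1,2) zero_less_one period1 ub'] by (auto simp: delta_def)
  have pos1: "0 < time H1 / C" using t1 C0 by simp
  have "delta L \<gamma> \<le> R / C" by (rule dd(2)[OF scale[OF F1] pos1])
  then show "C * delta L \<gamma> \<le> (1 + err) * (ln 2 + (- ln \<epsilon> - ln a - defect_integral c 1) / n + err / n + err + 3 * D * err / n)"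
    using C0 by (simp add: R_def field_simps)
  show "(ln 2 + (- ln \<epsilon> - ln a - defect_integral c 1) / n - 2 * err / n) / (1 + 5 * err) \<le> C * delta L \<gamma>"
  proof (rule lower_bound[OF lm])
    fix d F assume d: "zero_free_ext kappa d F" "0 < d"
    have "d / C \<le> delta L \<gamma>" by (rule dd(1)[OF scale[OF d(1)]]) (use d C0 in simp)
    then show "d \<le> C * delta L \<gamma>" using C0 by (simp add: field_simps)
  qed
qed

end

section \<open>The asymptotic formula\<close>

text \<open>Bookkeeping of relative errors: \<open>A\<close> is the expected value of size at most \<open>B l\<close> with \<open>l = \<bar>ln \<epsilon>\<bar>\<close>, so
relative errors of size \<open>e\<close> become absolute errors of size \<open>e l\<close>. This is where the logarithm in
the error term comes from.\<close>

lemma rescaled_estimate: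
  fixes e l C A B E F \<delta> :: real
  assumes e: "0 < e" "e \<le> 1/100" and l: "1 \<le> l" and C: "0 < C"
    and A: "\<bar>A\<bar> \<le> B * l" and EF: "0 \<le> E" "0 \<le> F"
    and ratio: "(1 - 10 * e) * C \<le> 2 * pi" "2 * pi \<le> (1 + 10 * e) * C"
    and lower: "(A - F * e) / (1 + 5 * e) \<le> C * \<delta>" and upper: "C * \<delta> \<le> (1 + e) * (A + E * e)"
  shows "\<bar>2 * pi * \<delta> - A\<bar> \<le> (12 * (B + E) + E + 20 * (B + F) + F) * (e * l)"
proof -
  define q where "q = 2 * pi / C"
  have q: "1 - 10 * e \<le> q" "q \<le> 1 + 10 * e" using ratio C by (auto simp: q_def field_simps)
  have q0: "0 < q" using q e by linarith
  have eq: "2 * pi * \<delta> = q * (C * \<delta>)" using C by (simp add: q_def)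
  have B0: "0 \<le> B * l" using A by linarith
  have Bn: "0 \<le> B" using B0 l by (simp add: zero_le_mult_iff)
  have el: "e \<le> e * l" "0 < e * l" using e l by auto
  have ee: "e * e \<le> e * (1/100)" using e by (intro mult_left_mono) auto
  have dev: "p * X \<le> X + c * e * Y" "X - c * e * Y \<le> p * X" if "\<bar>p - 1\<bar> \<le> c * e" "\<bar>X\<bar> \<le> Y" for p X Y c :: real
  proof -
    have "\<bar>(p - 1) * X\<bar> \<le> c * e * Y" unfolding abs_mult using that by (intro mult_mono) auto
    moreover have "p * X = X + (p - 1) * X" by (simp add: algebra_simps)
    ultimately show "p * X \<le> X + c * e * Y" "X - c * e * Y \<le> p * X" by (auto simp: abs_le_iff)
  qed
  have X1: "\<bar>A + E * e\<bar> \<le> (B + E) * l"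
  proof -
    have "\<bar>A + E * e\<bar> \<le> \<bar>A\<bar> + E * e" using EF e abs_triangle_ineq[of A "E * e"] by simp
    also have "E * e \<le> E * l" using EF e l by (intro mult_left_mono) auto
    finally show ?thesis using A by (simp add: algebra_simps)
  qed
  have X2: "\<bar>A - F * e\<bar> \<le> (B + F) * l"
  proof -
    have "\<bar>A - F * e\<bar> \<le> \<bar>A\<bar> + F * e" using EF e abs_triangle_ineq4[of A "F * e"] by simp
    also have "F * e \<le> F * l" using EF e l by (intro mult_left_mono) auto
    finally show ?thesis using A by (simp add: algebra_simps)
  qed
  have p1: "\<bar>q * (1 + e) - 1\<bar> \<le> 12 * e"
  proof -
    have "q * (1 + e) \<le> (1 + 10 * e) * (1 + e)" using q e by (intro mult_right_mono) auto
    moreover have "(1 + 10 * e) * (1 + e) = 1 + 11 * e + 10 * (e * e)" by (simp add: algebra_simps)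
    moreover have "1 - 10 * e \<le> q * (1 + e)"
    proof -
      have "q * 1 \<le> q * (1 + e)" using q0 e by (intro mult_left_mono) auto
      then show ?thesis using q by linarith
    qed
    ultimately have "q * (1 + e) - 1 \<le> 12 * e" "1 - q * (1 + e) \<le> 12 * e" using ee e by linarith+
    then show ?thesis by (simp add: abs_le_iff)
  qed
  have p2: "\<bar>q / (1 + 5 * e) - 1\<bar> \<le> 20 * e"
  proof -
    have "q / (1 + 5 * e) \<le> q / 1" using q0 e by (intro divide_left_mono) auto
    moreover have "1 - 20 * e \<le> q / (1 + 5 * e)"
    proof -
      have "(1 - 20 * e) * (1 + 5 * e) = 1 - 15 * e - 100 * (e * e)" by (simp add: algebra_simps)
      moreover have "0 \<le> e * e" by simp
      ultimately have "(1 - 20 * e) * (1 + 5 * e) \<le> q" using q e by linarith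
      then show ?thesis using e by (simp add: le_divide_eq)
    qed
    ultimately show ?thesis using q e by (simp add: abs_le_iff)
  qed
  have "2 * pi * \<delta> \<le> q * ((1 + e) * (A + E * e))" unfolding eq using upper q0 by (intro mult_left_mono) auto
  also have "\<dots> = (q * (1 + e)) * (A + E * e)" by simp
  also have "\<dots> \<le> A + E * e + 12 * e * ((B + E) * l)" by (rule dev(1)[OF p1 X1])
  finally have u: "2 * pi * \<delta> \<le> A + E * e + 12 * (B + E) * (e * l)" by (simp add: mult_ac)
  have "q * ((A - F * e) / (1 + 5 * e)) \<le> 2 * pi * \<delta>" unfolding eq using lower q0 by (intro mult_left_mono) auto
  moreover have "q * ((A - F * e) / (1 + 5 * e)) = (q / (1 + 5 * e)) * (A - F * e)" by simp
  moreover have "A - F * e - 20 * e * ((B + F) * l) \<le> (q / (1 + 5 * e)) * (A - F * e)" by (rule dev(2)[OF p2 X2])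
  moreover have "20 * e * ((B + F) * l) = 20 * (B + F) * (e * l)" by simp
  ultimately have lo: "A - F * e - 20 * (B + F) * (e * l) \<le> 2 * pi * \<delta>" by linarith
  have "E * e \<le> E * (e * l)" "F * e \<le> F * (e * l)" using EF el by (auto intro: mult_left_mono)
  moreover have "0 \<le> 12 * (B + E) * (e * l)" "0 \<le> 20 * (B + F) * (e * l)" "0 \<le> E * (e * l)" "0 \<le> F * (e * l)"
    using Bn EF el by auto
  ultimately have "\<bar>2 * pi * \<delta> - A\<bar> \<le> 12 * (B + E) * (e * l) + E * (e * l) + 20 * (B + F) * (e * l) + F * (e * l)"
    using u lo by (simp add: abs_le_iff)
  then show ?thesis by (simp add: distrib_right)
qed

theorem proposition7:
  fixes n :: nat
  assumes "n \<ge> 3"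
  shows "\<exists>\<eta>::real. \<forall>(\<gamma> :: real \<Rightarrow> real \<Rightarrow> real \<times> real) (L :: real \<Rightarrow> real).
           (\<forall>\<epsilon>\<in>param_interval n. arclength_param (Q n \<epsilon>) (L \<epsilon>) (\<gamma> \<epsilon>)) \<longrightarrow>
           (\<lambda>\<epsilon>. 2 * pi * delta (L \<epsilon>) (\<gamma> \<epsilon>) - (\<bar>ln \<epsilon>\<bar> / real n + \<eta>))
             \<in> O[at 0 within param_interval n](\<lambda>\<epsilon>. \<epsilon> powr (2 / real n) * ln \<epsilon>)"
proof -
  define m where "m = n - 2"
  have mm: "1 \<le> m" "n = m + 2" using assms by (auto simp: m_def)
  define cm where "cm = 2 / real m"
  define am where "am = (real m + 1) * real m / 2"
  define N where "N = real n"
  have N: "N = real m + 2" "3 \<le> N" using mm by (auto simp: N_def)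
  have cm: "0 < cm" using mm by (simp add: cm_def)
  obtain D where D: "0 \<le> D" "\<And>r s. r \<in> {0..1} \<Longrightarrow> s \<in> {0..1} \<Longrightarrow> \<bar>defect_integral cm r - defect_integral cm s\<bar> \<le> D * \<bar>r - s\<bar>"
    using defect_integral_lipschitz[OF cm] by blast
  define \<eta> where "\<eta> = ln 2 + (- ln am - defect_integral cm 1) / N"
  define \<Gamma> where "\<Gamma> = N ^ 3 * 4 ^ (m + 4)"
  have \<Gamma>1: "1 \<le> \<Gamma>"
  proof -
    have "1 * 1 \<le> N ^ 3 * 4 ^ (m + 4)" using N(2) by (intro mult_mono one_le_power) auto
    then show ?thesis by (simp add: \<Gamma>_def)
  qed
  \<comment> \<open>for \<open>\<beta> \<le> b0\<close> both \<open>err \<le> 1/100\<close> and the bound on \<open>err \<bar>ln \<epsilon>\<bar>\<close> required for \<open>k \<noteq> 0\<close> hold, the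
     latter because \<open>\<beta> \<bar>ln \<epsilon>\<bar> \<le> N\<close>\<close>
  define b0 where "b0 = 1 / (100 * \<Gamma> * N)"
  have b0: "0 < b0" using \<Gamma>1 N by (simp add: b0_def)
  define E where "E = 1 / N + 1 + 3 * D / N"
  define F where "F = 2 / N"
  have EF: "0 \<le> E" "0 \<le> F" using D(1) N by (auto simp: E_def F_def)
  define B where "B = 1 + \<bar>\<eta>\<bar>"
  define R where "R = (12 * (B + E) + E + 20 * (B + F) + F) * \<Gamma>"
  have "(\<lambda>\<epsilon>. 2 * pi * delta (L \<epsilon>) (\<gamma> \<epsilon>) - (\<bar>ln \<epsilon>\<bar> / real n + \<eta>))
             \<in> O[at 0 within param_interval n](\<lambda>\<epsilon>. \<epsilon> powr (2 / real n) * ln \<epsilon>)"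
    if arc: "\<forall>\<epsilon>\<in>param_interval n. arclength_param (Q n \<epsilon>) (L \<epsilon>) (\<gamma> \<epsilon>)"
    for \<gamma> :: "real \<Rightarrow> real \<Rightarrow> real \<times> real" and L :: "real \<Rightarrow> real"
  proof (rule bigoI[of _ R])
    have est: "norm (2 * pi * delta (L \<epsilon>) (\<gamma> \<epsilon>) - (\<bar>ln \<epsilon>\<bar> / real n + \<eta>)) \<le> R * norm (\<epsilon> powr (2 / real n) * ln \<epsilon>)"
      if eps: "\<epsilon> \<in> param_interval n" "\<epsilon> < b0 ^ n" for \<epsilon>
    proof -
      have \<epsilon>0: "0 < \<epsilon>" using eps(1) by (simp add: param_interval_def)
      define \<beta> where "\<beta> = \<epsilon> powr (1 / N)"
      have \<beta>0: "0 < \<beta>" using \<epsilon>0 by (simp add: \<beta>_def)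
      have \<beta>n: "\<beta> ^ n = \<epsilon>"
        using \<epsilon>0 N by (simp add: \<beta>_def N_def powr_powr flip: powr_realpow)
      have \<beta>2: "\<beta>\<^sup>2 = \<epsilon> powr (2 / N)" 
        using \<epsilon>0 by (simp add: \<beta>_def powr_powr flip: powr_numeral)
      have \<beta>b: "\<beta> \<le> b0" using eps(2) \<beta>n b0 power_less_imp_less_base[of \<beta> n b0] by simp
      have G\<beta>: "\<Gamma> * \<beta> \<le> 1 / (100 * N)"
      proof -
        have "\<Gamma> * \<beta> \<le> \<Gamma> * b0" using \<beta>b \<Gamma>1 by (intro mult_left_mono) auto
        also have "\<dots> = 1 / (100 * N)" using \<Gamma>1 by (simp add: b0_def)
        finally show ?thesis .
      qed
      have "1 / (100 * N) \<le> 1 / 100" using N by (intro divide_left_mono) auto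
      then have G1: "\<Gamma> * \<beta> \<le> 1/100" using G\<beta> by linarith
      have "1 * \<beta> \<le> \<Gamma> * \<beta>" using \<Gamma>1 \<beta>0 by (intro mult_right_mono) auto
      then have \<beta>1: "\<beta> \<le> 1/100" using G1 by simp
      have NG: "N * (\<Gamma> * \<beta>) \<le> 1/100" using G\<beta> N by (simp add: field_simps)
      interpret curve m \<beta> by unfold_locales (use mm \<beta>0 in auto)
      have \<beta>m: "\<beta> ^ (m + 2) = \<epsilon>" using \<beta>n unfolding mm(2) .
      have cn4: "curve.\<epsilon> m \<beta> = \<epsilon>" unfolding curve.\<epsilon>_def[OF curve_axioms] by (rule \<beta>m)
      have cn: "curve.n m = N" "curve.c m = cm" "curve.a m = am" "curve.\<epsilon> m \<beta> = \<epsilon>" "err = \<Gamma> * \<beta>\<^sup>2"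
        using mm cn4 by (simp_all add: n_def N(1) c_def cm_def a_def am_def err_def \<Gamma>_def)
      have bb: "\<beta>\<^sup>2 \<le> \<beta>" using \<beta>0 \<beta>1 by (simp add: power2_eq_square mult_left_le)
      have e: "err \<le> 1/100"
      proof -
        have "\<Gamma> * \<beta>\<^sup>2 \<le> \<Gamma> * \<beta>" using bb \<Gamma>1 by (intro mult_left_mono) auto
        then show ?thesis using G1 by (simp add: cn)
      qed
      interpret small_curve m \<beta> by unfold_locales (rule e)
      interpret arclength_curve m \<beta> "\<gamma> \<epsilon>" "L \<epsilon>"
        by unfold_locales (use arc eps(1) mm cn(4) in simp)
      define l where "l = - ln \<epsilon>"
      have \<epsilon>small: "\<epsilon> \<le> 1/100"
      proof -
        have "\<beta> ^ n \<le> \<beta> ^ 1" using \<beta>0 \<beta>1 mm by (intro power_decreasing) auto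
        then show ?thesis using \<beta>1 \<beta>n by simp
      qed
      have l1: "1 \<le> l"
      proof -
        have "exp (1::real) * \<epsilon> \<le> 3 * (1/100)" using \<epsilon>small \<epsilon>0 exp_le by (intro mult_mono) auto
        then have "\<epsilon> \<le> exp (-1)" by (simp add: exp_minus field_simps)
        then have "ln \<epsilon> \<le> ln (exp (-1))" using \<epsilon>0 by (subst ln_le_cancel_iff) auto
        then show ?thesis by (simp add: l_def)
      qed
      have l2: "l * \<beta> \<le> N"
      proof -
        have "ln (1 / \<epsilon>) \<le> (1 / \<epsilon>) powr (1 / N) / (1 / N)" using \<epsilon>0 \<epsilon>small N by (intro ln_powr_bound) (auto simp: field_simps)
        moreover have "(1 / \<epsilon>) powr (1 / N) = 1 / \<beta>" using \<epsilon>0 by (simp add: \<beta>_def powr_divide)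
        ultimately have "l \<le> N / \<beta>" using \<epsilon>0 by (simp add: l_def ln_div)
        then show ?thesis using \<beta>0 by (simp add: field_simps)
      qed
      have small: "curve.n m * err * (- ln r0 / curve.n m) \<le> 1/5"
      proof -
        have "ln r0 = ln am + ln \<epsilon> - N * ln 2 - ln (1 - err)"
          using a_ge_1 \<epsilon>0 e by (simp add: r0_def cn ln_div ln_mult ln_realpow N(1) del: power_Suc)
        moreover have "0 \<le> ln am" using a_ge_1 by (simp add: cn)
        moreover have "ln (1 - err) \<le> 0" using err_pos e by simp
        ultimately have "- ln r0 \<le> l + N * ln 2" by (simp add: l_def)
        then have "err * (- ln r0) \<le> err * (l + N * ln 2)" using err_pos by (intro mult_left_mono) auto
        also have "\<dots> = \<Gamma> * \<beta> * (l * \<beta>) + \<Gamma> * \<beta> * (\<beta> * (N * ln 2))" by (simp add: cn power2_eq_square algebra_simps)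
        also have "\<dots> \<le> \<Gamma> * \<beta> * N + \<Gamma> * \<beta> * (1 * (N * 1))"
          using l2 \<Gamma>1 \<beta>0 \<beta>1 N ln2_le_25_over_36 by (intro add_mono mult_left_mono mult_mono) auto
        also have "\<dots> \<le> 1/5" using NG by (simp add: mult_ac)
        finally have "err * (- ln r0) \<le> 1/5" .
        moreover have "curve.n m * err * (- ln r0 / curve.n m) = err * (- ln r0)" using N by (simp add: cn)
        ultimately show ?thesis by simp
      qed
      have D': "\<bar>defect_integral (curve.c m) r - defect_integral (curve.c m) s\<bar> \<le> D * \<bar>r - s\<bar>" if "r \<in> {0..1}" "s \<in> {0..1}" for r s
        unfolding cn by (rule D(2)[OF that])
      note db = delta_bounds[OF small D(1) D']
      define A where "A = l / N + \<eta>"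
      have A_eq: "ln 2 + (- ln \<epsilon> - ln am - defect_integral cm 1) / N = A"
        by (simp add: A_def \<eta>_def l_def add_divide_distrib diff_divide_distrib)
      have "\<bar>2 * pi * delta (L \<epsilon>) (\<gamma> \<epsilon>) - A\<bar> \<le> (12 * (B + E) + E + 20 * (B + F) + F) * (err * l)"
      proof (rule rescaled_estimate[OF err_pos e l1])
        show "0 < C_const (L \<epsilon>) (\<gamma> \<epsilon>)" by (rule db(1))
        show "(1 - 10 * err) * C_const (L \<epsilon>) (\<gamma> \<epsilon>) \<le> 2 * pi" by (rule db(2))
        show "2 * pi \<le> (1 + 10 * err) * C_const (L \<epsilon>) (\<gamma> \<epsilon>)" by (rule db(3))
        show "\<bar>A\<bar> \<le> B * l"
        proof -
          have "l / N \<le> l / 1" using l1 N by (intro divide_left_mono) auto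
          moreover have "0 \<le> l / N" using l1 N by simp
          moreover have "\<bar>\<eta>\<bar> * 1 \<le> \<bar>\<eta>\<bar> * l" using l1 by (intro mult_left_mono) auto
          moreover have "\<bar>A\<bar> \<le> \<bar>l / N\<bar> + \<bar>\<eta>\<bar>" unfolding A_def by (rule abs_triangle_ineq)
          ultimately show ?thesis by (simp add: B_def algebra_simps)
        qed
        show "(A - F * err) / (1 + 5 * err) \<le> C_const (L \<epsilon>) (\<gamma> \<epsilon>) * delta (L \<epsilon>) (\<gamma> \<epsilon>)"
          using db(4) unfolding cn(1-4) A_eq by (simp add: F_def)
        have AE: "A + err / N + err + 3 * D * err / N = A + E * err" by (simp add: E_def field_simps)
        show "C_const (L \<epsilon>) (\<gamma> \<epsilon>) * delta (L \<epsilon>) (\<gamma> \<epsilon>) \<le> (1 + err) * (A + E * err)"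
          using db(5) unfolding cn(1-4) A_eq AE .
      qed (rule EF)+
      also have "\<dots> = R * norm (\<epsilon> powr (2 / real n) * ln \<epsilon>)"
        using l1 \<epsilon>0 by (simp add: R_def cn(5) \<beta>2 N_def l_def abs_mult)
      finally show ?thesis using l1 by (simp add: A_def l_def N_def)
    qed
    show "\<forall>\<^sub>F \<epsilon> in at 0 within param_interval n.
        norm (2 * pi * delta (L \<epsilon>) (\<gamma> \<epsilon>) - (\<bar>ln \<epsilon>\<bar> / real n + \<eta>)) \<le> R * norm (\<epsilon> powr (2 / real n) * ln \<epsilon>)"
      unfolding eventually_at
      by (rule exI[of _ "b0 ^ n"]) (use b0 est in \<open>auto simp: dist_real_def simp del: real_norm_def\<close>)
  qed
  then show ?thesis by blast
qed

end
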